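(* We have $$\sum_{T\ge 1}\frac1T\big(B_{T,\pi/3}\big)^3<\infty .$$ As a consequence, $B_{T,\pi/3}\to 0$ as $T\to\infty$. Moreover $B_{T,\pi/3}<1/(\log T)^{1/3}$ for infinitely many values of $T$.
   Context: Tiling. $\mathbb{H}(\pi/3)$ is the right half-plane tiled by rhombi $r_{k,j}$ of side length $1$ (column $k\ge 1$, row $j\in\mathbb{Z}$). Each rhombus has two vertical sides $W$ (left) and $E$ (right), and two other sides $N$ (top) and $S$ (bottom); the upper-left angle (between $W$ and $N$) of every rhombus is $\pi/3$. The $E$ side of $r_{k,j}$ is the $W$ side of $r_{k+1,j}$ and the $N$ side of $r_{k,j}$ is the $S$ side of $r_{k,j+1}$. The left boundary is a vertical line and the midpoint of the $W$ side of $r_{1,j}$ is the point $(0,j)$. For $T\ge1$, $\mathrm{Strip}_T(\pi/3)$ is the strip formed of columns $1,\dots,T$. Splitting every rhombus along its short diagonal into two unit equilateral triangles turns this tiling into a (half-plane) triangular lattice. Walks. A self-avoiding walk is a simple curve starting and ending at midpoints of sides of the rhombi, which crosses the edges of the triangular lattice only at their midpoints and whose intersection with each unit triangle is either empty or a single arc joining the midpoints of two of its sides (passing to the neighbouring triangle each time it crosses an edge). Equivalently, it is a self-avoiding walk between mid-edges of the hexagonal lattice dual to the triangular lattice. Its length $|\gamma|$ is the number of triangles it traverses and its weight is $\mathrm{w}(\gamma)=(2+\sqrt2)^{-|\gamma|/2}$. Bridges. A bridge of width $T$ is a self-avoiding walk in $\mathrm{Strip}_T(\pi/3)$ starting at $0=(0,0)$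 and ending at the midpoint of an edge of the right boundary of the strip (an $E$ side of a rhombus of column $T$). $B_{T,\pi/3}=\sum_\gamma \mathrm{w}(\gamma)$, the sum being over all bridges of width $T$. *)

theory Defs
  imports "HOL-Analysis.Analysis"
begin

(* The rhombus r_{k,j} (column k >= 1, row j) has corners
     SW = vertex k j,        NW = vertex k (j + 1),
     SE = vertex (k + 1) j,  NE = vertex (k + 1) (j + 1).
   The N and S sides point in the direction obtained by rotating the downward W side
   anticlockwise by pi/3, so the angle at NW is pi/3; the midpoint of W in r_{1,j} is (0, j). *)
definition vertex :: "nat \<Rightarrow> int \<Rightarrow> complex" where
  "vertex k j = \<i> * of_real (of_int j - 1 / 2) + of_real (real k - 1) * (- \<i> * cis (pi / 3))"

definition mid_W :: "nat \<Rightarrow> int \<Rightarrow> complex" where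
  "mid_W k j = midpoint (vertex k j) (vertex k (j + 1))"

definition mid_E :: "nat \<Rightarrow> int \<Rightarrow> complex" where
  "mid_E k j = midpoint (vertex (k + 1) j) (vertex (k + 1) (j + 1))"

definition mid_S :: "nat \<Rightarrow> int \<Rightarrow> complex" where
  "mid_S k j = midpoint (vertex k j) (vertex (k + 1) j)"

definition mid_N :: "nat \<Rightarrow> int \<Rightarrow> complex" where
  "mid_N k j = midpoint (vertex k (j + 1)) (vertex (k + 1) (j + 1))"

definition rhombus_side_midpoints :: "complex set" where
  "rhombus_side_midpoints =
     (\<Union>k\<in>{1..}. \<Union>j. {mid_W k j, mid_E k j, mid_S k j, mid_N k j})"

(* A unit triangle is represented by its set of three corners. The short diagonal joins
   SW to NE, the two corners with angle 2 pi/3. *)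
definition triangle_WN :: "nat \<Rightarrow> int \<Rightarrow> complex set" where
  "triangle_WN k j = {vertex k j, vertex k (j + 1), vertex (k + 1) (j + 1)}"

definition triangle_SE :: "nat \<Rightarrow> int \<Rightarrow> complex set" where
  "triangle_SE k j = {vertex k j, vertex (k + 1) j, vertex (k + 1) (j + 1)}"

definition column_triangles :: "nat \<Rightarrow> complex set set" where
  "column_triangles k = range (triangle_WN k) \<union> range (triangle_SE k)"

definition half_plane :: "complex set set" where
  "half_plane = (\<Union>k\<in>{1..}. column_triangles k)"

definition strip :: "nat \<Rightarrow> complex set set" where
  "strip T = (\<Union>k\<in>{1..T}. column_triangles k)"

definition side_midpoints :: "complex set \<Rightarrow> complex set" where
  "side_midpoints t = {midpoint a b |a b. a \<in> t \<and> b \<in> t \<and> a \<noteq> b}"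

(* A walk (ps, ts) is recorded by the edge midpoints ps = [p_0, ..., p_n] it visits and the
   triangles ts = [t_1, ..., t_n] it traverses, t_i being traversed from p_(i-1) to p_i.
   Consecutive triangles are distinct and share p_i, so the walk crosses into the neighbouring
   triangle at p_i. Distinctness of ps only adds that the curve is not closed. *)
definition self_avoiding_walk :: "complex list \<times> complex set list \<Rightarrow> bool" where
  "self_avoiding_walk \<gamma> \<longleftrightarrow> (case \<gamma> of (ps, ts) \<Rightarrow>
     length ps = length ts + 1 \<and>
     set ts \<subseteq> half_plane \<and>
     (\<forall>i < length ts. ps ! i \<in> side_midpoints (ts ! i) \<and>
                       ps ! (i + 1) \<in> side_midpoints (ts ! i)) \<and>
     distinct ps \<and> distinct ts \<and>
     hd ps \<in> rhombus_side_midpoints \<and> last ps \<in> rhombus_side_midpoints)"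

definition walk_length :: "complex list \<times> complex set list \<Rightarrow> nat" where
  "walk_length \<gamma> = length (snd \<gamma>)"

definition weight :: "complex list \<times> complex set list \<Rightarrow> real" where
  "weight \<gamma> = (2 + sqrt 2) powr (- real (walk_length \<gamma>) / 2)"

definition bridges :: "nat \<Rightarrow> (complex list \<times> complex set list) set" where
  "bridges T = {(ps, ts). self_avoiding_walk (ps, ts) \<and> set ts \<subseteq> strip T \<and>
                          hd ps = 0 \<and> last ps \<in> range (mid_E T)}"

(* A sum over infinitely many bridges, taken in [0, \<infinity>] so that no convergence is presupposed. *)
definition bridge_sum :: "nat \<Rightarrow> ennreal" where
  "bridge_sum T = (\<Sum>\<^sub>\<infinity>\<gamma>\<in>bridges T. ennreal (weight \<gamma>))"

end

(* Walks are encoded by their turns (1 = left, -1 = right). With x = 1 / sqrt (2 + sqrt 2), the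
   function x^n * cis (pi / 8 * sum of the turns) on walks of length n equals the sum of its values
   on the two extensions of the walk. In a finite domain the total over the walks that cannot be
   extended is thus 1. Those blocked by one of their own vertices cancel in pairs, by reversal of
   the loop that they close, which leaves the walks that end on the boundary.

   Applied to a trapezoid this gives bridge_sum T <= D T := 1 - cos (3 * pi / 8) * A T, where A T is
   the weight of the walks in the strip that return to its left side, and D is decreasing. Applied
   to an equilateral triangle with a vertical left side it shows that the walks from the middle of
   that side to the upper right side have weight at least x * D. Three such walks, in triangles that
   share a vertex and fill half a turn around it, form a walk that returns to the left side. If the
   first triangle has size 9^k, then the end point has height between 9^k and 9^(k + 1). Hence the
   walks obtained for different k are distinct, and the sum over k of D (8 * 9^k)^3 is finite. *)

theory Submission imports Defs begin

text \<open>A full turn multiplies the phase by \<open>cis (6 * pi / 8)\<close>, which is not 1, so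
  the direction of the last edge does not determine the phase: the winding has to be known as an
  integer. This question of plane topology arises twice, for the loops that are reversed and for the
  walks that reach the boundary. Both cases rest on a discrete form of Hopf's turning number
  theorem. It takes the place of the Jordan curve theorem because every walk starts at an extreme
  point of its domain: seen from there a loop lies in a half-plane and cannot wind, and this is
  carried along the walk up to the loop. The geometric input is that two lattice edges without a
  common vertex are strictly separated by a line.

  The exponent 3 is the number of sectors of angle pi / 3 in a half-plane. Each exit at most doubles
  the size of the next triangle, so three steps from size N stay within strips of width 8 N and end
  at a height below N + 8 N: this is the origin of 8 and 9. All walks that return to the left side
  together weigh at most \<open>1 / ca\<close>, which bounds the sum over k.\<close>

section \<open>Walks as lists of turns\<close>

text \<open>The pair \<open>(a, b)\<close> stands for \<open>a + b * cis (pi / 3)\<close>, and the edges of the hexagonal lattice have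
  length \<open>2\<close>, so that edge midpoints are lattice points as well.\<close>

definition unit_dir :: "int \<Rightarrow> int \<times> int" where
  "unit_dir d = (let k = d mod 6 in
     if k = 0 then (1, 0) else if k = 1 then (0, 1) else if k = 2 then (-1, 1)
     else if k = 3 then (-1, 0) else if k = 4 then (0, -1) else (1, -1))"

text \<open>Multiplication by \<open>cis (pi / 3)\<close>, whose square is
  \<open>cis (pi / 3) - 1\<close>.\<close>

definition rot :: "int \<times> int \<Rightarrow> int \<times> int" where
  "rot z = (- snd z, fst z + snd z)"

text \<open>Complex conjugation, the reflection that exchanges left and right turns.\<close>

definition flip :: "int \<times> int \<Rightarrow> int \<times> int" where
  "flip z = (fst z + snd z, - snd z)"

lemma mod6_cases:
  fixes d :: int
  obtains "d mod 6 = 0" | "d mod 6 = 1" | "d mod 6 = 2" | "d mod 6 = 3" | "d mod 6 = 4" | "d mod 6 = 5"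
proof -
  have "0 \<le> d mod 6" "d mod 6 < 6" by auto
  then have "d mod 6 = 0 \<or> d mod 6 = 1 \<or> d mod 6 = 2 \<or> d mod 6 = 3 \<or> d mod 6 = 4 \<or> d mod 6 = 5"
    by presburger
  then show thesis by (elim disjE) (erule that)+
qed

lemma unit_dir_simps:
  "d mod 6 = 0 \<Longrightarrow> unit_dir d = (1, 0)" "d mod 6 = 1 \<Longrightarrow> unit_dir d = (0, 1)"
  "d mod 6 = 2 \<Longrightarrow> unit_dir d = (-1, 1)" "d mod 6 = 3 \<Longrightarrow> unit_dir d = (-1, 0)"
  "d mod 6 = 4 \<Longrightarrow> unit_dir d = (0, -1)" "d mod 6 = 5 \<Longrightarrow> unit_dir d = (1, -1)"
  by (simp_all add: unit_dir_def)

lemma unit_dir_mod: "unit_dir (d mod 6) = unit_dir d"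
  by (simp add: unit_dir_def)

lemma unit_dir_cong: "d mod 6 = e mod 6 \<Longrightarrow> unit_dir d = unit_dir e"
  by (metis unit_dir_mod)

lemma unit_dir_0 [simp]: "unit_dir 0 = (1, 0)"
  by (simp add: unit_dir_def)

lemma rot_unit_dir: "rot (unit_dir d) = unit_dir (d + 1)"
proof -
  have "(d + 1) mod 6 = (d mod 6 + 1) mod 6" by presburger
  then show ?thesis
    by (cases d rule: mod6_cases) (simp_all add: unit_dir_simps rot_def)
qed

lemma flip_unit_dir: "flip (unit_dir d) = unit_dir (- d)"
proof -
  have "(- d) mod 6 = (- (d mod 6)) mod 6" by (simp add: mod_minus_eq)
  then show ?thesis
    by (cases d rule: mod6_cases) (simp_all add: unit_dir_simps flip_def)
qed

lemma unit_dir_add3: "unit_dir (d + 3) = - unit_dir d"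
proof -
  have "(d + 3) mod 6 = (d mod 6 + 3) mod 6" by presburger
  then show ?thesis
    by (cases d rule: mod6_cases) (simp_all add: unit_dir_simps)
qed

lemma unit_dir_inj: "unit_dir d = unit_dir e \<longleftrightarrow> d mod 6 = e mod 6"
  by (cases d rule: mod6_cases; cases e rule: mod6_cases) (simp_all add: unit_dir_simps)

lemma rot_add: "rot (z + z') = rot z + rot z'"
  by (simp add: rot_def)

lemma flip_add: "flip (z + z') = flip z + flip z'"
  by (simp add: flip_def)

lemma rot_inj: "rot z = rot z' \<longleftrightarrow> z = z'"
  by (auto simp: rot_def prod_eq_iff)

lemma flip_inj: "flip z = flip z' \<longleftrightarrow> z = z'"
  by (auto simp: flip_def prod_eq_iff)

text \<open>Vertices visited by the walk that leaves the edge midpoint \<open>m\<close> in direction \<open>d\<close> and takes the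
  turns \<open>t\<close>. Directions are not reduced modulo \<open>6\<close>, hence \<open>sum_list t\<close> is the winding.\<close>

primrec verts :: "int \<times> int \<Rightarrow> int \<Rightarrow> int list \<Rightarrow> (int \<times> int) list" where
  "verts m d [] = []"
| "verts m d (s # t) = (m + unit_dir d) # verts (m + unit_dir d + unit_dir (d + s)) (d + s) t"

primrec endpos :: "int \<times> int \<Rightarrow> int \<Rightarrow> int list \<Rightarrow> int \<times> int" where
  "endpos m d [] = m"
| "endpos m d (s # t) = endpos (m + unit_dir d + unit_dir (d + s)) (d + s) t"

lemma verts_append:
  "verts m d (t @ t') = verts m d t @ verts (endpos m d t) (d + sum_list t) t'"
  by (induction t arbitrary: m d) (simp_all add: add.assoc)

lemma endpos_append:
  "endpos m d (t @ t') = endpos (endpos m d t) (d + sum_list t) t'"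
  by (induction t arbitrary: m d) (simp_all add: add.assoc)

lemma length_verts [simp]: "length (verts m d t) = length t"
  by (induction t arbitrary: m d) simp_all

lemma verts_cong: "d mod 6 = e mod 6 \<Longrightarrow> verts m d t = verts m e t"
proof (induction t arbitrary: m d e)
  case (Cons s t)
  have e: "(d + s) mod 6 = (e + s) mod 6" using Cons.prems by (metis mod_add_left_eq)
  show ?case
    using Cons.IH[OF e] unit_dir_cong[OF Cons.prems] unit_dir_cong[OF e] by simp
qed simp

lemma endpos_cong: "d mod 6 = e mod 6 \<Longrightarrow> endpos m d t = endpos m e t"
proof (induction t arbitrary: m d e)
  case (Cons s t)
  have e: "(d + s) mod 6 = (e + s) mod 6" using Cons.prems by (metis mod_add_left_eq)
  show ?case
    using Cons.IH[OF e] unit_dir_cong[OF Cons.prems] unit_dir_cong[OF e] by simp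
qed simp

lemma verts_rot: "verts (p + rot m) (d + 1) t = map (\<lambda>z. p + rot z) (verts m d t)"
proof (induction t arbitrary: m d)
  case (Cons s t)
  have e: "p + rot m + unit_dir (d + 1) = p + rot (m + unit_dir d)"
    by (simp add: rot_add rot_unit_dir add.assoc)
  have e2: "p + rot m + unit_dir (d + 1) + unit_dir (d + s + 1) = p + rot (m + unit_dir d + unit_dir (d + s))"
    by (simp add: rot_add rot_unit_dir add.assoc)
  have e3: "d + 1 + s = d + s + 1" by simp
  show ?case using Cons[of "m + unit_dir d + unit_dir (d + s)" "d + s"]
    by (simp only: verts.simps e3 e2 list.map) (simp only: e)
qed simp

lemma endpos_rot: "endpos (p + rot m) (d + 1) t = p + rot (endpos m d t)"
proof (induction t arbitrary: m d)
  case (Cons s t)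
  have e2: "p + rot m + unit_dir (d + 1) + unit_dir (d + s + 1) = p + rot (m + unit_dir d + unit_dir (d + s))"
    by (simp add: rot_add rot_unit_dir add.assoc)
  have e3: "d + 1 + s = d + s + 1" by simp
  show ?case using Cons[of "m + unit_dir d + unit_dir (d + s)" "d + s"]
    by (simp only: endpos.simps e3 e2)
qed simp

lemma verts_flip: "verts (flip m) (- d) (map uminus t) = map flip (verts m d t)"
proof (induction t arbitrary: m d)
  case (Cons s t)
  have e3: "- d + - s = - (d + s)" by simp
  show ?case using Cons[of "m + unit_dir d + unit_dir (d + s)" "d + s"]
    by (simp only: verts.simps list.map e3 flip_add flip_unit_dir)
qed simp

lemma endpos_flip: "endpos (flip m) (- d) (map uminus t) = flip (endpos m d t)"
proof (induction t arbitrary: m d)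
  case (Cons s t)
  have e3: "- d + - s = - (d + s)" by simp
  show ?case using Cons[of "m + unit_dir d + unit_dir (d + s)" "d + s"]
    by (simp only: endpos.simps list.map e3 flip_add flip_unit_dir)
qed simp

text \<open>Running a walk backwards reverses the order of the turns and their signs. The reversal
  of loops rests on this.\<close>

lemma verts_endpos_rev:
  "verts (endpos m d t) (d + sum_list t + 3) (rev (map uminus t)) = rev (verts m d t) \<and>
   endpos (endpos m d t) (d + sum_list t + 3) (rev (map uminus t)) = m"
proof (induction t arbitrary: m d)
  case (Cons s t)
  let ?m = "m + unit_dir d + unit_dir (d + s)"
  have IH: "verts (endpos ?m (d + s) t) (d + s + sum_list t + 3) (rev (map uminus t)) = rev (verts ?m (d + s) t)"
    "endpos (endpos ?m (d + s) t) (d + s + sum_list t + 3) (rev (map uminus t)) = ?m"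
    using Cons[of ?m "d + s"] by auto
  have sl: "sum_list (rev (map uminus t)) = - sum_list t"
    by (induction t) simp_all
  have sc: "d + sum_list (s # t) + 3 = d + s + sum_list t + 3" by simp
  have "d + 3 + s = d + s + 3" by simp
  then have u1: "unit_dir (d + s + 3) = - unit_dir (d + s)" "unit_dir (d + 3) = - unit_dir d"
    by (simp_all add: unit_dir_add3)
  have d1: "d + s + sum_list t + 3 + sum_list (rev (map uminus t)) = d + s + 3" "d + s + 3 + - s = d + 3"
    using sl by simp_all
  show ?case
    unfolding sc list.map rev.simps verts_append endpos_append verts.simps endpos.simps IH d1 u1
    by simp
qed simp

section \<open>Turning numbers of polygonal paths\<close>

text \<open>In general the two sides differ by a multiple of 2 pi. The factor \<open>e\<close> turns
  the half-plane to the right one, where the two arguments differ by less than pi, so the multiple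
  is 0. One point may lie on the boundary line: the tip of a walk that leaves through the left side
  is level with the vertex behind its start.\<close>

lemma Arg_divide_half_plane:
  assumes "Re (w * e) \<ge> 0" "Re (z * e) \<ge> 0" "Re (w * e) > 0 \<or> Re (z * e) > 0" "w \<noteq> 0" "z \<noteq> 0"
  shows "Arg (z / w) = Arg (z * e) - Arg (w * e)"
proof -
  have e: "e \<noteq> 0" using assms by auto
  have "\<bar>Arg (w * e)\<bar> \<le> pi / 2" "\<bar>Arg (z * e)\<bar> \<le> pi / 2"
    using assms by (simp_all only: Arg_Re_nonneg)
  moreover have "\<bar>Arg (w * e)\<bar> < pi / 2 \<or> \<bar>Arg (z * e)\<bar> < pi / 2"
    using assms(3) by (simp only: Arg_Re_pos) blast
  ultimately have "- pi < Arg (z * e) - Arg (w * e)" "Arg (z * e) - Arg (w * e) < pi"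
    by linarith+
  then have "Arg ((z * e) / (w * e)) = Arg (z * e) - Arg (w * e)"
    using assms(4,5) e by (subst Arg_divide') auto
  then show ?thesis using e by simp
qed

text \<open>Strict separation by a line, stated through the secants: all differences
  \<open>p - q\<close> lie in one open half-plane, which is what the additivity of
  \<open>Arg\<close> requires.\<close>

definition seg_sep :: "complex \<Rightarrow> complex \<Rightarrow> complex \<Rightarrow> complex \<Rightarrow> bool" where
  "seg_sep x x' y y' \<longleftrightarrow> (\<exists>e. \<forall>p\<in>{x, x'}. \<forall>q\<in>{y, y'}. Re ((p - q) * e) > 0)"

lemma seg_sep_swap:
  "seg_sep x x' y y' \<Longrightarrow> seg_sep x' x y y'" "seg_sep x x' y y' \<Longrightarrow> seg_sep x x' y' y"
  by (auto simp: seg_sep_def)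

lemma seg_sep_sym: assumes "seg_sep x x' y y'" shows "seg_sep y y' x x'"
proof -
  obtain e where "\<forall>p\<in>{x, x'}. \<forall>q\<in>{y, y'}. Re ((p - q) * e) > 0"
    using assms by (auto simp: seg_sep_def)
  then have "\<forall>p\<in>{y, y'}. \<forall>q\<in>{x, x'}. Re ((p - q) * (- e)) > 0"
    by (auto simp: algebra_simps)
  then show ?thesis unfolding seg_sep_def by blast
qed

text \<open>The half-plane containing the four secants carries one branch of the argument; both
  sides are the same alternating sum of its four values.\<close>

lemma Arg_square:
  assumes "seg_sep z z' w w'"
  shows "Arg ((z' - w') / (z - w')) - Arg ((z' - w) / (z - w)) =
         Arg ((z' - w') / (z' - w)) - Arg ((z - w') / (z - w))"
proof -
  obtain e where e: "\<forall>p\<in>{z, z'}. \<forall>q\<in>{w, w'}. Re ((p - q) * e) > 0"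
    using assms by (auto simp: seg_sep_def)
  have *: "Arg (p / q) = Arg (p * e) - Arg (q * e)" if "Re (p * e) > 0" "Re (q * e) > 0" for p q
    by (rule Arg_divide_half_plane) (use that in auto)
  show ?thesis using e by (subst (1 2 3 4) *) auto
qed

definition wind :: "(nat \<Rightarrow> complex) \<Rightarrow> nat \<Rightarrow> nat \<Rightarrow> complex \<Rightarrow> real" where
  "wind z a b w = (\<Sum>i=a..<b. Arg ((z (Suc i) - w) / (z i - w)))"

lemma wind_self [simp]: "wind z a a w = 0"
  by (simp add: wind_def)

lemma wind_Suc: "a \<le> b \<Longrightarrow> wind z a (Suc b) w = wind z a b w + Arg ((z (Suc b) - w) / (z b - w))"
  by (simp add: wind_def)

lemma wind_Suc_left: "a < b \<Longrightarrow> wind z a b w = Arg ((z (Suc a) - w) / (z a - w)) + wind z (Suc a) b w"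
  by (simp add: wind_def sum.atLeast_Suc_lessThan)

text \<open>\<open>Arg_square\<close> is summed along the path. When the base point moves along a
  segment that the path avoids, only terms at the two ends remain.\<close>

lemma wind_move:
  assumes "a \<le> b" "\<And>i. a \<le> i \<Longrightarrow> i < b \<Longrightarrow> seg_sep (z i) (z (Suc i)) w w'"
  shows "wind z a b w' - wind z a b w = Arg ((z b - w') / (z b - w)) - Arg ((z a - w') / (z a - w))"
  using assms
proof (induction b rule: dec_induct)
  case (step b)
  then show ?case
    using Arg_square[OF step.prems[of b]] by (simp add: wind_Suc less_SucI)
qed simp

lemma wind_half_plane:
  assumes "a \<le> b" "\<And>i. a \<le> i \<Longrightarrow> i \<le> b \<Longrightarrow> Re ((z i - w) * e) \<ge> 0 \<and> z i \<noteq> w"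
    "\<And>i. a \<le> i \<Longrightarrow> i < b \<Longrightarrow> Re ((z i - w) * e) > 0 \<or> Re ((z (Suc i) - w) * e) > 0"
  shows "wind z a b w = Arg ((z b - w) * e) - Arg ((z a - w) * e)"
  using assms
proof (induction b rule: dec_induct)
  case (step b)
  have "Arg ((z (Suc b) - w) / (z b - w)) = Arg ((z (Suc b) - w) * e) - Arg ((z b - w) * e)"
    by (rule Arg_divide_half_plane) (use step.prems[of b] step.prems(1)[of "Suc b"] step.hyps in auto)
  then show ?case using step by (simp add: wind_Suc)
qed simp

lemma Arg_minus_divide: "Arg ((x - y) / (x - y')) = Arg ((y - x) / (y' - x))" for x y y' :: complex
  by (metis minus_diff_eq minus_divide_divide)

text \<open>Hopf's turning number argument: the total turning is the variation of the secant direction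
  along the diagonal of the triangle \<open>a \<le> i < j \<le> k + 1\<close>, which is pushed to its two legs.\<close>

lemma total_turning:
  assumes "a \<le> k"
    "\<And>i j. a \<le> i \<Longrightarrow> Suc i < j \<Longrightarrow> j \<le> k \<Longrightarrow> seg_sep (z i) (z (Suc i)) (z j) (z (Suc j))"
    "\<And>i. a \<le> i \<Longrightarrow> i < k \<Longrightarrow>
       Arg ((z (Suc (Suc i)) - z (Suc i)) / (z (Suc i) - z i)) =
       Arg ((z (Suc (Suc i)) - z i) / (z (Suc i) - z i)) +
       Arg ((z (Suc (Suc i)) - z (Suc i)) / (z (Suc (Suc i)) - z i))"
  shows "(\<Sum>i=a..<k. Arg ((z (Suc (Suc i)) - z (Suc i)) / (z (Suc i) - z i))) =
         wind z (Suc a) (Suc k) (z a) + wind z a k (z (Suc k))"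
  using assms
proof (induction k rule: dec_induct)
  case (step k)
  \<comment> \<open>The base point moves from \<open>z (Suc k)\<close> to
    \<open>z (Suc (Suc k))\<close>, past the path from \<open>z a\<close> to \<open>z k\<close>. The
    next segment shares the vertex \<open>z (Suc k)\<close> and cannot be separated; there the last
    hypothesis replaces the missing square.\<close>
  have "wind z a k (z (Suc (Suc k))) - wind z a k (z (Suc k)) =
      Arg ((z k - z (Suc (Suc k))) / (z k - z (Suc k))) - Arg ((z a - z (Suc (Suc k))) / (z a - z (Suc k)))"
    by (rule wind_move) (use step in auto)
  moreover have "wind z a (Suc k) (z (Suc (Suc k))) =
      wind z a k (z (Suc (Suc k))) + Arg ((z (Suc k) - z (Suc (Suc k))) / (z k - z (Suc (Suc k))))"
    using step by (intro wind_Suc) auto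
  moreover have "wind z (Suc a) (Suc (Suc k)) (z a) =
      wind z (Suc a) (Suc k) (z a) + Arg ((z (Suc (Suc k)) - z a) / (z (Suc k) - z a))"
    using step by (intro wind_Suc) auto
  moreover have "(\<Sum>i=a..<Suc k. Arg ((z (Suc (Suc i)) - z (Suc i)) / (z (Suc i) - z i))) =
     (\<Sum>i=a..<k. Arg ((z (Suc (Suc i)) - z (Suc i)) / (z (Suc i) - z i))) +
     Arg ((z (Suc (Suc k)) - z (Suc k)) / (z (Suc k) - z k))"
    using step by simp
  moreover have "Arg ((z (Suc (Suc k)) - z (Suc k)) / (z (Suc k) - z k)) =
       Arg ((z (Suc (Suc k)) - z k) / (z (Suc k) - z k)) +
       Arg ((z (Suc (Suc k)) - z (Suc k)) / (z (Suc (Suc k)) - z k))"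
    using step by simp
  moreover have "(\<Sum>i=a..<k. Arg ((z (Suc (Suc i)) - z (Suc i)) / (z (Suc i) - z i))) =
         wind z (Suc a) (Suc k) (z a) + wind z a k (z (Suc k))"
    by (rule step.IH) (use step.prems in auto)
  ultimately show ?case
    using Arg_minus_divide[of "z k" "z (Suc (Suc k))" "z (Suc k)"]
      Arg_minus_divide[of "z a" "z (Suc (Suc k))" "z (Suc k)"]
      Arg_minus_divide[of "z (Suc (Suc k))" "z (Suc k)" "z k"]
    by simp
qed simp

text \<open>The end terms of \<open>wind_move\<close> cancel against the closing edge: a winding
  number is the same at both ends of a segment disjoint from the closed path.\<close>

lemma winding_closed_move:
  assumes "a \<le> b" "\<And>i. a \<le> i \<Longrightarrow> i < b \<Longrightarrow> seg_sep (z i) (z (Suc i)) w w'"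
    and "seg_sep (z b) (z a) w w'"
  shows "wind z a b w' + Arg ((z a - w') / (z b - w')) = wind z a b w + Arg ((z a - w) / (z b - w))"
  using wind_move[of a b z w w'] assms Arg_square[OF assms(3)] by simp

section \<open>Angles at a turn by pi / 3\<close>

definition omega :: "int \<Rightarrow> complex" where
  "omega d = cis (of_int d * pi / 3)"

lemma omega_nonzero [simp]: "omega d \<noteq> 0"
  by (simp add: omega_def)

lemma one_plus_cis: "1 + cis t = of_real (2 * cos (t / 2)) * cis (t / 2)"
proof -
  have "cos t = 2 * (cos (t/2))\<^sup>2 - 1" "sin t = 2 * sin (t/2) * cos (t/2)"
    using cos_double_cos[of "t/2"] sin_double[of "t/2"] by simp_all
  then show ?thesis by (simp add: complex_eq_iff power2_eq_square)
qed

lemma omega_inverse: "omega s * omega (- s) = 1"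
  by (simp add: omega_def cis_mult)

lemma omega_minus_inverse:
  assumes "s = 1 \<or> s = - 1"
  shows "omega s + omega (- s) = 1"
  using assms by (auto simp: complex_eq_iff cos_60 omega_def)

lemma Arg_omega:
  assumes "s = 1 \<or> s = - 1"
  shows "Arg (omega s) = of_int s * pi / 3"
  unfolding omega_def by (rule Arg_cis) (use assms pi_gt_zero in auto)

text \<open>The sum of two unit vectors bisects the angle between them. These are the arguments of
  the secants across one turn.\<close>

lemma Arg_one_plus_omega:
  assumes "s = 1 \<or> s = - 1"
  shows "Arg (1 + omega s) = of_int s * pi / 6" "Arg (1 / (1 + omega s)) = - (of_int s * pi / 6)"
    "Arg (omega s / (1 + omega s)) = of_int s * pi / 6" "1 + omega s \<noteq> 0"
proof -
  have A: "Arg (1 + omega s) = of_int s * pi / 6" "1 + omega s \<noteq> 0"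
    if "s = 1 \<or> s = - 1" for s
  proof -
    have c: "cos (pi / 6) > 0" by (rule cos_gt_zero) (use pi_gt_zero in auto)
    have e: "1 + omega s = of_real (2 * cos (pi / 6)) * cis (of_int s * pi / 6)"
      using that by (auto simp: one_plus_cis omega_def)
    moreover have "Arg (cis (of_int s * pi / 6)) = of_int s * pi / 6"
      by (rule Arg_cis) (use that pi_gt_zero in auto)
    then have "Arg (of_real (2 * cos (pi / 6)) * cis (of_int s * pi / 6)) = of_int s * pi / 6"
      using c by (subst Arg_times_of_real) auto
    ultimately show "Arg (1 + omega s) = of_int s * pi / 6" by simp
    show "1 + omega s \<noteq> 0" using e c by simp
  qed
  have B: "Arg (1 / (1 + omega s)) = - (of_int s * pi / 6)" if "s = 1 \<or> s = - 1" for s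
  proof -
    have "\<bar>Arg (1 + omega s)\<bar> < pi" using A[OF that] that pi_gt_zero by (auto simp only: of_int_1)
    then have "Arg (1 / (1 + omega s)) = - Arg (1 + omega s)"
      using A(2)[OF that] by (subst Arg_divide') auto
    then show ?thesis using A[OF that] by simp
  qed
  show "Arg (1 + omega s) = of_int s * pi / 6" "1 + omega s \<noteq> 0"
    "Arg (1 / (1 + omega s)) = - (of_int s * pi / 6)"
    using A B assms by auto
  have ms: "- s = 1 \<or> - s = - 1" using assms by auto
  have "omega s / (1 + omega s) = 1 / (1 + omega (- s))"
    using omega_inverse[of s] A(2)[OF assms] A(2)[OF ms]
    by (simp add: frac_eq_eq distrib_left distrib_right add.commute)
  then show "Arg (omega s / (1 + omega s)) = of_int s * pi / 6"
    using B[OF ms] by simp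
qed

text \<open>The secant \<open>c - a\<close> splits a turn by pi / 3 into two equal halves. The
  second equation is the hypothesis of \<open>total_turning\<close> on consecutive edges.\<close>

lemma Arg_turn:
  assumes t: "\<tau> = 1 \<or> \<tau> = - 1" and "b \<noteq> a" and c: "c - b = (b - a) * omega \<tau>"
  shows "Arg ((c - b) / (b - a)) = of_int \<tau> * (pi / 3)"
    and "Arg ((c - b) / (b - a)) = Arg ((c - a) / (b - a)) + Arg ((c - b) / (c - a))"
proof -
  define h where "h = b - a"
  have h: "h \<noteq> 0" using assms by (simp add: h_def)
  have c2: "c - b = h * omega \<tau>" "c - a = h * (1 + omega \<tau>)"
    using c by (simp_all add: h_def algebra_simps)
  note B = Arg_one_plus_omega[OF t] Arg_omega[OF t]
  show "Arg ((c - b) / (b - a)) = of_int \<tau> * (pi / 3)"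
    "Arg ((c - b) / (b - a)) = Arg ((c - a) / (b - a)) + Arg ((c - b) / (c - a))"
    unfolding c2 h_def[symmetric] using h B by simp_all
qed

text \<open>The closed loop does not wind around \<open>z (i - 1)\<close>, which the initial part of the path joins to
  the extreme point \<open>z 0\<close> without meeting the loop. Moving the base point across the last edge to \<open>z i\<close>
  gives the winding around \<open>z i\<close>, which in turn determines the turning by Hopf's argument.\<close>

lemma loop_turning:
  fixes z :: "nat \<Rightarrow> complex" and s \<tau>' :: int
  assumes i: "1 \<le> i" "i + 2 \<le> n"
    and sep: "\<And>a b. Suc a < b \<Longrightarrow> b < n \<Longrightarrow> seg_sep (z a) (z (Suc a)) (z b) (z (Suc b))"
    and sepc: "\<And>a. a < n \<Longrightarrow> Suc a < i \<or> (i < a \<and> Suc a < n) \<Longrightarrow> seg_sep (z a) (z (Suc a)) (z n) (z i)"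
    and turn: "\<And>j. i \<le> j \<Longrightarrow> Suc j < n \<Longrightarrow> (\<tau> j = 1 \<or> \<tau> j = - 1) \<and>
                  z (Suc (Suc j)) - z (Suc j) = (z (Suc j) - z j) * omega (\<tau> j)"
    and turnc: "\<tau>' = 1 \<or> \<tau>' = - 1" "z i - z n = (z n - z (n - 1)) * omega \<tau>'"
    and s: "s = 1 \<or> s = - 1" and g: "g \<noteq> 0"
    and loc: "z i - z (i - 1) = g" "z (Suc i) - z i = g * omega s" "z n - z i = g * omega (- s)"
    and ext: "\<And>j. 1 \<le> j \<Longrightarrow> j \<le> n \<Longrightarrow> Re (z j - z 0) > 0"
    and nz: "\<And>j. j < n \<Longrightarrow> z (Suc j) \<noteq> z j"
  shows "(\<Sum>j=i..<n - 1. \<tau> j) + \<tau>' = - 5 * s"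
proof -
  define v p q r y where vdef: "v = z i" "p = z (i - 1)" "q = z (Suc i)" "r = z n" "y = z (n - 1)"
  note ws = omega_inverse[of s] omega_minus_inverse[OF s]
  \<comment> \<open>From the extreme point \<open>z 0\<close> the whole loop is seen within a
    half-plane, hence with winding 0.\<close>
  have closed0: "wind z i n w + Arg ((z i - w) / (z n - w)) = 0" if w: "w = z 0" for w
  proof -
    have "wind z i n w = Arg ((z n - w) * 1) - Arg ((z i - w) * 1)"
    proof (rule wind_half_plane)
      fix j assume "i \<le> j" "j \<le> n"
      then have "Re (z j - z 0) > 0" using ext i by auto
      then show "0 \<le> Re ((z j - w) * 1) \<and> z j \<noteq> w" using w by auto
    next
      fix j assume "i \<le> j" "j < n"
      then have "Re (z j - z 0) > 0" using ext i by auto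
      then show "0 < Re ((z j - w) * 1) \<or> 0 < Re ((z (Suc j) - w) * 1)" using w by auto
    qed (use i in auto)
    moreover have "Re ((z n - w) * 1) > 0" "Re ((z i - w) * 1) > 0" using ext i w by auto
    then have "Arg ((z i - w) / (z n - w)) = Arg ((z i - w) * 1) - Arg ((z n - w) * 1)"
      by (intro Arg_divide_half_plane) auto
    ultimately show ?thesis by simp
  qed
  \<comment> \<open>The stem from \<open>z 0\<close> to \<open>z (i - 1)\<close> avoids the loop, so
    the winding stays 0 along it.\<close>
  have closed: "wind z i n (z k) + Arg ((z i - z k) / (z n - z k)) = 0" if "k < i" for k
    using that
  proof (induction k)
    case 0 show ?case by (rule closed0) simp
  next
    case (Suc k)
    have "wind z i n (z (Suc k)) + Arg ((z i - z (Suc k)) / (z n - z (Suc k)))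
        = wind z i n (z k) + Arg ((z i - z k) / (z n - z k))"
    proof (rule winding_closed_move)
      show "i \<le> n" using i by simp
      show "seg_sep (z n) (z i) (z k) (z (Suc k))"
        using sepc[of k] Suc.prems i by (auto intro: seg_sep_sym)
      show "seg_sep (z j) (z (Suc j)) (z k) (z (Suc k))" if "i \<le> j" "j < n" for j
        using sep[of k j] Suc.prems that by (auto intro: seg_sep_sym)
    qed
    then show ?case using Suc by simp
  qed
  have cp: "wind z i n p + Arg ((v - p) / (r - p)) = 0"
    using closed[of "i - 1"] i unfolding vdef by simp
  have split: "wind z i n p = Arg ((q - p) / (v - p)) + wind z (Suc i) n p"
    unfolding vdef using i by (intro wind_Suc_left) auto
  have mv: "wind z (Suc i) n v - wind z (Suc i) n p = Arg ((r - v) / (r - p)) - Arg ((q - v) / (q - p))"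
    unfolding vdef
  proof (rule wind_move)
    fix j assume "Suc i \<le> j" "j < n"
    then show "seg_sep (z j) (z (Suc j)) (z (i - 1)) (z i)"
      using sep[of "i - 1" j] i by (auto intro: seg_sep_sym)
  qed (use i in auto)
  have e: "q - p = g * (1 + omega s)" "r - p = g * (1 + omega (- s))" "v - p = g"
    "r - v = g * omega (- s)" "q - v = g * omega s"
    using loc unfolding vdef by (auto simp: algebra_simps)
  have ms: "- s = 1 \<or> - s = - 1" using s by auto
  note A = Arg_one_plus_omega[OF s] Arg_one_plus_omega[OF ms]
  have f1: "Arg ((v - p) / (r - p)) = of_int s * pi / 6"
    unfolding e using g A by simp
  have f2: "Arg ((q - p) / (v - p)) = of_int s * pi / 6"
    unfolding e using g A by simp
  have f3: "Arg ((r - v) / (r - p)) = - (of_int s * pi / 6)"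
    unfolding e using g A by simp
  have f4: "Arg ((q - v) / (q - p)) = of_int s * pi / 6"
    unfolding e using g A by simp
  \<comment> \<open>The directions of \<open>q\<close> and \<open>r\<close> as seen from
    \<open>v\<close> determine this value only up to multiples of 2 pi; the zero winding around
    \<open>p\<close> decides which one it is.\<close>
  have Wv: "wind z (Suc i) n v = - (of_int s * (2 * pi / 3))"
    using mv split cp f1 f2 f3 f4 by (simp add: field_simps)
  have trn: "Arg ((z (Suc (Suc j)) - z (Suc j)) / (z (Suc j) - z j)) = of_int (\<tau> j) * (pi / 3) \<and>
       Arg ((z (Suc (Suc j)) - z (Suc j)) / (z (Suc j) - z j)) =
       Arg ((z (Suc (Suc j)) - z j) / (z (Suc j) - z j)) +
       Arg ((z (Suc (Suc j)) - z (Suc j)) / (z (Suc (Suc j)) - z j))"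
    if "i \<le> j" "Suc j < n" for j
    using Arg_turn[of "\<tau> j" "z (Suc j)" "z j" "z (Suc (Suc j))"] turn[OF that] nz[of j] that by simp
  have "(\<Sum>j=i..<n - 1. Arg ((z (Suc (Suc j)) - z (Suc j)) / (z (Suc j) - z j))) =
      wind z (Suc i) (Suc (n - 1)) (z i) + wind z i (n - 1) (z (Suc (n - 1)))"
    by (rule total_turning) (use i trn sep in auto)
  moreover have "(\<Sum>j=i..<n - 1. Arg ((z (Suc (Suc j)) - z (Suc j)) / (z (Suc j) - z j))) =
     (\<Sum>j=i..<n - 1. of_int (\<tau> j) * (pi / 3))"
    by (intro sum.cong refl trn[THEN conjunct1]) auto
  moreover have "Suc (n - 1) = n" using i by simp
  ultimately have T: "(\<Sum>j=i..<n - 1. of_int (\<tau> j)) * (pi / 3) = wind z (Suc i) n v + wind z i (n - 1) r"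
    by (simp only: vdef sum_distrib_right)
  have w1: "wind z i (n - 1) r = Arg ((q - r) / (v - r)) + wind z (Suc i) (n - 1) r"
    unfolding vdef using i by (intro wind_Suc_left) auto
  \<comment> \<open>The second leg of \<open>total_turning\<close> is seen from \<open>r\<close>.
    Moving its base point to \<open>v\<close> along the closing edge allows \<open>Wv\<close> to be
    used for both legs.\<close>
  have w2: "wind z (Suc i) (n - 1) v - wind z (Suc i) (n - 1) r =
      Arg ((y - v) / (y - r)) - Arg ((q - v) / (q - r))"
    unfolding vdef
  proof (rule wind_move)
    fix j assume "Suc i \<le> j" "j < n - 1"
    then show "seg_sep (z j) (z (Suc j)) (z n) (z i)" using sepc[of j] i by auto
  qed (use i in auto)
  have w3: "wind z (Suc i) n v = wind z (Suc i) (n - 1) v + Arg ((r - v) / (y - v))"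
    using wind_Suc[of "Suc i" "n - 1" z v] i unfolding vdef by simp
  have e2: "q - r = g * (omega s - omega (- s))" "v - r = - g * omega (- s)"
    using e by (auto simp: algebra_simps)
  have sq: "omega s * omega s = - omega (- s)" "omega (- s) * omega (- s) = - omega s"
    using ws by algebra+
  have x2: "omega s - omega (- s) = - (omega (- s) * (1 + omega (- s)))"
    using sq by (simp add: distrib_left)
  have x3: "omega s - omega (- s) = omega s * (1 + omega s)"
    using sq by (simp add: distrib_left)
  have f5: "Arg ((q - r) / (v - r)) = - (of_int s * pi / 6)"
    unfolding e2 x2 using g A by (simp add: add.commute)
  have f6: "Arg ((q - v) / (q - r)) = - (of_int s * pi / 6)"
    unfolding e e2 x3 using g A by simp
  define h where "h = r - y"
  have h: "h \<noteq> 0" using nz[of "n - 1"] i by (simp add: h_def vdef)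
  have vr: "v - r = h * omega \<tau>'" using turnc(2) by (simp add: vdef h_def)
  have mt: "- \<tau>' = 1 \<or> - \<tau>' = - 1" using turnc(1) by auto
  note B = Arg_one_plus_omega[OF turnc(1)] Arg_one_plus_omega[OF mt]
  have e3: "r - v = - (h * omega \<tau>')" "y - v = - (h * (1 + omega \<tau>'))" "y - r = - h"
    using vr by (auto simp: h_def algebra_simps)
  have f7: "Arg ((y - v) / (y - r)) = of_int \<tau>' * pi / 6"
    unfolding e3 using h B by (simp add: add.commute)
  have f8: "Arg ((r - v) / (y - v)) = of_int \<tau>' * pi / 6"
    unfolding e3 using h B by simp
  have "(\<Sum>j=i..<n - 1. of_int (\<tau> j)) * pi / 3 = 2 * wind z (Suc i) n v - of_int s * pi / 3 - of_int \<tau>' * pi / 3"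
    using T w1 w2 w3 f5 f6 f7 f8 by (simp add: field_simps)
  then have "(\<Sum>j=i..<n - 1. real_of_int (\<tau> j)) * pi / 3 = (- 5 * of_int s - of_int \<tau>') * pi / 3"
    using Wv by (simp add: field_simps)
  then have "(\<Sum>j=i..<n - 1. real_of_int (\<tau> j)) = - 5 * of_int s - of_int \<tau>'"
    using pi_gt_zero by simp
  then have "real_of_int ((\<Sum>j=i..<n - 1. \<tau> j) + \<tau>') = real_of_int (- 5 * s)" by simp
  then show ?thesis by (simp only: of_int_eq_iff)
qed

section \<open>The hexagonal lattice\<close>

definition emb :: "int \<times> int \<Rightarrow> complex" where
  "emb z = of_int (fst z) + of_int (snd z) * omega 1"

lemma emb_add: "emb (z + z') = emb z + emb z'"
  by (simp add: emb_def algebra_simps)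

lemma emb_0 [simp]: "emb 0 = 0"
  by (simp add: emb_def)

lemma omega_1: "omega 1 = Complex (1/2) (sqrt 3 / 2)"
  by (simp add: omega_def complex_eq_iff cos_60 sin_60)

lemma emb_complex: "emb z = Complex (of_int (fst z) + of_int (snd z) / 2) (of_int (snd z) * sqrt 3 / 2)"
  by (simp add: emb_def omega_1 complex_eq_iff)

lemma emb_inj: "emb z = emb z' \<longleftrightarrow> z = z'"
  by (auto simp: emb_complex prod_eq_iff)

lemma omega_add: "omega (d + e) = omega d * omega e"
  by (simp add: omega_def cis_mult add_divide_distrib distrib_right)

lemma omega_3: "omega 3 = - 1"
  by (simp add: omega_def complex_eq_iff)

lemma omega_2: "omega 2 = omega 1 - 1"
  using omega_inverse[of 1] omega_minus_inverse[of 1] omega_add[of 1 1] by simp algebra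

lemma omega_0 [simp]: "omega 0 = 1"
  by (simp add: omega_def)

lemma omega_mod: "omega d = omega (d mod 6)"
proof -
  have 6: "omega (6 * k) = 1" for k
  proof -
    have "of_int (6 * k) * pi / 3 = 2 * pi * of_int k" by simp
    then show ?thesis unfolding omega_def by (metis cis_multiple_2pi Ints_of_int)
  qed
  have "omega d = omega (6 * (d div 6) + d mod 6)" by simp
  also have "\<dots> = omega (d mod 6)" by (simp only: omega_add 6 mult_1_left)
  finally show ?thesis .
qed

lemma emb_unit_dir: "emb (unit_dir d) = omega d"
proof -
  have "omega 4 = omega 3 * omega 1" "omega 5 = omega 3 * omega 2"
    by (simp_all flip: omega_add)
  then have o: "omega 4 = - omega 1" "omega 5 = 1 - omega 1" by (simp_all add: omega_3 omega_2)
  show ?thesis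
    by (subst omega_mod, cases d rule: mod6_cases)
      (simp_all add: unit_dir_simps emb_def o omega_2 omega_3)
qed

text \<open>Twice the scalar product of \<open>z\<close> with the unit vector of direction \<open>k\<close>.\<close>

definition height :: "int \<Rightarrow> int \<times> int \<Rightarrow> int" where
  "height k z = fst z * (2 * fst (unit_dir k) + snd (unit_dir k))
     + snd z * (fst (unit_dir k) + 2 * snd (unit_dir k))"

lemma height_add: "height k (z + z') = height k z + height k z'"
  and height_diff: "height k (z - z') = height k z - height k z'"
  and height_0 [simp]: "height k 0 = 0"
  by (simp_all add: height_def algebra_simps)

lemma height_cong: "k mod 6 = l mod 6 \<Longrightarrow> height k z = height l z"
  by (simp add: height_def unit_dir_cong[of k l])

lemma height_flip: "height k (flip z) = height (- k) z"
proof -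
  obtain c d where u: "unit_dir k = (c, d)" by fastforce
  then have "unit_dir (- k) = (c + d, - d)" using flip_unit_dir[of k] by (simp add: flip_def)
  with u show ?thesis by (simp add: height_def flip_def algebra_simps)
qed

lemma height_simps:
  "height 0 z = 2 * fst z + snd z" "height 1 z = fst z + 2 * snd z"
  "height 2 z = snd z - fst z" "height 3 z = - (2 * fst z + snd z)"
  "height 4 z = - (fst z + 2 * snd z)" "height 5 z = fst z - snd z"
  "height (-1) z = fst z - snd z" "height (-2) z = - (fst z + 2 * snd z)"
  by (simp_all add: height_def unit_dir_def)

lemma height_triple: "height 0 z = height 1 z - height 2 z"
  by (simp add: height_simps)

lemma Re_emb_omega: "2 * Re (emb z * omega (- k)) = of_int (height k z)"
proof -
  have "omega (- k) = cnj (omega k)" by (simp add: omega_def cis_cnj)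
  then have "omega (- k) = cnj (emb (unit_dir k))" by (simp add: emb_unit_dir)
  then show ?thesis by (simp add: emb_complex height_def) (simp add: field_simps)
qed

lemma Re_emb: "2 * Re (emb z) = of_int (height 0 z)"
  using Re_emb_omega[of z 0] by simp

text \<open>\<open>m\<close> is the midpoint of an edge of direction \<open>d\<close>, for the hexagonal lattice in which \<open>0\<close> is the
  midpoint of an edge of direction \<open>0\<close>.\<close>

definition mid_ok :: "int \<times> int \<Rightarrow> int \<Rightarrow> bool" where
  "mid_ok m d \<longleftrightarrow> (fst m - snd m) mod 3 = 0 \<and>
     (if d mod 3 = 0 then even (fst m) \<and> even (snd m)
      else if d mod 3 = 1 then odd (fst m) \<and> odd (snd m)
      else even (fst m) \<and> odd (snd m))"

lemma mod3_of_mod6: "(d::int) mod 3 = (d mod 6) mod 3"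
  by (simp add: mod_mod_cancel)

lemma mod2_of_mod6: "(d::int) mod 2 = (d mod 6) mod 2"
  by (simp add: mod_mod_cancel)

lemma mid_ok_0 [simp]: "mid_ok 0 0"
  by (simp add: mid_ok_def)

lemma mid_ok_cong: "d mod 6 = e mod 6 \<Longrightarrow> mid_ok m d = mid_ok m e"
proof -
  assume "d mod 6 = e mod 6"
  then have "d mod 3 = e mod 3" by (metis mod3_of_mod6)
  then show ?thesis by (simp add: mid_ok_def)
qed

text \<open>The vertices form two classes according to \<open>fst - snd\<close> modulo 3. One class
  is entered in even directions and the other in odd ones, so a vertex determines the parity of
  every direction of arrival.\<close>

lemma mid_ok_vertex:
  assumes "mid_ok m d"
  shows "odd (fst (m + unit_dir d))" "even (snd (m + unit_dir d))"
    "(fst (m + unit_dir d) - snd (m + unit_dir d)) mod 3 = (if even d then 1 else 2)"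
proof -
  define k where "k = d mod 6"
  have dk: "d mod 6 = k mod 6" by (simp add: k_def)
  have k: "mid_ok m k" "unit_dir d = unit_dir k" "even d = even k"
    using assms mid_ok_cong[OF dk] unit_dir_cong[OF dk] mod2_of_mod6[of d] mod2_of_mod6[of k] dk
    by (simp_all only: even_iff_mod_2_eq_zero)
  have "k = 0 \<or> k = 1 \<or> k = 2 \<or> k = 3 \<or> k = 4 \<or> k = 5"
    unfolding k_def by (cases d rule: mod6_cases) auto
  with k(1) have "odd (fst (m + unit_dir k)) \<and> even (snd (m + unit_dir k)) \<and>
    (fst (m + unit_dir k) - snd (m + unit_dir k)) mod 3 = (if even k then 1 else 2)"
    by (elim disjE; simp add: mid_ok_def unit_dir_def; presburger)
  then show "odd (fst (m + unit_dir d))" "even (snd (m + unit_dir d))"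
    "(fst (m + unit_dir d) - snd (m + unit_dir d)) mod 3 = (if even d then 1 else 2)"
    using k by auto
qed

lemma mid_ok_step:
  assumes "mid_ok m d" "s = 1 \<or> s = - 1"
  shows "mid_ok (m + unit_dir d + unit_dir (d + s)) (d + s)"
proof -
  define k where "k = d mod 6"
  have dk: "d mod 6 = k mod 6" "(d + s) mod 6 = (k + s) mod 6"
    by (simp_all add: k_def mod_add_left_eq)
  have k: "mid_ok m k" "unit_dir d = unit_dir k" "unit_dir (d + s) = unit_dir (k + s)"
    "mid_ok n (d + s) = mid_ok n (k + s)" for n
    using assms(1) mid_ok_cong[OF dk(1)] mid_ok_cong[OF dk(2)] unit_dir_cong[OF dk(1)] unit_dir_cong[OF dk(2)]
    by simp_all
  have "k = 0 \<or> k = 1 \<or> k = 2 \<or> k = 3 \<or> k = 4 \<or> k = 5"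
    unfolding k_def by (cases d rule: mod6_cases) auto
  with assms(2) k(1) have "mid_ok (m + unit_dir k + unit_dir (k + s)) (k + s)"
    by (elim disjE; simp add: mid_ok_def unit_dir_def; presburger)
  then show ?thesis using k by simp
qed

lemma mid_ok_endpos:
  "mid_ok m d \<Longrightarrow> set t \<subseteq> {1, - 1} \<Longrightarrow> mid_ok (endpos m d t) (d + sum_list t)"
proof (induction t arbitrary: m d)
  case (Cons s t)
  have "mid_ok (m + unit_dir d + unit_dir (d + s)) (d + s)"
    using Cons.prems by (intro mid_ok_step) auto
  from Cons.IH[OF this] Cons.prems show ?case by (simp add: add.assoc)
qed simp

lemma mid_ok_add3: "mid_ok m (d + 3) = mid_ok m d"
  by (simp add: mid_ok_def)

section \<open>Separation of disjoint lattice edges\<close>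

definition hex_edge :: "int \<times> int \<Rightarrow> int \<times> int \<Rightarrow> bool" where
  "hex_edge c e \<longleftrightarrow> (\<exists>m d. mid_ok m d \<and> c = m - unit_dir d \<and> e = m + unit_dir d)"

lemma hex_edgeI: "mid_ok m d \<Longrightarrow> hex_edge (m - unit_dir d) (m + unit_dir d)"
  unfolding hex_edge_def by blast

lemma seg_sep_functional:
  fixes \<alpha> \<beta> :: int
  assumes "\<forall>p\<in>{c, e}. \<forall>q\<in>{c', e'}. \<alpha> * (fst p - fst q) + \<beta> * (snd p - snd q) > 0"
  shows "seg_sep (emb c) (emb e) (emb c') (emb e')"
proof -
  \<comment> \<open>This \<open>w\<close> represents the functional: the real part of
    \<open>emb p * w\<close> is \<open>\<alpha> * fst p + \<beta> * snd p\<close>.\<close>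
  define w where "w = Complex \<alpha> ((of_int \<alpha> - 2 * of_int \<beta>) / sqrt 3)"
  have "Re ((emb p - emb q) * w) = of_int (\<alpha> * (fst p - fst q) + \<beta> * (snd p - snd q))" for p q
    by (simp add: emb_complex w_def field_simps)
  then have "\<forall>p\<in>{c, e}. \<forall>q\<in>{c', e'}. Re ((emb p - emb q) * w) > 0"
    using assms by (simp only: of_int_0_less_iff)
  then show ?thesis unfolding seg_sep_def by blast
qed

text \<open>Opposite directions differ in parity, so every edge has an orientation of odd direction.
  This leaves three directions to compare.\<close>

lemma hex_edge_odd:
  assumes "hex_edge c e"
  obtains d where "odd d" "mid_ok (c + unit_dir d) d" "e = c + unit_dir d + unit_dir d"
  | d where "odd d" "mid_ok (e + unit_dir d) d" "c = e + unit_dir d + unit_dir d"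
proof -
  obtain m d where md: "mid_ok m d" "c = m - unit_dir d" "e = m + unit_dir d"
    using assms by (auto simp: hex_edge_def)
  show thesis
  proof (cases "odd d")
    case True
    show thesis by (rule that(1)[of d]) (use md True in auto)
  next
    case False
    show thesis by (rule that(2)[of "d + 3"]) (use md False in \<open>auto simp: unit_dir_add3 mid_ok_add3\<close>)
  qed
qed

text \<open>\<open>(a, b)\<close> is half the difference of the starting vertices of two edges of
  odd directions, and the four inequalities concern the four pairs of end points. A coordinate of
  absolute value at least 3 separates by itself, since each unit direction changes it by at most 1.
  The eight remaining positions are checked against the list.\<close>

lemma separating_functional:
  fixes a b k l :: int
  assumes "odd k" "odd l" "(a - b) mod 3 = 0" "\<not> (a = 0 \<and> b = 0)"
    "\<not> (a + fst (unit_dir k) - fst (unit_dir l) = 0 \<and> b + snd (unit_dir k) - snd (unit_dir l) = 0)"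
  shows "\<exists>(\<alpha>, \<beta>)\<in>{(0,1),(0,-1),(1,0),(-1,0),(1,1),(-1,-1),(2,1),(-2,-1),(1,2),(-1,-2),(-1,1),(1,-1)}.
     \<alpha> * a + \<beta> * b > 0 \<and> \<alpha> * (a + fst (unit_dir k)) + \<beta> * (b + snd (unit_dir k)) > 0 \<and>
     \<alpha> * (a - fst (unit_dir l)) + \<beta> * (b - snd (unit_dir l)) > 0 \<and>
     \<alpha> * (a + fst (unit_dir k) - fst (unit_dir l)) + \<beta> * (b + snd (unit_dir k) - snd (unit_dir l)) > 0"
proof -
  have odd_cases: "d mod 6 = 1 \<or> d mod 6 = 3 \<or> d mod 6 = 5" if "odd d" for d :: int
  proof -
    have "d mod 6 mod 2 = 1" using that mod2_of_mod6[of d] by (simp only: odd_iff_mod_2_eq_one)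
    then show ?thesis by (cases d rule: mod6_cases; simp)
  qed
  note o = odd_cases[OF assms(1)] odd_cases[OF assms(2)]
  have u: "\<bar>fst (unit_dir d)\<bar> \<le> 1" "\<bar>snd (unit_dir d)\<bar> \<le> 1" "\<bar>fst (unit_dir d) + snd (unit_dir d)\<bar> \<le> 1" for d
    by (cases d rule: mod6_cases; simp add: unit_dir_simps)+
  note uk = u[of k] u[of l]
  consider "b \<ge> 3" | "b \<le> - 3" | "a \<ge> 3" | "a \<le> - 3" | "\<bar>a\<bar> \<le> 2" "\<bar>b\<bar> \<le> 2" by linarith
  then show ?thesis
  proof cases
    case 1
    then show ?thesis using uk by (intro bexI[of _ "(0, 1)"]) auto
  next
    case 2
    then show ?thesis using uk by (intro bexI[of _ "(0, -1)"]) auto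
  next
    case 3
    then show ?thesis using uk by (intro bexI[of _ "(1, 0)"]) auto
  next
    case 4
    then show ?thesis using uk by (intro bexI[of _ "(-1, 0)"]) auto
  next
    case 5
    have "a = - 2 \<or> a = - 1 \<or> a = 0 \<or> a = 1 \<or> a = 2" "b = - 2 \<or> b = - 1 \<or> b = 0 \<or> b = 1 \<or> b = 2"
      using 5 by linarith+
    then have "(a, b) \<in> {(1, 1), (-1, -1), (2, -1), (-2, 1), (1, -2), (-1, 2), (2, 2), (-2, -2)}"
      using assms(3,4) by (elim disjE; simp)
    then show ?thesis
      using o assms(5) by (elim insertE emptyE disjE; simp add: unit_dir_simps)
  qed
qed

lemma odd_edge_sep:
  assumes "odd k" "odd l" "mid_ok (c + unit_dir k) k" "mid_ok (c' + unit_dir l) l" "c \<noteq> c'"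
    "c + unit_dir k + unit_dir k \<noteq> c' + unit_dir l + unit_dir l"
  shows "seg_sep (emb c) (emb (c + unit_dir k + unit_dir k)) (emb c') (emb (c' + unit_dir l + unit_dir l))"
proof -
  have v: "odd (fst c) \<and> even (snd c) \<and> (fst c - snd c) mod 3 = 1"
    if "odd k" "mid_ok (c + unit_dir k) k" for c k
    using mid_ok_vertex[of "c + unit_dir k" "k + 3"] that
    by (simp add: unit_dir_add3 mid_ok_add3)
  note vc = v[OF assms(1,3)] v[OF assms(2,4)]
  then obtain a b where a: "fst c - fst c' = 2 * a" "snd c - snd c' = 2 * b"
    by (metis dvdE even_diff odd_even_add add_diff_eq diff_add_cancel dvd_diff)
  have "2 * (a - b) mod 3 = ((fst c - snd c) - (fst c' - snd c')) mod 3"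
    using a by (simp add: algebra_simps)
  also have "\<dots> = 0" using vc by (metis mod_diff_eq diff_self mod_0)
  finally have ab: "(a - b) mod 3 = 0" by presburger
  have "\<not> (a = 0 \<and> b = 0)" using a assms(5) by (auto simp: prod_eq_iff)
  moreover have "\<not> (a + fst (unit_dir k) - fst (unit_dir l) = 0 \<and> b + snd (unit_dir k) - snd (unit_dir l) = 0)"
    using a assms(6) by (auto simp: prod_eq_iff)
  ultimately obtain \<alpha> \<beta> where f: "\<alpha> * a + \<beta> * b > 0"
    "\<alpha> * (a + fst (unit_dir k)) + \<beta> * (b + snd (unit_dir k)) > 0"
    "\<alpha> * (a - fst (unit_dir l)) + \<beta> * (b - snd (unit_dir l)) > 0"
    "\<alpha> * (a + fst (unit_dir k) - fst (unit_dir l)) + \<beta> * (b + snd (unit_dir k) - snd (unit_dir l)) > 0"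
    using separating_functional[OF assms(1,2) ab] by blast
  have e: "fst c = fst c' + 2 * a" "snd c = snd c' + 2 * b" using a by auto
  show ?thesis
    by (rule seg_sep_functional[of _ _ _ _ \<alpha> \<beta>]) (use f in \<open>simp add: e algebra_simps\<close>)
qed

lemma hex_edge_sep:
  assumes "hex_edge c e" "hex_edge c' e'" "c \<noteq> c'" "c \<noteq> e'" "e \<noteq> c'" "e \<noteq> e'"
  shows "seg_sep (emb c) (emb e) (emb c') (emb e')"
  using assms(1)
proof (cases rule: hex_edge_odd)
  case (1 k)
  from assms(2) show ?thesis
  proof (cases rule: hex_edge_odd)
    case (1 l)
    then show ?thesis using odd_edge_sep[of k l c c'] \<open>odd k\<close> \<open>mid_ok (c + unit_dir k) k\<close> \<open>e = _\<close> assms by simp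
  next
    case (2 l)
    then have "seg_sep (emb c) (emb e) (emb e') (emb c')"
      using odd_edge_sep[of k l c e'] \<open>odd k\<close> \<open>mid_ok (c + unit_dir k) k\<close> \<open>e = _\<close> assms by simp
    then show ?thesis by (rule seg_sep_swap)
  qed
next
  case (2 k)
  from assms(2) have "seg_sep (emb e) (emb c) (emb c') (emb e')"
  proof (cases rule: hex_edge_odd)
    case (1 l)
    then show ?thesis using odd_edge_sep[of k l e c'] \<open>odd k\<close> \<open>mid_ok (e + unit_dir k) k\<close> \<open>c = _\<close> assms by simp
  next
    case (2 l)
    then have "seg_sep (emb e) (emb c) (emb e') (emb c')"
      using odd_edge_sep[of k l e e'] \<open>odd k\<close> \<open>mid_ok (e + unit_dir k) k\<close> \<open>c = _\<close> assms by simp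
    then show ?thesis by (rule seg_sep_swap)
  qed
  then show ?thesis by (rule seg_sep_swap)
qed

section \<open>The polygon traced by a walk\<close>

definition tip :: "int \<times> int \<Rightarrow> int \<Rightarrow> int list \<Rightarrow> int \<times> int" where
  "tip m d t = endpos m d t + unit_dir (d + sum_list t)"

text \<open>The vertices behind the starting midpoint and ahead of the final one are added to the
  visited ones, so that every turn sits at an inner vertex of the polygon.\<close>

definition trail :: "int \<times> int \<Rightarrow> int \<Rightarrow> int list \<Rightarrow> (int \<times> int) list" where
  "trail m d t = (m - unit_dir d) # verts m d t @ [tip m d t]"

lemma trail_Cons:
  "trail m d (s # t) = (m - unit_dir d) # trail (m + unit_dir d + unit_dir (d + s)) (d + s) t"
  by (simp add: trail_def tip_def add.assoc)

lemma length_trail [simp]: "length (trail m d t) = length t + 2"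
  by (simp add: trail_def)

lemma trail_edge:
  assumes "mid_ok m d" "set t \<subseteq> {1, - 1}" "i \<le> length t"
  shows "hex_edge (trail m d t ! i) (trail m d t ! Suc i)"
    and "trail m d t ! Suc i = trail m d t ! i + unit_dir (d + sum_list (take i t)) + unit_dir (d + sum_list (take i t))"
proof -
  have "hex_edge (trail m d t ! i) (trail m d t ! Suc i) \<and>
    trail m d t ! Suc i = trail m d t ! i + unit_dir (d + sum_list (take i t)) + unit_dir (d + sum_list (take i t))"
    using assms
  proof (induction t arbitrary: m d i)
    case Nil
    then show ?case using hex_edgeI[of m d] by (simp add: trail_def tip_def)
  next
    case (Cons s t)
    let ?m = "m + unit_dir d + unit_dir (d + s)"
    have ok: "mid_ok ?m (d + s)" using Cons.prems by (intro mid_ok_step) auto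
    show ?case
    proof (cases i)
      case 0
      have "trail ?m (d + s) t ! 0 = m + unit_dir d" by (simp add: trail_def)
      then show ?thesis using 0 hex_edgeI[OF Cons.prems(1)] by (simp add: trail_Cons)
    next
      case (Suc j)
      then show ?thesis using Cons.IH[OF ok, of j] Cons.prems by (auto simp: trail_Cons add.assoc)
    qed
  qed
  then show "hex_edge (trail m d t ! i) (trail m d t ! Suc i)"
    "trail m d t ! Suc i = trail m d t ! i + unit_dir (d + sum_list (take i t)) + unit_dir (d + sum_list (take i t))"
    by auto
qed

lemma trail_omega:
  assumes "mid_ok m d" "set t \<subseteq> {1, - 1}" "i \<le> length t"
  shows "emb (trail m d t ! Suc i) - emb (trail m d t ! i) = 2 * omega (d + sum_list (take i t))"
  using trail_edge(2)[OF assms] by (simp add: emb_add emb_unit_dir)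

lemma trail_turn:
  assumes "mid_ok m d" "set t \<subseteq> {1, - 1}" "i < length t"
  shows "emb (trail m d t ! Suc (Suc i)) - emb (trail m d t ! Suc i) =
     (emb (trail m d t ! Suc i) - emb (trail m d t ! i)) * omega (t ! i)"
  using trail_omega[OF assms(1,2), of i] trail_omega[OF assms(1,2), of "Suc i"] assms(3)
  by (simp add: take_Suc_conv_app_nth omega_add flip: add.assoc)

section \<open>Turning of self-avoiding walks\<close>

lemma turn_cases: "set t \<subseteq> {1, - 1} \<Longrightarrow> j < length t \<Longrightarrow> t ! j = 1 \<or> t ! j = (- 1 :: int)"
  by (metis insertE nth_mem singletonD subsetD)

text \<open>Three residues modulo 6 have the parity of \<open>b\<close>; with two excluded,
  \<open>a\<close> has the third. At a vertex these are the three directions of arrival.\<close>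

lemma even_mod6:
  fixes a b s :: int
  assumes "even a = even b" "a mod 6 \<noteq> b mod 6" "a mod 6 \<noteq> (b + s + 3) mod 6" "s = 1 \<or> s = - 1"
  shows "a mod 6 = (b - s + 3) mod 6"
proof -
  have "even (a - b)" using assms(1) by simp
  then obtain c where "a - b = 2 * c" by (rule evenE)
  define q r where "q = c div 3" and "r = c mod 3"
  have c: "c = 3 * q + r" by (simp add: q_def r_def)
  have a: "a = b + 2 * r + q * 6" using \<open>a - b = 2 * c\<close> c by simp
  have am: "a mod 6 = (b + 2 * r) mod 6" unfolding a by (rule mod_mult_self1)
  have r: "r = 0 \<or> r = 1 \<or> r = 2" using pos_mod_bound[of 3 c] pos_mod_sign[of 3 c] unfolding r_def by linarith
  have "r \<noteq> 0"
  proof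
    assume "r = 0"
    then show False using am assms(2) by simp
  qed
  from assms(4) show ?thesis
  proof
    assume s: "s = 1"
    have "r \<noteq> 2"
    proof
      assume "r = 2"
      then have "b + 2 * r = b + s + 3" by (simp add: s)
      then show False using am assms(3) by metis
    qed
    then have "b + 2 * r = b - s + 3" using r \<open>r \<noteq> 0\<close> by (simp add: s)
    then show ?thesis using am by metis
  next
    assume s: "s = - 1"
    have "r \<noteq> 1"
    proof
      assume "r = 1"
      then have "b + 2 * r = b + s + 3" by (simp add: s)
      then show False using am assms(3) by metis
    qed
    then have "b + 2 * r = b - s + 3" using r \<open>r \<noteq> 0\<close> by (simp add: s)
    then show ?thesis using am by metis
  qed
qed

text \<open>Both end points being extreme, the two windings in \<open>total_turning\<close> are variations of an
  argument within a half-plane.\<close>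

lemma exit_turning:
  assumes t: "set t \<subseteq> {1, - 1}" "distinct (verts 0 0 t)" "t \<noteq> []"
    and pos: "\<And>c. c \<in> set (verts 0 0 t) \<Longrightarrow> height 0 c > 0"
    and tp: "height 0 (tip 0 0 t) \<ge> - 2" "tip 0 0 t \<noteq> (-1, 0)"
    and k: "sum_list t mod 6 = k mod 6"
      "\<And>c. c \<in> set (verts 0 0 t) \<Longrightarrow> height k c < height k (tip 0 0 t)"
      "height k (-1, 0) \<le> height k (tip 0 0 t)"
  shows "\<bar>sum_list t\<bar> \<le> 3"
proof -
  define n where "n = length t"
  define z where "z i = emb (trail 0 0 t ! i)" for i
  have n: "n > 0" using t by (simp add: n_def)
  have z0: "trail 0 0 t ! 0 = (-1, 0)" by (simp add: trail_def)
  have zn: "trail 0 0 t ! Suc n = tip 0 0 t" by (simp add: trail_def n_def nth_append)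
  have zi: "trail 0 0 t ! i \<in> set (verts 0 0 t)" if "1 \<le> i" "i \<le> n" for i
  proof -
    have "trail 0 0 t ! i = verts 0 0 t ! (i - 1)"
      using that by (cases i) (auto simp: trail_def n_def nth_append)
    then show ?thesis using that by (simp add: n_def)
  qed
  have c0: "(-1, 0) \<notin> set (verts 0 0 t)" using pos[of "(-1,0)"] by (auto simp: height_simps)
  have ct: "tip 0 0 t \<notin> set (verts 0 0 t)" using k(2) by (metis less_irrefl)
  have dist: "distinct (trail 0 0 t)" using t(2) c0 ct tp(2) by (auto simp: trail_def)
  have dn: "trail 0 0 t ! i \<noteq> trail 0 0 t ! j" if "i < j" "j \<le> Suc n" for i j
    using dist that by (simp add: nth_eq_iff_index_eq n_def)
  have Sum: "(\<Sum>i=0..<n. Arg ((z (Suc (Suc i)) - z (Suc i)) / (z (Suc i) - z i))) =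
         wind z (Suc 0) (Suc n) (z 0) + wind z 0 n (z (Suc n))"
  proof (rule total_turning)
    fix i j assume "Suc i < j" "j \<le> n"
    then show "seg_sep (z i) (z (Suc i)) (z j) (z (Suc j))"
      unfolding z_def using dn by (intro hex_edge_sep trail_edge(1)) (use t in \<open>auto simp: n_def\<close>)
  next
    fix i assume "i < n"
    then show "Arg ((z (Suc (Suc i)) - z (Suc i)) / (z (Suc i) - z i)) =
       Arg ((z (Suc (Suc i)) - z i) / (z (Suc i) - z i)) +
       Arg ((z (Suc (Suc i)) - z (Suc i)) / (z (Suc (Suc i)) - z i))"
      using dn[of i "Suc i"] trail_turn[of 0 0 t i] t turn_cases[OF t(1), of i]
      by (intro Arg_turn(2)[of "t ! i"]) (auto simp: z_def n_def emb_inj)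
  qed simp
  have "(\<Sum>i=0..<n. Arg ((z (Suc (Suc i)) - z (Suc i)) / (z (Suc i) - z i))) =
      (\<Sum>i=0..<n. of_int (t ! i) * (pi / 3))"
  proof (rule sum.cong)
    fix i assume "i \<in> {0..<n}"
    then show "Arg ((z (Suc (Suc i)) - z (Suc i)) / (z (Suc i) - z i)) = of_int (t ! i) * (pi / 3)"
      using dn[of i "Suc i"] trail_turn[of 0 0 t i] t turn_cases[OF t(1), of i]
      by (subst Arg_turn(1)[of "t ! i"]) (auto simp: z_def n_def emb_inj)
  qed simp
  also have "\<dots> = of_int (sum_list t) * (pi / 3)"
    by (simp only: sum_list_sum_nth n_def of_int_sum sum_distrib_right)
  finally have S: "of_int (sum_list t) * (pi / 3) = wind z (Suc 0) (Suc n) (z 0) + wind z 0 n (z (Suc n))"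
    using Sum by simp
  define w where "w = z (Suc n) - z 0"
  have Rez: "2 * Re (z i - z j) = of_int (height 0 (trail 0 0 t ! i) - height 0 (trail 0 0 t ! j))" for i j
    using Re_emb[of "trail 0 0 t ! i"] Re_emb[of "trail 0 0 t ! j"] by (simp add: z_def)
  have Rek: "2 * Re ((z i - z j) * omega (- k)) = of_int (height k (trail 0 0 t ! i) - height k (trail 0 0 t ! j))" for i j
    using Re_emb_omega[of "trail 0 0 t ! i" k] Re_emb_omega[of "trail 0 0 t ! j" k]
    by (simp add: z_def algebra_simps)
  have h0: "height 0 (-1, 0) = -2" by (simp add: height_simps)
  have P1: "Re (z i - z 0) > 0" if "1 \<le> i" "i \<le> n" for i
    using Rez[of i 0] pos[OF zi[OF that]] z0 h0 by simp
  have P2: "Re w \<ge> 0"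
    using Rez[of "Suc n" 0] tp z0 zn h0 by (simp add: w_def)
  have w1: "wind z (Suc 0) (Suc n) (z 0) = Arg (w * 1) - Arg ((z (Suc 0) - z 0) * 1)"
    unfolding w_def
  proof (rule wind_half_plane)
    fix i assume i: "Suc 0 \<le> i" "i \<le> Suc n"
    show "0 \<le> Re ((z i - z 0) * 1) \<and> z i \<noteq> z 0"
      using i dn[of 0 i] P1[of i] P2 by (cases "i = Suc n") (auto simp: w_def z_def emb_inj)
  next
    fix i assume i: "Suc 0 \<le> i" "i < Suc n"
    then show "0 < Re ((z i - z 0) * 1) \<or> 0 < Re ((z (Suc i) - z 0) * 1)" using P1[of i] by auto
  qed simp
  have z10: "z (Suc 0) - z 0 = 2"
    using trail_omega[of 0 0 t 0] t by (simp add: z_def)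
  have Q1: "Re ((z (Suc n) - z i) * omega (- k)) > 0" if "1 \<le> i" "i \<le> n" for i
    using Rek[of "Suc n" i] k(2)[OF zi[OF that]] zn by simp
  have Q2: "Re (w * omega (- k)) \<ge> 0"
    using Rek[of "Suc n" 0] k(3) zn z0 by (simp add: w_def)
  have w2: "wind z 0 n (z (Suc n)) = Arg ((z n - z (Suc n)) * (- omega (- k))) - Arg ((z 0 - z (Suc n)) * (- omega (- k)))"
  proof (rule wind_half_plane)
    fix i assume i: "0 \<le> i" "i \<le> n"
    have eq: "(z i - z (Suc n)) * (- omega (- k)) = (z (Suc n) - z i) * omega (- k)" by (simp add: algebra_simps)
    show "0 \<le> Re ((z i - z (Suc n)) * (- omega (- k))) \<and> z i \<noteq> z (Suc n)"
      unfolding eq using i dn[of i "Suc n"] Q1[of i] Q2 by (cases "i = 0") (auto simp: w_def z_def emb_inj)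
  next
    fix i assume i: "0 \<le> i" "i < n"
    have eq: "(z (Suc i) - z (Suc n)) * (- omega (- k)) = (z (Suc n) - z (Suc i)) * omega (- k)" by (simp add: algebra_simps)
    show "0 < Re ((z i - z (Suc n)) * (- omega (- k))) \<or> 0 < Re ((z (Suc i) - z (Suc n)) * (- omega (- k)))"
      unfolding eq using Q1[of "Suc i"] i by auto
  qed simp
  have "(z n - z (Suc n)) * (- omega (- k)) = 2 * (omega (sum_list t) * omega (- k))"
    using trail_omega[of 0 0 t n] t by (simp add: z_def n_def algebra_simps)
  also have "\<dots> = 2"
    using k(1) omega_mod[of "sum_list t"] omega_mod[of k] omega_inverse[of k] by simp
  finally have e1: "(z n - z (Suc n)) * (- omega (- k)) = of_real 2" by simp
  have e2: "(z 0 - z (Suc n)) * (- omega (- k)) = w * omega (- k)" by (simp add: w_def algebra_simps)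
  have a2: "Arg (2::complex) = 0" using Arg_of_real[of 2] by simp
  \<comment> \<open>The first and the last edge point along the axes of the two half-planes and
    contribute 0. What remains is the secant \<open>w\<close> between the end points, measured in
    each half-plane.\<close>
  have "of_int (sum_list t) * (pi / 3) = Arg w - Arg (w * omega (- k))"
    unfolding S w1 w2 e1 e2 z10 using a2 by simp
  moreover have "\<bar>Arg w\<bar> \<le> pi / 2" "\<bar>Arg (w * omega (- k))\<bar> \<le> pi / 2"
    using P2 Q2 by (simp_all only: Arg_Re_nonneg)
  ultimately have "\<bar>of_int (sum_list t) * (pi / 3)\<bar> \<le> pi" by linarith
  then have "pi * \<bar>real_of_int (sum_list t)\<bar> \<le> pi * 3" by (simp add: abs_mult)
  then show ?thesis by simp
qed

text \<open>A closed loop turns by 6 or -6 in total. Its stem lies outside, so after a left turn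
  (\<open>s = 1\<close>) it runs clockwise and after a right turn counterclockwise: the total is
  \<open>- 6 * s\<close>. The turn from the closing edge into the loop is \<open>- s\<close> and
  does not occur in \<open>t1\<close>. For the second claim, the closing edge is the one of the
  three edges at the attachment vertex that is neither the end of the stem nor the first edge of the
  loop.\<close>

lemma loop_sum:
  assumes t: "t = t0 @ [s] @ t1" "set t \<subseteq> {1, - 1}" "distinct (verts 0 0 t)"
    and pos: "\<And>c. c \<in> set (verts 0 0 t) \<Longrightarrow> height 0 c > 0"
    and cl: "tip 0 0 t = tip 0 0 t0"
  shows "sum_list t1 = - 5 * s"
    and "(sum_list t) mod 6 = (sum_list t0 - s + 3) mod 6"
proof -
  define n where "n = length t"
  define i where "i = Suc (length t0)"
  define z where "z i = emb (trail 0 0 t ! i)" for i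
  define dir where "dir i = sum_list (take i t)" for i
  have s: "s = 1 \<or> s = - 1" using t by auto
  have z0: "trail 0 0 t ! 0 = (-1, 0)" by (simp add: trail_def)
  have zn: "trail 0 0 t ! Suc n = tip 0 0 t" by (simp add: trail_def n_def nth_append)
  have zi: "trail 0 0 t ! j \<in> set (verts 0 0 t)" if "1 \<le> j" "j \<le> n" for j
  proof -
    have "trail 0 0 t ! j = verts 0 0 t ! (j - 1)"
      using that by (cases j) (auto simp: trail_def n_def nth_append)
    then show ?thesis using that by (simp add: n_def)
  qed
  have c0: "(-1, 0) \<notin> set (verts 0 0 t)" using pos[of "(-1,0)"] by (auto simp: height_simps)
  have dist: "distinct ((-1, 0) # verts 0 0 t)" using t(3) c0 by simp
  have nth: "trail 0 0 t ! j = ((-1, 0) # verts 0 0 t) ! j" if "j \<le> n" for j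
    using that by (cases j) (auto simp: trail_def n_def nth_append)
  have dn: "trail 0 0 t ! a \<noteq> trail 0 0 t ! b" if "a < b" "b \<le> n" for a b
    using dist that nth_eq_iff_index_eq[OF dist, of a b] by (simp add: nth n_def)
  have ile: "i \<le> n" by (simp add: i_def n_def t)
  have vi: "trail 0 0 t ! i = tip 0 0 t0"
    using nth[OF ile] by (simp add: i_def t(1) verts_append nth_append tip_def)
  then have close: "trail 0 0 t ! Suc n = trail 0 0 t ! i" using zn cl by simp
  have edge: "trail 0 0 t ! Suc j = trail 0 0 t ! j + unit_dir (dir j) + unit_dir (dir j)" if "j \<le> n" for j
    using trail_edge(2)[of 0 0 t j] that t by (simp add: dir_def n_def)
  have hex: "hex_edge (trail 0 0 t ! j) (trail 0 0 t ! Suc j)" if "j \<le> n" for j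
    using trail_edge(1)[of 0 0 t j] that t by (simp add: n_def)
  have dirS: "dir (Suc j) = dir j + t ! j" if "j < n" for j
    using that by (simp add: dir_def n_def take_Suc_conv_app_nth)
  have tj: "t ! j = 1 \<or> t ! j = - 1" if "j < n" for j
    using turn_cases[OF t(2)] that by (simp add: n_def)
  have diri: "dir (i - 1) = sum_list t0" "dir i = sum_list t0 + s" "dir n = sum_list t"
    by (simp_all add: dir_def i_def t(1) n_def)
  have u2: "unit_dir d + unit_dir d \<noteq> 0" for d
    by (cases d rule: mod6_cases) (simp_all add: unit_dir_simps prod_eq_iff)
  \<comment> \<open>One edge does not close up, and two edges would need a reversal of
    direction.\<close>
  have "i + 2 \<le> n"
  proof (rule ccontr)
    assume "\<not> i + 2 \<le> n"
    then consider "n = i" | "n = Suc i" using ile by linarith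
    then show False
    proof cases
      case 1
      then show False using edge[of n] close u2[of "dir n"] by (simp add: add.assoc)
    next
      case 2
      have "trail 0 0 t ! i = trail 0 0 t ! i + (unit_dir (dir i) + unit_dir (dir i)) + (unit_dir (dir n) + unit_dir (dir n))"
        using edge[of n] edge[of i] close 2 by (simp add: add.assoc)
      then have "unit_dir (dir i) + unit_dir (dir i) + (unit_dir (dir n) + unit_dir (dir n)) = 0"
        by (simp add: add.assoc)
      then have "unit_dir (dir n) = - unit_dir (dir i)" by (auto simp: prod_eq_iff)
      then have "unit_dir (dir n) = unit_dir (dir i + 3)" by (simp add: unit_dir_add3)
      then have "dir n mod 6 = (dir i + 3) mod 6" by (simp add: unit_dir_inj)
      moreover have "dir n = dir i + t ! i" "t ! i = 1 \<or> t ! i = - 1" using dirS[of i] tj[of i] 2 by auto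
      ultimately show False by presburger
    qed
  qed
  have par: "even (dir n) = even (dir (i - 1))"
  proof -
    have ok: "mid_ok (endpos 0 0 t) (sum_list t)" "mid_ok (endpos 0 0 t0) (sum_list t0)"
      using mid_ok_endpos[of 0 0 t] mid_ok_endpos[of 0 0 t0] t by auto
    have cl': "endpos 0 0 t + unit_dir (sum_list t) = endpos 0 0 t0 + unit_dir (sum_list t0)"
      using cl by (simp add: tip_def)
    have "(if even (sum_list t) then 1 else 2 :: int) = (if even (sum_list t0) then 1 else 2)"
      using mid_ok_vertex(3)[OF ok(1)] mid_ok_vertex(3)[OF ok(2)] unfolding cl' by (rule trans[OF sym])
    then show ?thesis unfolding diri by (auto split: if_splits)
  qed
  have d1: "dir n mod 6 \<noteq> dir (i - 1) mod 6"
  proof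
    assume "dir n mod 6 = dir (i - 1) mod 6"
    then have "unit_dir (dir n) = unit_dir (dir (i - 1))" by (rule unit_dir_cong)
    then have "trail 0 0 t ! n = trail 0 0 t ! (i - 1)"
      using edge[of n] edge[of "i - 1"] close ile by (simp add: i_def)
    then show False using dn[of "i - 1" n] ile by (simp add: i_def)
  qed
  have d2: "dir n mod 6 \<noteq> (dir (i - 1) + s + 3) mod 6"
  proof
    assume "dir n mod 6 = (dir (i - 1) + s + 3) mod 6"
    then have "unit_dir (dir n) = unit_dir (dir i + 3)" by (intro unit_dir_cong) (simp only: diri)
    then have "unit_dir (dir n) = - unit_dir (dir i)" by (simp add: unit_dir_add3)
    then have "trail 0 0 t ! n = trail 0 0 t ! Suc i"
      using edge[of n] edge[of i] close ile by (simp add: algebra_simps)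
    then show False using dn[of "Suc i" n] \<open>i + 2 \<le> n\<close> by simp
  qed
  have d3: "dir n mod 6 = (dir (i - 1) - s + 3) mod 6"
    using par d1 d2 s by (rule even_mod6)
  then show "(sum_list t) mod 6 = (sum_list t0 - s + 3) mod 6" by (simp only: diri)
  have "emb (trail 0 0 t ! Suc j) - emb (trail 0 0 t ! j) = 2 * omega (dir j)" if "j \<le> n" for j
    using trail_omega[of 0 0 t j] that t by (simp add: dir_def n_def)
  then have zd: "z (Suc j) - z j = 2 * omega (dir j)" if "j \<le> n" for j
    using that by (simp add: z_def)
  have zc: "z (Suc n) = z i" using close by (simp add: z_def)
  have "(\<Sum>j=i..<n - 1. t ! j) + t ! (n - 1) = - 5 * s"
  proof (rule loop_turning[of i n z "\<lambda>j. t ! j" "t ! (n - 1)" s "2 * omega (dir (i - 1))"])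
    show "1 \<le> i" by (simp add: i_def)
    show "i + 2 \<le> n" by fact
    show "seg_sep (z a) (z (Suc a)) (z b) (z (Suc b))" if "Suc a < b" "b < n" for a b
      unfolding z_def using that dn by (intro hex_edge_sep hex) auto
    show "seg_sep (z a) (z (Suc a)) (z n) (z i)" if "a < n" "Suc a < i \<or> i < a \<and> Suc a < n" for a
    proof -
      have "hex_edge (trail 0 0 t ! n) (trail 0 0 t ! i)" using hex[of n] close by simp
      then show ?thesis unfolding z_def
        using that dn[of a n] dn[of "Suc a" n] dn[of a i] dn[of i a] dn[of "Suc a" i] dn[of i "Suc a"] ile
        by (intro hex_edge_sep hex) auto
    qed
    show "(t ! j = 1 \<or> t ! j = - 1) \<and> z (Suc (Suc j)) - z (Suc j) = (z (Suc j) - z j) * omega (t ! j)"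
      if "i \<le> j" "Suc j < n" for j
      using tj[of j] zd[of j] zd[of "Suc j"] dirS[of j] that by (simp add: omega_add)
    show "t ! (n - 1) = 1 \<or> t ! (n - 1) = - 1" using tj[of "n - 1"] \<open>i + 2 \<le> n\<close> by simp
    show "z i - z n = (z n - z (n - 1)) * omega (t ! (n - 1))"
      using zd[of n] zd[of "n - 1"] dirS[of "n - 1"] zc \<open>i + 2 \<le> n\<close> by (simp add: omega_add)
    show "s = 1 \<or> s = - 1" by fact
    show "2 * omega (dir (i - 1)) \<noteq> 0" by simp
    show "z i - z (i - 1) = 2 * omega (dir (i - 1))" using zd[of "i - 1"] ile by (simp add: i_def)
    show "z (Suc i) - z i = 2 * omega (dir (i - 1)) * omega s" using zd[of i] ile by (simp only: diri omega_add mult.assoc)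
    have "z n - z i = - (2 * omega (dir n))" using zd[of n] zc by (simp add: algebra_simps)
    also have "omega (dir n) = omega (dir (i - 1) - s + 3)"
      using d3 omega_mod by metis
    also have "- (2 * \<dots>) = 2 * omega (dir (i - 1)) * omega (- s)"
      using omega_add[of "dir (i - 1) - s" 3] omega_add[of "dir (i - 1)" "- s"] by (simp add: omega_3)
    finally show "z n - z i = 2 * omega (dir (i - 1)) * omega (- s)" .
    show "0 < Re (z j - z 0)" if "1 \<le> j" "j \<le> n" for j
      using Re_emb[of "trail 0 0 t ! j"] Re_emb[of "trail 0 0 t ! 0"] pos[OF zi[OF that]]
      by (simp add: z_def z0 height_simps)
    show "z (Suc j) \<noteq> z j" if "j < n" for j
      using dn[of j "Suc j"] that by (simp add: z_def emb_inj)
  qed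
  moreover have "sum_list t1 = (\<Sum>j=i..<n. t ! j)"
  proof -
    have "t1 = drop i t" by (simp add: t(1) i_def)
    then have "sum_list t1 = (\<Sum>j=0..<n - i. t ! (i + j))"
      by (simp add: sum_list_sum_nth n_def)
    also have "\<dots> = (\<Sum>j=i..<n. t ! j)"
      using ile sum.shift_bounds_nat_ivl[of "\<lambda>j. t ! j" 0 i "n - i"] by (simp add: add.commute)
    finally show ?thesis .
  qed
  moreover have "(\<Sum>j=i..<n. t ! j) = (\<Sum>j=i..<n - 1. t ! j) + t ! (n - 1)"
    using \<open>i + 2 \<le> n\<close> sum.atLeastLessThan_Suc[of i "n - 1" "\<lambda>j. t ! j"] by simp
  ultimately show "sum_list t1 = - 5 * s" by simp
qed

section \<open>The parafermionic identity\<close>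

definition saws :: "(int \<times> int) set \<Rightarrow> int list set" where
  "saws \<Omega> = {t. set t \<subseteq> {1, - 1} \<and> set (verts 0 0 t) \<subseteq> \<Omega> \<and> distinct (verts 0 0 t)}"

definition exits :: "(int \<times> int) set \<Rightarrow> int list set" where
  "exits \<Omega> = {t \<in> saws \<Omega>. tip 0 0 t \<notin> \<Omega>}"

definition crit :: real where
  "crit = 1 / sqrt (2 + sqrt 2)"

definition wt :: "int list \<Rightarrow> real" where
  "wt t = crit ^ length t"

text \<open>The angle pi / 8 is 3/8 of the turning angle pi / 3. This is the usual parafermionic
  observable of spin 5/8 multiplied by the direction of the last edge; with this factor included,
  the relation around a vertex has no coefficients.\<close>

definition obs :: "int list \<Rightarrow> complex" where
  "obs t = of_real (wt t) * cis (pi / 8 * of_int (sum_list t))"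

lemma crit_pos: "crit > 0"
  by (simp add: crit_def add_pos_nonneg)

lemma wt_pos: "wt t > 0"
  by (simp add: wt_def crit_pos)

lemma wt_append: "wt (t @ t') = wt t * wt t'"
  by (simp add: wt_def power_add)

lemma cos_pi8_pos: "cos (pi / 8) > 0"
  by (rule cos_gt_zero) (use pi_gt_zero in auto)

lemma crit_cos: "crit = 1 / (2 * cos (pi / 8))"
proof -
  have "(2 * cos (pi / 8))\<^sup>2 = 2 * (2 * (cos (pi / 8))\<^sup>2 - 1) + 2"
    by (simp add: power_mult_distrib)
  also have "2 * (cos (pi / 8))\<^sup>2 - 1 = cos (pi / 4)"
    using cos_double_cos[of "pi / 8"] by simp
  finally have "(2 * cos (pi / 8))\<^sup>2 = 2 + sqrt 2" by (simp add: cos_45)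
  then have "2 * cos (pi / 8) = sqrt (2 + sqrt 2)"
    using cos_pi8_pos by (metis less_eq_real_def real_sqrt_abs abs_of_nonneg mult_nonneg_nonneg zero_le_numeral)
  then show ?thesis by (simp add: crit_def)
qed

text \<open>This is what singles out the weight: \<open>2 * cos (pi / 8) * crit = 1\<close>.\<close>

lemma obs_extend: "obs (t @ [1]) + obs (t @ [- 1]) = obs t"
proof -
  have "obs (t @ [s]) = obs t * (of_real crit * cis (pi / 8 * of_int s))" for s
    by (simp add: obs_def wt_append wt_def cis_mult distrib_left flip: mult.assoc)
  then have "obs (t @ [1]) + obs (t @ [- 1]) = obs t * (of_real crit * (cis (pi / 8) + cis (- (pi / 8))))"
    by (simp add: distrib_left)
  also have "cis (pi / 8) + cis (- (pi / 8)) = of_real (2 * cos (pi / 8))"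
    by (simp add: complex_eq_iff)
  also have "of_real crit * of_real (2 * cos (pi / 8)) = (1 :: complex)"
    using cos_pi8_pos by (simp add: crit_cos del: of_real_mult flip: of_real_mult)
  finally show ?thesis by simp
qed

lemma verts_snoc: "verts 0 0 (t @ [s]) = verts 0 0 t @ [tip 0 0 t]"
  by (simp add: verts_append tip_def)

lemma saws_snoc:
  "t @ [s] \<in> saws \<Omega> \<longleftrightarrow> t \<in> saws \<Omega> \<and> s \<in> {1, - 1} \<and> tip 0 0 t \<in> \<Omega> \<and> tip 0 0 t \<notin> set (verts 0 0 t)"
  by (auto simp: saws_def verts_snoc)

lemma finite_saws:
  assumes "finite \<Omega>"
  shows "finite (saws \<Omega>)"
proof (rule finite_subset)
  show "saws \<Omega> \<subseteq> {t. set t \<subseteq> {1, - 1} \<and> length t \<le> card \<Omega>}"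
  proof
    fix t assume t: "t \<in> saws \<Omega>"
    then have "length t = card (set (verts 0 0 t))"
      by (simp add: saws_def distinct_card)
    also have "\<dots> \<le> card \<Omega>" using t assms by (intro card_mono) (auto simp: saws_def)
    finally show "t \<in> {t. set t \<subseteq> {1, - 1} \<and> length t \<le> card \<Omega>}" using t by (simp add: saws_def)
  qed
  show "finite {t. set t \<subseteq> {1, - 1 :: int} \<and> length t \<le> card \<Omega>}"
    by (rule finite_lists_length_le) simp
qed

text \<open>A walk that faces one of its own vertices, cut there: \<open>t0\<close> is the stem,
  \<open>s\<close> the turn taken at that vertex, and \<open>t1\<close> runs around the
  loop.\<close>

definition loops :: "(int \<times> int) set \<Rightarrow> (int list \<times> int \<times> int list) set" where
  "loops \<Omega> = {(t0, s, t1). t0 @ [s] @ t1 \<in> saws \<Omega> \<and> tip 0 0 (t0 @ [s] @ t1) = tip 0 0 t0}"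

lemma verts_nth_take:
  "j < length t \<Longrightarrow> verts 0 0 t ! j = tip 0 0 (take j t)"
proof -
  assume j: "j < length t"
  have "verts 0 0 (take j t @ [t ! j] @ drop (Suc j) t) ! j = tip 0 0 (take j t)"
    using j by (simp add: verts_append nth_append tip_def)
  then show ?thesis using j by (simp add: id_take_nth_drop[symmetric])
qed

text \<open>A walk visits each vertex once, so the place at which it has to be cut is
  unique.\<close>

lemma loops_bij:
  "bij_betw (\<lambda>(t0, s, t1). t0 @ [s] @ t1) (loops \<Omega>) {t \<in> saws \<Omega>. tip 0 0 t \<in> set (verts 0 0 t)}"
  unfolding bij_betw_def
proof
  have v: "verts 0 0 (t0 @ [s] @ t1) ! length t0 = tip 0 0 t0" for t0 s t1
    using verts_nth_take[of "length t0" "t0 @ [s] @ t1"] by simp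
  show "inj_on (\<lambda>(t0, s, t1). t0 @ [s] @ t1) (loops \<Omega>)"
  proof (rule inj_onI)
    fix l l'
    assume l: "l \<in> loops \<Omega>" "l' \<in> loops \<Omega>" "(case l of (t0, s, t1) \<Rightarrow> t0 @ [s] @ t1) = (case l' of (t0, s, t1) \<Rightarrow> t0 @ [s] @ t1)"
    obtain t0 s t1 t0' s' t1' where ll: "l = (t0, s, t1)" "l' = (t0', s', t1')" by (cases l; cases l')
    have a: "(t0, s, t1) \<in> loops \<Omega>" "(t0', s', t1') \<in> loops \<Omega>" and e: "t0 @ [s] @ t1 = t0' @ [s'] @ t1'"
      using l unfolding ll by simp_all
    define t where "t = t0 @ [s] @ t1"
    have t': "t = t0' @ [s'] @ t1'" using e by (simp only: t_def)
    have "tip 0 0 t = tip 0 0 t0" using a(1) unfolding loops_def t_def by blast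
    moreover have "tip 0 0 t = tip 0 0 t0'" using a(2) unfolding loops_def t' by blast
    ultimately have "verts 0 0 t ! length t0 = verts 0 0 t ! length t0'"
      using v[of t0 s t1] v[of t0' s' t1'] by (simp only: t_def[symmetric] t'[symmetric])
    moreover have "distinct (verts 0 0 t)" using a(1) unfolding loops_def saws_def t_def by blast
    moreover have "length t0 < length t" by (simp add: t_def)
    moreover have "length t0' < length t" by (simp add: t')
    ultimately have "length t0 = length t0'" by (simp add: nth_eq_iff_index_eq)
    then show "l = l'" using e by (simp add: ll)
  qed
  show "(\<lambda>(t0, s, t1). t0 @ [s] @ t1) ` loops \<Omega> = {t \<in> saws \<Omega>. tip 0 0 t \<in> set (verts 0 0 t)}"
  proof (intro equalityI subsetI)
    fix t assume "t \<in> (\<lambda>(t0, s, t1). t0 @ [s] @ t1) ` loops \<Omega>"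
    then obtain t0 s t1 where t: "t = t0 @ [s] @ t1" "(t0, s, t1) \<in> loops \<Omega>" by auto
    have len: "length t0 < length (verts 0 0 t)" by (simp add: t(1))
    have "tip 0 0 t0 \<in> set (verts 0 0 t)"
      using nth_mem[OF len] v[of t0 s t1] unfolding t(1) by (simp only:)
    moreover have "tip 0 0 t = tip 0 0 t0" "t \<in> saws \<Omega>"
      using t(2) unfolding loops_def t(1) by blast+
    ultimately show "t \<in> {t \<in> saws \<Omega>. tip 0 0 t \<in> set (verts 0 0 t)}"
      by simp
  next
    fix t assume t: "t \<in> {t \<in> saws \<Omega>. tip 0 0 t \<in> set (verts 0 0 t)}"
    then obtain j where j: "j < length t" "tip 0 0 t = verts 0 0 t ! j" by (auto simp: in_set_conv_nth)
    have e: "t = take j t @ [t ! j] @ drop (Suc j) t" using j by (simp add: id_take_nth_drop[symmetric])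
    have "(take j t, t ! j, drop (Suc j) t) \<in> loops \<Omega>"
      unfolding loops_def using t j verts_nth_take[OF j(1)] e by simp
    then show "t \<in> (\<lambda>(t0, s, t1). t0 @ [s] @ t1) ` loops \<Omega>"
      using e by (intro image_eqI[of _ _ "(take j t, t ! j, drop (Suc j) t)"]) auto
  qed
qed

lemma mod6_shift:
  fixes D s :: int
  assumes "s = 1 \<or> s = - 1"
  shows "(D - 4 * s) mod 6 = (D - s + 3) mod 6"
  using assms
proof
  assume "s = 1"
  then have "D - s + 3 = (D - 4 * s) + 6" by simp
  then show ?thesis by (simp only: mod_add_self2)
qed (simp add: add.commute)

definition reverse_loop :: "int list \<times> int \<times> int list \<Rightarrow> int list \<times> int \<times> int list" where
  "reverse_loop = (\<lambda>(t0, s, t1). (t0, - s, rev (map uminus t1)))"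

lemma sum_list_rev_uminus: "sum_list (rev (map uminus t)) = - sum_list t" for t :: "int list"
  by (induction t) simp_all

lemma reverse_loop_reverse_loop: "reverse_loop (reverse_loop l) = l"
  by (cases l) (simp add: reverse_loop_def rev_map o_def)

text \<open>Together with the entry turn the loop contributes \<open>- 4 * s\<close> to the winding,
  and \<open>4 * s\<close> when reversed. The difference of 8 turns changes the phase by the angle
  pi.\<close>

lemma reverse_loop:
  assumes pos: "\<And>c. c \<in> \<Omega> \<Longrightarrow> height 0 c > 0" and l: "(t0, s, t1) \<in> loops \<Omega>"
  shows "reverse_loop (t0, s, t1) \<in> loops \<Omega>"
    and "obs (t0 @ [- s] @ rev (map uminus t1)) = - obs (t0 @ [s] @ t1)"
proof -
  define t where "t = t0 @ [s] @ t1"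
  have t: "set t \<subseteq> {1, - 1}" "set (verts 0 0 t) \<subseteq> \<Omega>" "distinct (verts 0 0 t)"
    "tip 0 0 t = tip 0 0 t0"
    using l by (simp_all add: loops_def saws_def t_def)
  have s: "s = 1 \<or> s = - 1" using t(1) by (auto simp: t_def)
  have sum: "sum_list t1 = - 5 * s" and "(sum_list t) mod 6 = (sum_list t0 - s + 3) mod 6"
    using loop_sum[OF t_def t(1) t(3) _ t(4)] pos t(2) by blast+
  define D v m where "D = sum_list t0" and "v = tip 0 0 t0" and "m = v + unit_dir (D + s)"
  have vt: "verts 0 0 t = verts 0 0 t0 @ [v] @ verts m (D + s) t1"
    by (simp add: t_def verts_append v_def tip_def m_def D_def)
  define r where "r = endpos m (D + s) t1"
  have dd: "D + s + sum_list t1 = D - 4 * s" using sum by simp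
  have "(D - 4 * s) mod 6 = (D - s + 3) mod 6" by (rule mod6_shift[OF s])
  then have ud: "unit_dir (D - 4 * s) = - unit_dir (D - s)"
    by (subst unit_dir_add3[symmetric]) (rule unit_dir_cong)
  have "sum_list t = D - 4 * s" using sum by (simp add: t_def D_def)
  moreover have "endpos 0 0 t = r"
    by (simp add: tip_def t_def endpos_append r_def m_def v_def D_def add.assoc)
  ultimately have "tip 0 0 t = r + unit_dir (D - 4 * s)" by (simp add: tip_def)
  \<comment> \<open>The closing edge is the third edge at \<open>v\<close>, so the reversed walk
    enters the loop with the turn \<open>- s\<close>.\<close>
  then have rv: "r = v + unit_dir (D - s)" using t(4) ud by (simp add: v_def algebra_simps)
  let ?t1 = "rev (map uminus t1)"
  have c: "(D - s) mod 6 = (D + s + sum_list t1 + 3) mod 6" 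
  proof -
    have "D + 3 - 4 * s = D + s + sum_list t1 + 3" "D + 3 - s + 3 = D - s + 6" using dd by simp_all
    then show ?thesis using mod6_shift[OF s, of "D + 3"] by (simp only: mod_add_self2)
  qed
  have v1: "verts r (D - s) ?t1 = rev (verts m (D + s) t1)" "endpos r (D - s) ?t1 = m"
    using verts_endpos_rev[of m "D + s" t1] verts_cong[OF c] endpos_cong[OF c] by (simp_all add: r_def)
  let ?t = "t0 @ [- s] @ ?t1"
  have vt': "verts 0 0 ?t = verts 0 0 t0 @ [v] @ rev (verts m (D + s) t1)"
    using v1 rv by (simp add: verts_append v_def tip_def D_def)
  have "tip 0 0 ?t = m + unit_dir (D - s - sum_list t1)"
    using v1 rv by (simp add: tip_def endpos_append v_def D_def sum_list_rev_uminus add_diff_eq del: sum_list_rev)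
  also have "unit_dir (D - s - sum_list t1) = unit_dir (D + s + 3)"
  proof (rule unit_dir_cong)
    have e: "D - 4 * (- s) = D - s - sum_list t1" "D - (- s) + 3 = D + s + 3" using sum by simp_all
    have "- s = 1 \<or> - s = - 1" using s by auto
    from mod6_shift[OF this, of D] show "(D - s - sum_list t1) mod 6 = (D + s + 3) mod 6"
      unfolding e .
  qed
  finally have tip: "tip 0 0 ?t = v" by (simp add: m_def unit_dir_add3)
  have "set ?t \<subseteq> {1, - 1}" using t(1) by (auto simp: t_def)
  then show "reverse_loop (t0, s, t1) \<in> loops \<Omega>"
    using tip t vt vt' by (auto simp: reverse_loop_def loops_def saws_def v_def)
  have "obs ?t = of_real (wt t) * cis (pi / 8 * of_int (D + 4 * s))"
    using sum by (simp add: obs_def wt_def t_def D_def sum_list_rev_uminus algebra_simps del: sum_list_rev)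
  moreover have "obs t = of_real (wt t) * cis (pi / 8 * of_int (D - 4 * s))"
    using sum by (simp add: obs_def wt_def t_def D_def)
  moreover have "cis (pi / 8 * of_int (D + 4 * s)) = - cis (pi / 8 * of_int (D - 4 * s))"
  proof -
    have e: "pi / 8 * of_int (D + 4 * s) = pi / 8 * of_int (D - 4 * s) + of_int s * pi" 
      by (simp add: field_simps)
    have "cis (of_int s * pi) = - 1" using s by (auto simp: complex_eq_iff)
    then show ?thesis unfolding e by (simp flip: cis_mult)
  qed
  ultimately show "obs (t0 @ [- s] @ rev (map uminus t1)) = - obs (t0 @ [s] @ t1)"
    by (simp add: t_def)
qed

lemma sum_loops:
  assumes "\<And>c. c \<in> \<Omega> \<Longrightarrow> height 0 c > 0"
  shows "(\<Sum>t | t \<in> saws \<Omega> \<and> tip 0 0 t \<in> set (verts 0 0 t). obs t) = 0"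
proof -
  define g where "g = (\<lambda>(t0, s, t1). t0 @ [s] @ t1 :: int list)"
  have eq: "(\<Sum>t | t \<in> saws \<Omega> \<and> tip 0 0 t \<in> set (verts 0 0 t). obs t) = (\<Sum>l\<in>loops \<Omega>. obs (g l))"
    using sum.reindex_bij_betw[OF loops_bij, of obs] by (simp add: g_def)
  have R: "reverse_loop l \<in> loops \<Omega>" if "l \<in> loops \<Omega>" for l
    using that reverse_loop(1)[of \<Omega>] assms by (cases l) blast
  have "bij_betw reverse_loop (loops \<Omega>) (loops \<Omega>)"
    by (rule bij_betw_byWitness[where f' = reverse_loop]) (use R in \<open>auto simp: reverse_loop_reverse_loop\<close>)
  then have "(\<Sum>l\<in>loops \<Omega>. obs (g l)) = (\<Sum>l\<in>loops \<Omega>. obs (g (reverse_loop l)))"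
    by (rule sum.reindex_bij_betw[symmetric])
  also have "\<dots> = (\<Sum>l\<in>loops \<Omega>. - obs (g l))"
  proof (rule sum.cong)
    fix l assume l: "l \<in> loops \<Omega>"
    obtain t0 s t1 where l': "l = (t0, s, t1)" by (cases l)
    show "obs (g (reverse_loop l)) = - obs (g l)"
      using reverse_loop(2)[of \<Omega> t0 s t1] assms l unfolding l' reverse_loop_def g_def by simp
  qed simp
  also have "\<dots> = - (\<Sum>l\<in>loops \<Omega>. obs (g l))" by (rule sum_negf)
  finally show ?thesis using eq by simp
qed

text \<open>Every nonempty walk extends a unique extendable one. By \<open>obs_extend\<close> the
  sum over all walks is therefore \<open>obs [] = 1\<close> plus the sum over the extendable walks,
  which cancels.\<close>

theorem sum_exits:
  assumes fin: "finite \<Omega>" and pos: "\<And>c. c \<in> \<Omega> \<Longrightarrow> height 0 c > 0"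
  shows "(\<Sum>t\<in>exits \<Omega>. obs t) = 1"
proof -
  define ext where "ext = {t \<in> saws \<Omega>. tip 0 0 t \<in> \<Omega> \<and> tip 0 0 t \<notin> set (verts 0 0 t)}"
  define cl where "cl = {t \<in> saws \<Omega>. tip 0 0 t \<in> set (verts 0 0 t)}"
  note f = finite_saws[OF fin]
  have fe: "finite ext" "finite cl" "finite (exits \<Omega>)" using f by (simp_all add: ext_def cl_def exits_def)
  have "saws \<Omega> = insert [] ((\<lambda>(t, s). t @ [s]) ` (ext \<times> {1, - 1}))" (is "?A = insert [] ?B")
  proof (intro equalityI subsetI)
    fix t assume "t \<in> saws \<Omega>"
    then show "t \<in> insert [] ?B"
      by (cases t rule: rev_cases) (auto simp: saws_snoc ext_def)
  next
    fix t assume "t \<in> insert [] ?B"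
    then show "t \<in> saws \<Omega>"
      by (auto simp: saws_snoc ext_def) (auto simp: saws_def)
  qed
  then have "(\<Sum>t\<in>saws \<Omega>. obs t) = obs [] + (\<Sum>t\<in>?B. obs t)"
    using fe by (simp add: sum.insert_if image_iff)
  also have "(\<Sum>t\<in>?B. obs t) = (\<Sum>(t, s)\<in>ext \<times> {1, - 1}. obs (t @ [s]))"
    by (subst sum.reindex) (auto simp: inj_on_def intro!: sum.cong)
  also have "\<dots> = (\<Sum>t\<in>ext. obs t)"
    by (subst sum.cartesian_product[symmetric]) (simp add: obs_extend)
  finally have 1: "(\<Sum>t\<in>saws \<Omega>. obs t) = 1 + (\<Sum>t\<in>ext. obs t)" by (simp add: obs_def wt_def)
  have "saws \<Omega> = ext \<union> (cl \<union> exits \<Omega>)"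
    by (auto simp: ext_def cl_def exits_def)
  moreover have "ext \<inter> (cl \<union> exits \<Omega>) = {}" by (auto simp: ext_def cl_def exits_def)
  moreover have "cl \<inter> exits \<Omega> = {}" by (auto simp: cl_def exits_def saws_def)
  ultimately have "(\<Sum>t\<in>saws \<Omega>. obs t) = (\<Sum>t\<in>ext. obs t) + ((\<Sum>t\<in>cl. obs t) + (\<Sum>t\<in>exits \<Omega>. obs t))"
    using fe by (simp add: sum.union_disjoint)
  moreover have "(\<Sum>t\<in>cl. obs t) = 0" using sum_loops[OF pos] by (simp add: cl_def)
  ultimately show ?thesis using 1 by simp
qed

section \<open>Strips and triangles\<close>

text \<open>The midpoints of edges of direction \<open>k\<close> have heights with exactly this
  residue. A boundary line at such a height cuts these edges in the middle and at right angles, and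
  no other edge crosses it.\<close>

lemma crossing_direction:
  assumes ok: "mid_ok m d" and B: "B mod 6 = (if k mod 3 = 0 then 0 else 3)"
    and "height k (m - unit_dir d) < B" "height k (m + unit_dir d) \<ge> B"
  shows "d mod 6 = k mod 6" "height k m = B"
proof -
  define e l where "e = d mod 6" and "l = k mod 6"
  have *: "mid_ok m e" "unit_dir d = unit_dir e" "height k z = height l z"
    "B mod 6 = (if l = 0 \<or> l = 3 then 0 else 3)" for z
  proof -
    show "mid_ok m e" "unit_dir d = unit_dir e" "height k z = height l z"
      using ok mid_ok_cong[of d e m] unit_dir_cong[of d e] height_cong[of k l] by (simp_all add: e_def l_def)
    have "k mod 3 = 0 \<longleftrightarrow> l = 0 \<or> l = 3" unfolding l_def by presburger
    then show "B mod 6 = (if l = 0 \<or> l = 3 then 0 else 3)" using B by simp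
  qed
  have e: "e = 0 \<or> e = 1 \<or> e = 2 \<or> e = 3 \<or> e = 4 \<or> e = 5"
    unfolding e_def by (cases d rule: mod6_cases) auto
  have l: "l = 0 \<or> l = 1 \<or> l = 2 \<or> l = 3 \<or> l = 4 \<or> l = 5"
    unfolding l_def by (cases k rule: mod6_cases) auto
  have hB: "height l m - height l (unit_dir e) < B" "B \<le> height l m + height l (unit_dir e)"
    using assms(3,4) *(2,3) by (simp_all add: height_add height_diff)
  have e3: "e mod 3 = (if e = 0 \<or> e = 3 then 0 else if e = 1 \<or> e = 4 then 1 else 2)" using e by auto
  have "3 dvd fst m - snd m" using *(1) by (simp add: mid_ok_def mod_eq_0_iff_dvd)
  then obtain i where i: "fst m = snd m + 3 * i" by (metis dvdE add.commute diff_add_cancel)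
  have par: "even (snd m) \<longleftrightarrow> e = 0 \<or> e = 3" "even i \<longleftrightarrow> \<not> (e = 2 \<or> e = 5)"
    using *(1) e unfolding mid_ok_def e3 by (auto simp: i split: if_splits)
  define \<beta> :: int where "\<beta> = (if l = 0 \<or> l = 3 then 0 else 1)"
  obtain j where B: "B = 6 * j + 3 * \<beta>"
  proof
    show "B = 6 * (B div 6) + 3 * \<beta>"
      using *(4) mult_div_mod_eq[of 6 B] by (simp add: \<beta>_def split: if_splits)
  qed
  \<comment> \<open>\<open>Y\<close> is the height of the midpoint above the line in units of 3, and
    it is even exactly for edges parallel to direction \<open>k\<close>. An edge rises by at most 2
    on either side of its midpoint, so a crossing has \<open>Y = 0\<close>.\<close>
  define Y where "Y = snd m * (fst (unit_dir l) + snd (unit_dir l))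
    + i * (2 * fst (unit_dir l) + snd (unit_dir l)) - 2 * j - \<beta>"
  have Y: "height l m = B + 3 * Y"
    by (simp add: height_def Y_def B i algebra_simps)
  have even_Y: "even Y \<longleftrightarrow> (e - l) mod 3 = 0"
    using e l par unfolding Y_def \<beta>_def by (elim disjE; simp add: unit_dir_def)
  have "height l (unit_dir e) = 2 \<and> e = l \<or> height l (unit_dir e) \<le> 1 \<and> (e - l) mod 3 \<noteq> 0 \<or> height l (unit_dir e) \<le> 0"
    using e l by (elim disjE; simp add: height_simps unit_dir_def)
  then have "e = l \<and> height l m = B"
  proof (elim disjE conjE)
    assume "height l (unit_dir e) = 2" "e = l"
    moreover from this have "even Y" using even_Y by simp
    then obtain y where "Y = 2 * y" by (rule evenE)
    ultimately show ?thesis using hB Y by simp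
  next
    assume "height l (unit_dir e) \<le> 1" "(e - l) mod 3 \<noteq> 0"
    then have "Y = 0" "odd Y" using hB Y even_Y by auto
    then show ?thesis by simp
  next
    assume "height l (unit_dir e) \<le> 0"
    then show ?thesis using hB by simp
  qed
  then show "d mod 6 = k mod 6" "height k m = B" using *(3) by (auto simp: e_def l_def)
qed

text \<open>By the second claim a walk of at least two steps does not end at its first vertex, so it
  cannot leave the domain along its starting edge.\<close>

lemma last_vertex:
  assumes "t \<noteq> []"
  shows "endpos 0 0 t - unit_dir (sum_list t) \<in> set (verts 0 0 t)"
    and "length t > 1 \<Longrightarrow> distinct (verts 0 0 t) \<Longrightarrow> endpos 0 0 t - unit_dir (sum_list t) \<noteq> (1, 0)"
proof -
  obtain t' s where t: "t = t' @ [s]" using assms by (cases t rule: rev_cases) auto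
  have e: "endpos 0 0 t - unit_dir (sum_list t) = tip 0 0 t'"
    by (simp add: t endpos_append tip_def)
  show "endpos 0 0 t - unit_dir (sum_list t) \<in> set (verts 0 0 t)"
    unfolding e by (simp add: t verts_snoc)
  assume a: "length t > 1" "distinct (verts 0 0 t)"
  then obtain s' t'' where "t' = s' # t''" by (cases t') (auto simp: t)
  then have "(1, 0) \<in> set (verts 0 0 t')" by simp
  then show "endpos 0 0 t - unit_dir (sum_list t) \<noteq> (1, 0)"
    unfolding e using a(2) by (auto simp: t verts_snoc)
qed

text \<open>A convex polygon, given by pairs of an outer normal direction and a bound.\<close>

definition region :: "(int \<times> int) set \<Rightarrow> (int \<times> int) set" where
  "region H = {c. \<forall>(k, B)\<in>H. height k c < B}"

lemma region_exit_iff: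
  assumes t: "t \<in> saws (region H)" "t \<noteq> []" and kB: "(k, B) \<in> H" "B mod 6 = (if k mod 3 = 0 then 0 else 3)"
  shows "height k (tip 0 0 t) \<ge> B \<longleftrightarrow> height k (endpos 0 0 t) = B"
    and "height k (tip 0 0 t) \<ge> B \<Longrightarrow> sum_list t mod 6 = k mod 6"
proof -
  let ?m = "endpos 0 0 t" and ?d = "sum_list t"
  have lt: "height k (?m - unit_dir ?d) < B"
    using last_vertex(1)[OF t(2)] t(1) kB(1) by (auto simp: saws_def region_def)
  have ok: "mid_ok ?m ?d" using mid_ok_endpos[of 0 0 t] t by (auto simp: saws_def)
  have tip: "tip 0 0 t = ?m + unit_dir ?d" by (simp add: tip_def)
  show "height k (tip 0 0 t) \<ge> B \<longleftrightarrow> height k ?m = B"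
    using crossing_direction(2)[OF ok kB(2) lt] lt unfolding tip by (auto simp: height_add height_diff)
  show "sum_list t mod 6 = k mod 6" if "height k (tip 0 0 t) \<ge> B"
    using crossing_direction(1)[OF ok kB(2) lt] that unfolding tip by simp
qed

text \<open>The tip is extreme in the direction of the side that is crossed, so
  \<open>exit_turning\<close> applies. The winding is known modulo 6, and the bound 3 then leaves a
  single value, or the two values 3 and -3 for the left side.\<close>

lemma region_exit:
  assumes H: "(3, 0) \<in> H" "\<And>k B. (k, B) \<in> H \<Longrightarrow> B mod 6 = (if k mod 3 = 0 then 0 else 3) \<and> B \<ge> 0"
    "\<And>B. (3, B) \<in> H \<Longrightarrow> B = 0" "\<And>k B. (k, B) \<in> H \<Longrightarrow> 0 \<le> k \<and> k < 6"
    and base: "(1, 0) \<in> region H" and t: "t \<in> exits (region H)"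
  obtains k B where "(k, B) \<in> H" "t \<noteq> []" "sum_list t mod 6 = k" "height k (endpos 0 0 t) = B"
    "\<bar>sum_list t\<bar> \<le> 3"
proof -
  have ts: "t \<in> saws (region H)" "tip 0 0 t \<notin> region H" using t by (auto simp: exits_def)
  have ne: "t \<noteq> []" using ts(2) base by (auto simp: tip_def)
  obtain k B where kB: "(k, B) \<in> H" "height k (tip 0 0 t) \<ge> B"
    using ts(2) by (auto simp: region_def not_less)
  have Bm: "B mod 6 = (if k mod 3 = 0 then 0 else 3)" "B \<ge> 0" "0 \<le> k" "k < 6" using H(2,4)[OF kB(1)] by auto
  note ex = region_exit_iff[OF ts(1) ne kB(1) Bm(1)]
  have hm: "height k (endpos 0 0 t) = B" and sm: "sum_list t mod 6 = k"
    using ex kB(2) Bm(3,4) by auto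
  have verts: "set (verts 0 0 t) \<subseteq> region H" "distinct (verts 0 0 t)" "set t \<subseteq> {1, - 1}"
    using ts(1) by (auto simp: saws_def)
  have pos: "height 0 c > 0" if "c \<in> set (verts 0 0 t)" for c
  proof -
    have "height 3 c < 0" using that verts(1) H(1) by (fastforce simp: region_def)
    then show ?thesis by (simp add: height_simps)
  qed
  define c where "c = endpos 0 0 t - unit_dir (sum_list t)"
  have c: "height 0 c > 0" "height k c < B"
    using last_vertex(1)[OF ne] pos verts(1) kB(1) by (auto simp: c_def region_def)
  have uk: "unit_dir (sum_list t) = unit_dir k" using sm Bm by (intro unit_dir_cong) auto
  have tipc: "tip 0 0 t = c + unit_dir k + unit_dir k" "endpos 0 0 t = c + unit_dir k"
    by (simp_all add: tip_def c_def flip: uk)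
  have k: "k = 0 \<or> k = 1 \<or> k = 2 \<or> k = 3 \<or> k = 4 \<or> k = 5" using Bm by presburger
  have "\<bar>sum_list t\<bar> \<le> 3"
  proof (rule exit_turning)
    show "height 0 (tip 0 0 t) \<ge> - 2"
    proof (cases "k = 3")
      case True
      then have "B = 0" using H(3) kB(1) by auto
      then show ?thesis using tipc hm True by (simp add: height_simps unit_dir_def)
    next
      case False
      then have "height 0 (unit_dir k) \<ge> - 1" using k by (auto simp: height_simps unit_dir_def)
      then show ?thesis using c(1) unfolding tipc height_add by linarith
    qed
    show "tip 0 0 t \<noteq> (-1, 0)"
    proof (cases "k = 3")
      case True
      have "length t > 1"
      proof (rule ccontr)
        assume "\<not> length t > 1"
        then obtain s where "t = [s]" using ne by (cases t) auto
        then show False using sm True verts(3) by auto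
      qed
      then have "c \<noteq> (1, 0)" using last_vertex(2)[OF ne] verts(2) by (simp add: c_def)
      then show ?thesis unfolding tipc(1) True by (auto simp: unit_dir_def prod_eq_iff)
    next
      case False
      then have "height 0 (unit_dir k) \<ge> - 1" using k by (auto simp: height_simps unit_dir_def)
      then have "height 0 (tip 0 0 t) > - 2" using c(1) unfolding tipc height_add by linarith
      then show ?thesis by (auto simp: height_simps)
    qed
    show "height k c' < height k (tip 0 0 t)" if "c' \<in> set (verts 0 0 t)" for c'
    proof -
      have "height k c' < B" using that verts(1) kB(1) by (auto simp: region_def)
      then show ?thesis using kB(2) by simp
    qed
    have "height k (unit_dir k) = 2" using k by (auto simp: height_simps unit_dir_def)
    then have "height k (tip 0 0 t) = B + 2" using hm tipc by (simp add: height_add)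
    moreover have "height k (-1, 0) \<le> 2" using k by (auto simp: height_simps)
    ultimately show "height k (-1, 0) \<le> height k (tip 0 0 t)" using Bm by simp
    show "sum_list t mod 6 = k mod 6" using sm by (metis mod_mod_trivial)
  qed (use ne verts pos in auto)
  then show thesis using that[of k B] kB ne sm hm by blast
qed

section \<open>Weights of returning and crossing walks in a strip\<close>

definition ca :: real where "ca = cos (3 * pi / 8)"

lemma ca_pos: "ca > 0"
  unfolding ca_def by (rule cos_gt_zero) (use pi_gt_zero in auto)

lemma Re_obs: "Re (obs t) = wt t * cos (pi / 8 * of_int (sum_list t))"
  by (simp add: obs_def)

lemma Re_obs_nonneg: "\<bar>sum_list t\<bar> \<le> 3 \<Longrightarrow> Re (obs t) \<ge> 0"
proof -
  assume "\<bar>sum_list t\<bar> \<le> 3"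
  then have s: "\<bar>real_of_int (sum_list t)\<bar> \<le> 3" by linarith
  have "\<bar>pi / 8 * of_int (sum_list t)\<bar> = pi / 8 * \<bar>of_int (sum_list t)\<bar>" by (simp add: abs_mult)
  also have "\<dots> \<le> pi / 8 * 3" using s by (intro mult_left_mono) auto
  also have "\<dots> \<le> pi / 2" using pi_gt_zero by linarith
  finally have "\<bar>pi / 8 * of_int (sum_list t)\<bar> \<le> pi / 2" .
  then have "cos (pi / 8 * of_int (sum_list t)) \<ge> 0" by (intro cos_ge_zero) linarith+
  then show ?thesis using wt_pos[of t] by (simp add: Re_obs)
qed

lemma Re_obs_3: "sum_list t = 3 \<or> sum_list t = - 3 \<Longrightarrow> Re (obs t) = ca * wt t"
  by (auto simp: Re_obs ca_def mult.commute)

text \<open>Measured by \<open>height 0\<close>, a column of rhombi has width 6.\<close>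

definition strip_verts :: "nat \<Rightarrow> (int \<times> int) set" where
  "strip_verts T = {c. 0 < height 0 c \<and> height 0 c < 6 * int T}"

definition arcs :: "nat \<Rightarrow> int list set" where
  "arcs T = {t \<in> saws (strip_verts T). t \<noteq> [] \<and> height 0 (endpos 0 0 t) = 0}"

definition crossings :: "nat \<Rightarrow> int list set" where
  "crossings T = {t \<in> saws (strip_verts T). height 0 (endpos 0 0 t) = 6 * int T}"

lemma finite_bounded_heights:
  assumes "\<And>c. c \<in> A \<Longrightarrow> \<bar>height 0 c\<bar> \<le> K \<and> \<bar>height 1 c\<bar> \<le> K"
  shows "finite A"
proof (rule finite_subset)
  show "A \<subseteq> {- K..K} \<times> {- K..K}"
    using assms by (fastforce simp: height_simps)
qed simp

text \<open>Finite families of walks fit into a trapezoid cut from the strip. There the walks ending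
  on the left have winding 3 or -3 and those ending on the right have winding 0, so the real parts
  of their phases are \<open>ca\<close> and 1.\<close>

lemma strip_inequality:
  assumes T: "T \<ge> 1" and F: "finite F" "F \<subseteq> arcs T" and G: "finite G" "G \<subseteq> crossings T"
  shows "ca * (\<Sum>t\<in>F. wt t) + (\<Sum>t\<in>G. wt t) \<le> 1"
proof -
  define S where "S = (\<Union>t\<in>F \<union> G. set (verts 0 0 t))"
  have finS: "finite S" using F G by (simp add: S_def)
  define K where "K = (\<Sum>c\<in>S. \<bar>height 1 c\<bar> + \<bar>height 2 c\<bar>)"
  have K: "\<bar>height 1 c\<bar> + \<bar>height 2 c\<bar> \<le> K" if "c \<in> S" for c
    unfolding K_def using finS that by (intro member_le_sum) auto
  have K0: "K \<ge> 0" unfolding K_def by (intro sum_nonneg) auto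
  \<comment> \<open>\<open>K\<close> dominates the heights that occur in \<open>S\<close>, and
    \<open>6 * K + 3\<close> has the residue required of a side in direction 2 or 4.\<close>
  define H :: "(int \<times> int) set" where "H = {(3, 0), (0, 6 * int T), (2, 6 * K + 3), (4, 6 * K + 3)}"
  have inR: "c \<in> region H" if "c \<in> strip_verts T" "c \<in> S" for c
    using that K[of c] K0 by (auto simp: region_def H_def strip_verts_def height_simps)
  have saws: "t \<in> saws (region H)" if "t \<in> F \<union> G" for t
  proof -
    have "t \<in> saws (strip_verts T)" "set (verts 0 0 t) \<subseteq> S"
      using that F G by (auto simp: arcs_def crossings_def S_def)
    then show ?thesis using inR unfolding saws_def by blast
  qed
  have ne: "t \<noteq> []" if "t \<in> F \<union> G" for t
    using that F G T by (auto simp: arcs_def crossings_def)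
  have HB: "B mod 6 = (if k mod 3 = 0 then 0 else 3) \<and> B \<ge> 0" if "(k, B) \<in> H" for k B
    using that K0 by (auto simp: H_def)
  have H3: "B = 0" if "(3, B) \<in> H" for B using that by (auto simp: H_def)
  have H6: "0 \<le> k \<and> k < 6" if "(k, B) \<in> H" for k B using that by (auto simp: H_def)
  have base: "(1, 0) \<in> region H" using K0 T by (auto simp: region_def H_def height_simps)
  have fin: "finite (region H)"
  proof (rule finite_bounded_heights)
    fix c assume "c \<in> region H"
    then show "\<bar>height 0 c\<bar> \<le> 6 * int T + 6 * K + 3 \<and> \<bar>height 1 c\<bar> \<le> 6 * int T + 6 * K + 3"
      using K0 by (auto simp: region_def H_def height_simps)
  qed
  have pos: "height 0 c > 0" if "c \<in> region H" for c
    using that by (auto simp: region_def H_def height_simps)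
  have small: "\<bar>sum_list t\<bar> \<le> 3" if "t \<in> exits (region H)" for t
    using region_exit[OF _ HB H3 H6 base that] by (auto simp: H_def)
  have Fe: "t \<in> exits (region H) \<and> Re (obs t) = ca * wt t" if "t \<in> F" for t
  proof -
    have m: "height 3 (endpos 0 0 t) = 0" using that F by (auto simp: arcs_def height_simps)
    have s: "t \<in> saws (region H)" "t \<noteq> []" using saws ne that by auto
    have h: "(3, 0) \<in> H" by (simp add: H_def)
    note x = region_exit_iff[OF s h]
    have tip: "height 3 (tip 0 0 t) \<ge> 0" "sum_list t mod 6 = 3" using x m by auto
    then have "tip 0 0 t \<notin> region H"
      using h by (auto simp: region_def not_less intro!: bexI[of _ "(3, 0)"])
    then have e: "t \<in> exits (region H)" using s by (simp add: exits_def)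
    have "sum_list t = 3 \<or> sum_list t = - 3" using tip(2) small[OF e] by presburger
    then show ?thesis using e Re_obs_3 by blast
  qed
  have Ge: "t \<in> exits (region H) \<and> Re (obs t) = wt t" if "t \<in> G" for t
  proof -
    have m: "height 0 (endpos 0 0 t) = 6 * int T" using that G by (auto simp: crossings_def)
    have s: "t \<in> saws (region H)" "t \<noteq> []" using saws ne that by auto
    have h: "(0, 6 * int T) \<in> H" by (simp add: H_def)
    note x = region_exit_iff[OF s h]
    have tip: "height 0 (tip 0 0 t) \<ge> 6 * int T" "sum_list t mod 6 = 0" using x m by auto
    then have "tip 0 0 t \<notin> region H"
      using h by (auto simp: region_def not_less intro!: bexI[of _ "(0, 6 * int T)"])
    then have e: "t \<in> exits (region H)" using s by (simp add: exits_def)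
    have "sum_list t = 0" using tip(2) small[OF e] by presburger
    then show ?thesis using e by (simp add: Re_obs)
  qed
  have "arcs T \<inter> crossings T = {}" using T by (auto simp: arcs_def crossings_def)
  then have disj: "F \<inter> G = {}" using F(2) G(2) by blast
  have "ca * (\<Sum>t\<in>F. wt t) + (\<Sum>t\<in>G. wt t) = (\<Sum>t\<in>F. Re (obs t)) + (\<Sum>t\<in>G. Re (obs t))"
    using Fe Ge by (simp add: sum_distrib_left)
  also have "\<dots> = (\<Sum>t\<in>F \<union> G. Re (obs t))"
    using F G disj by (simp add: sum.union_disjoint)
  \<comment> \<open>The walks added here have winding at most 3 in absolute value, hence phases with
    nonnegative real part.\<close>
  also have "\<dots> \<le> (\<Sum>t\<in>exits (region H). Re (obs t))"
  proof (rule sum_mono2)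
    show "finite (exits (region H))" using finite_saws[OF fin] by (simp add: exits_def)
  qed (use Fe Ge small Re_obs_nonneg in auto)
  also have "\<dots> = 1"
    using sum_exits[OF fin pos] by (metis Re_sum one_complex.simps(1))
  finally show ?thesis .
qed

definition arc_sum :: "nat \<Rightarrow> real" where
  "arc_sum T = infsum wt (arcs T)"

definition deficit :: "nat \<Rightarrow> real" where
  "deficit T = 1 - ca * arc_sum T"

lemma summable_arcs:
  assumes "T \<ge> 1"
  shows "wt summable_on arcs T"
proof (rule nonneg_bdd_above_summable_on)
  show "bdd_above (sum wt ` {F. F \<subseteq> arcs T \<and> finite F})"
  proof (rule bdd_aboveI2)
    fix F assume "F \<in> {F. F \<subseteq> arcs T \<and> finite F}"
    then have "ca * sum wt F \<le> 1" using strip_inequality[of T F "{}"] assms by simp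
    then show "sum wt F \<le> 1 / ca" using ca_pos by (simp add: field_simps)
  qed
qed (use wt_pos in \<open>auto intro: less_imp_le\<close>)

lemma crossings_le_deficit:
  assumes "T \<ge> 1" "finite G" "G \<subseteq> crossings T"
  shows "(\<Sum>t\<in>G. wt t) \<le> deficit T"
proof -
  have "arc_sum T \<le> (1 - (\<Sum>t\<in>G. wt t)) / ca"
    unfolding arc_sum_def
  proof (rule infsum_le_finite_sums)
    fix F assume "finite F" "F \<subseteq> arcs T"
    then show "sum wt F \<le> (1 - (\<Sum>t\<in>G. wt t)) / ca"
      using strip_inequality[of T F G] assms ca_pos by (simp add: field_simps)
  qed (rule summable_arcs[OF assms(1)])
  then show ?thesis using ca_pos by (simp add: deficit_def field_simps)
qed

lemma deficit_nonneg: "T \<ge> 1 \<Longrightarrow> deficit T \<ge> 0"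
  using crossings_le_deficit[of T "{}"] by simp

lemma arc_sum_ge: "T \<ge> 1 \<Longrightarrow> finite F \<Longrightarrow> F \<subseteq> arcs T \<Longrightarrow> sum wt F \<le> arc_sum T"
  unfolding arc_sum_def
  by (intro finite_sum_le_infsum summable_arcs) (use wt_pos in \<open>auto intro: less_imp_le\<close>)

lemma deficit_antimono: "1 \<le> T \<Longrightarrow> T \<le> T' \<Longrightarrow> deficit T' \<le> deficit T"
proof -
  assume T: "1 \<le> T" "T \<le> T'"
  then have "arcs T \<subseteq> arcs T'" by (auto simp: arcs_def saws_def strip_verts_def)
  then have "arc_sum T \<le> arc_sum T'" unfolding arc_sum_def
    using T wt_pos by (intro infsum_mono2 summable_arcs) (auto intro: less_imp_le)
  then show ?thesis using ca_pos by (simp add: deficit_def)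
qed

section \<open>Walks in an equilateral triangle\<close>

definition tri :: "nat \<Rightarrow> (int \<times> int) set" where
  "tri N = region {(3, 0), (1, 6 * int N - 3), (5, 6 * int N - 3)}"

lemma tri_iff: "c \<in> tri N \<longleftrightarrow> height 0 c > 0 \<and> height 1 c < 6 * int N - 3 \<and> - height 2 c < 6 * int N - 3"
  by (auto simp: tri_def region_def height_simps)

lemma finite_tri: "finite (tri N)"
proof (rule finite_bounded_heights)
  fix c assume "c \<in> tri N"
  then show "\<bar>height 0 c\<bar> \<le> 12 * int N \<and> \<bar>height 1 c\<bar> \<le> 12 * int N"
    by (auto simp: tri_iff height_simps)
qed

text \<open>Winding 1 characterises the exits through the upper right side.\<close>

definition ups :: "nat \<Rightarrow> int list set" where
  "ups N = {t \<in> exits (tri N). sum_list t = 1}"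

lemma tri_exit:
  assumes "N \<ge> 1" "t \<in> exits (tri N)"
  shows "(sum_list t \<in> {3, - 3} \<and> height 0 (endpos 0 0 t) = 0 \<or>
    sum_list t = 1 \<and> height 1 (endpos 0 0 t) = 6 * int N - 3 \<or> sum_list t = - 1) \<and> t \<noteq> []"
proof -
  let ?H = "{(3, 0), (1, 6 * int N - 3), (5, 6 * int N - 3)}"
  obtain k B where kB: "(k, B) \<in> ?H" "t \<noteq> []" "sum_list t mod 6 = k" "height k (endpos 0 0 t) = B" "\<bar>sum_list t\<bar> \<le> 3"
  proof (rule region_exit[of ?H t])
    show "(3, 0) \<in> ?H" by simp
    show "B mod 6 = (if k mod 3 = 0 then 0 else 3) \<and> 0 \<le> B" if "(k, B) \<in> ?H" for k B :: int
    proof -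
      have "(6 * int N - 3) mod 6 = 3" by presburger
      then show ?thesis using that assms(1) by auto
    qed
    show "(1, 0) \<in> region ?H" using assms(1) by (auto simp: region_def height_simps)
  qed (use assms(2) in \<open>auto simp: tri_def\<close>)
  have "k = 3 \<and> B = 0 \<or> k = 1 \<and> B = 6 * int N - 3 \<or> k = 5" using kB(1) by auto
  then show ?thesis
  proof (elim disjE conjE)
    assume k: "k = 3" "B = 0"
    have "sum_list t \<in> {3, - 3}" using kB(3,5) k by (simp; presburger)
    then show ?thesis using kB k by (simp add: height_simps)
  next
    assume k: "k = 1" "B = 6 * int N - 3"
    have "sum_list t = 1" using kB(3,5) k by presburger
    then show ?thesis using kB k by simp
  next
    assume k: "k = 5"
    have "sum_list t = - 1" using kB(3,5) k by presburger
    then show ?thesis using kB by simp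
  qed
qed

lemma flip_exits: "t \<in> exits (tri N) \<Longrightarrow> map uminus t \<in> exits (tri N)"
proof -
  assume t: "t \<in> exits (tri N)"
  have f: "flip c \<in> tri N \<longleftrightarrow> c \<in> tri N" for c
    by (auto simp: tri_iff height_flip height_simps)
  have z: "flip 0 = 0" by (simp add: flip_def prod_eq_iff)
  have v: "verts 0 0 (map uminus t) = map flip (verts 0 0 t)"
    using verts_flip[of 0 0 t] by (simp add: z)
  have s: "sum_list (map uminus t) = - sum_list t" using sum_list_rev_uminus[of t] by simp
  have "tip 0 0 (map uminus t) = flip (tip 0 0 t)"
    using endpos_flip[of 0 0 t] by (simp add: z tip_def flip_add flip_unit_dir s)
  moreover have "set (map uminus t) \<subseteq> {1, - 1}" using t by (auto simp: exits_def saws_def)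
  moreover have "inj_on flip A" for A by (auto simp: inj_on_def flip_inj)
  ultimately show "map uminus t \<in> exits (tri N)"
    using t f by (auto simp: exits_def saws_def v distinct_map)
qed

text \<open>The exits on the left are arcs of a strip, so they take at most
  \<open>ca * arc_sum (2 * N - 1)\<close> of the total 1. The rest is shared equally by the other
  two sides, by reflection, and each of these walks has a phase with real part
  \<open>cos (pi / 8)\<close>, which is \<open>1 / (2 * crit)\<close>.\<close>

lemma ups_weight:
  assumes N: "N \<ge> 1"
  shows "crit * deficit (2 * N - 1) \<le> (\<Sum>t\<in>ups N. wt t)"
proof -
  define U where "U i = {t \<in> exits (tri N). sum_list t = i}" for i
  have fin: "finite (exits (tri N))" using finite_saws[OF finite_tri] by (simp add: exits_def)
  have finU: "finite (U i)" for i using fin by (simp add: U_def)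
  have un: "exits (tri N) = (U 3 \<union> U (- 3)) \<union> (U 1 \<union> U (- 1))"
    using tri_exit[OF N] by (auto simp: U_def)
  have dis: "i \<noteq> j \<Longrightarrow> U i \<inter> U j = {}" for i j by (auto simp: U_def)
  have pos: "height 0 c > 0" if "c \<in> tri N" for c using that by (simp add: tri_iff)
  have "(\<Sum>t\<in>exits (tri N). Re (obs t)) = 1"
    using sum_exits[OF finite_tri pos] by (metis Re_sum one_complex.simps(1))
  moreover have "(\<Sum>t\<in>exits (tri N). Re (obs t)) = (\<Sum>t\<in>U 3 \<union> U (- 3). Re (obs t)) + (\<Sum>t\<in>U 1 \<union> U (- 1). Re (obs t))"
    unfolding un using finU dis by (intro sum.union_disjoint) (auto simp: Int_Un_distrib Int_Un_distrib2)
  moreover have "(\<Sum>t\<in>U 3 \<union> U (- 3). Re (obs t)) = ca * (\<Sum>t\<in>U 3 \<union> U (- 3). wt t)"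
    unfolding sum_distrib_left by (intro sum.cong refl Re_obs_3) (auto simp: U_def)
  moreover have "(\<Sum>t\<in>U 3 \<union> U (- 3). wt t) \<le> arc_sum (2 * N - 1)"
  proof (rule arc_sum_ge)
    show "U 3 \<union> U (- 3) \<subseteq> arcs (2 * N - 1)"
    proof
      fix t assume t: "t \<in> U 3 \<union> U (- 3)"
      then have e: "t \<in> exits (tri N)" by (auto simp: U_def)
      have "height 0 (endpos 0 0 t) = 0 \<and> t \<noteq> []" using tri_exit[OF N e] t by (auto simp: U_def)
      \<comment> \<open>\<open>height 0\<close> is the sum of \<open>height 1\<close> and
        \<open>height 5\<close>, so it stays below \<open>12 * N - 6\<close> in the triangle: this
        is the width of \<open>2 * N - 1\<close> columns.\<close>
      moreover have "tri N \<subseteq> strip_verts (2 * N - 1)"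
        using N by (auto simp: tri_iff strip_verts_def height_simps of_nat_diff)
      ultimately show "t \<in> arcs (2 * N - 1)" using e by (auto simp: arcs_def exits_def saws_def)
    qed
  qed (use N finU in auto)
  moreover have "(\<Sum>t\<in>U 1 \<union> U (- 1). Re (obs t)) = cos (pi / 8) * (\<Sum>t\<in>U 1 \<union> U (- 1). wt t)"
    unfolding sum_distrib_left by (intro sum.cong refl) (auto simp: U_def Re_obs)
  moreover have "(\<Sum>t\<in>U 1 \<union> U (- 1). wt t) = (\<Sum>t\<in>U 1. wt t) + (\<Sum>t\<in>U (- 1). wt t)"
    using finU dis by (intro sum.union_disjoint) auto
  moreover have "(\<Sum>t\<in>U (- 1). wt t) = (\<Sum>t\<in>U 1. wt t)"
  proof (rule sum.reindex_bij_witness[where i = "map uminus" and j = "map uminus"])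
    fix t assume t: "t \<in> U (- 1)"
    show "map uminus t \<in> U 1" using t flip_exits sum_list_rev_uminus[of t] by (auto simp: U_def)
  next
    fix t assume t: "t \<in> U 1"
    show "map uminus t \<in> U (- 1)" using t flip_exits sum_list_rev_uminus[of t] by (auto simp: U_def)
  qed (auto simp: o_def wt_def)
  ultimately have "1 = ca * (\<Sum>t\<in>U 3 \<union> U (- 3). wt t) + cos (pi / 8) * (2 * (\<Sum>t\<in>U 1. wt t))"
    "ca * (\<Sum>t\<in>U 3 \<union> U (- 3). wt t) \<le> ca * arc_sum (2 * N - 1)"
    using ca_pos by (simp_all only: mult_left_mono less_imp_le mult_2)
  then have "deficit (2 * N - 1) \<le> (2 * cos (pi / 8)) * (\<Sum>t\<in>U 1. wt t)" by (simp add: deficit_def algebra_simps)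
  then have "deficit (2 * N - 1) / (2 * cos (pi / 8)) \<le> (\<Sum>t\<in>U 1. wt t)"
    using cos_pi8_pos by (simp add: divide_le_eq mult.commute)
  then show ?thesis by (simp add: crit_cos U_def ups_def)
qed

section \<open>Gluing three triangles\<close>

definition half_plane_arcs :: "int list set" where
  "half_plane_arcs = {t \<in> saws {c. height 0 c > 0}. t \<noteq> [] \<and> height 0 (endpos 0 0 t) = 0}"

text \<open>A finite family lies in some strip, and the bound does not depend on the width. This is
  the total weight available to the glued walks.\<close>

lemma half_plane_arcs_weight:
  assumes "finite F" "F \<subseteq> half_plane_arcs"
  shows "(\<Sum>t\<in>F. wt t) \<le> 1 / ca"
proof -
  define S where "S = (\<Union>t\<in>F. set (verts 0 0 t))"
  have finS: "finite S" using assms by (simp add: S_def)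
  define T where "T = nat (1 + (\<Sum>c\<in>S. \<bar>height 0 c\<bar>))"
  have T: "height 0 c < 6 * int T" if "c \<in> S" for c
  proof -
    have "\<bar>height 0 c\<bar> \<le> (\<Sum>c\<in>S. \<bar>height 0 c\<bar>)" using finS that by (intro member_le_sum) auto
    then show ?thesis by (simp add: T_def)
  qed
  have "(\<Sum>c\<in>S. \<bar>height 0 c\<bar>) \<ge> 0" by (intro sum_nonneg) auto
  then have "T \<ge> 1" unfolding T_def by linarith
  moreover have "F \<subseteq> arcs T"
  proof
    fix t assume t: "t \<in> F"
    then have "t \<in> half_plane_arcs" "set (verts 0 0 t) \<subseteq> S" using assms by (auto simp: S_def)
    then show "t \<in> arcs T" using T by (auto simp: half_plane_arcs_def arcs_def saws_def strip_verts_def)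
  qed
  ultimately have "ca * (\<Sum>t\<in>F. wt t) \<le> 1" using strip_inequality[of T F "{}"] assms by simp
  then show ?thesis using ca_pos by (simp add: field_simps)
qed

text \<open>The end point of a walk in \<open>ups N\<close> is the midpoint of the \<open>exit_index\<close>-th edge, counted from the
  top, of the upper right side of the triangle. Hence the triangle of this size having the end
  point in the middle of its side has the same top vertex.\<close>

definition exit_index :: "int list \<Rightarrow> nat" where
  "exit_index t = nat ((height 0 (endpos 0 0 t) + 3) div 6)"

lemma finite_ups: "finite (ups N)"
  using finite_saws[OF finite_tri] by (simp add: ups_def exits_def)

lemma ups_index:
  assumes "N \<ge> 1" "t \<in> ups N"
  shows "height 1 (endpos 0 0 t) = 6 * int N - 3"
    and "height 0 (endpos 0 0 t) = 6 * int (exit_index t) - 3"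
    and "1 \<le> exit_index t" "exit_index t \<le> 2 * N - 1"
proof -
  have t: "t \<in> exits (tri N)" "sum_list t = 1" using assms by (auto simp: ups_def)
  let ?p = "endpos 0 0 t"
  show h1: "height 1 ?p = 6 * int N - 3" using tri_exit[OF assms(1) t(1)] t(2) by auto
  have ne: "t \<noteq> []" using tri_exit[OF assms(1) t(1)] by auto
  have "?p - unit_dir 1 \<in> tri N"
    using last_vertex(1)[OF ne] t by (auto simp: exits_def saws_def)
  then have b: "height 0 ?p > 0" "height 2 ?p > - (6 * int N - 3)"
    by (auto simp: tri_iff height_diff) (auto simp: height_simps unit_dir_def)
  \<comment> \<open>On this side the midpoints lie at \<open>height 0\<close> equal to an odd
    multiple of 3, so consecutive ones differ by 6.\<close>
  have "mid_ok ?p 1" using mid_ok_endpos[of 0 0 t] t by (auto simp: exits_def saws_def)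
  then have "odd (snd ?p)" "odd (fst ?p)" "(fst ?p - snd ?p) mod 3 = 0" by (auto simp: mid_ok_def)
  then have "(2 * fst ?p + snd ?p + 3) mod 6 = 0" by presburger
  then have m: "(height 0 ?p + 3) mod 6 = 0" by (simp add: height_simps)
  then have e: "height 0 ?p + 3 = 6 * ((height 0 ?p + 3) div 6)" using mult_div_mod_eq[of 6 "height 0 ?p + 3"] by simp
  moreover have "(height 0 ?p + 3) div 6 \<ge> 0" using b(1) by simp
  ultimately have i: "height 0 ?p + 3 = 6 * int (exit_index t)" by (simp add: exit_index_def)
  then show "height 0 ?p = 6 * int (exit_index t) - 3" by simp
  show "1 \<le> exit_index t" using i b(1) by simp
  have "height 0 ?p < 12 * int N - 6" using b(2) h1 height_triple[of ?p] by simp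
  then show "exit_index t \<le> 2 * N - 1" using i by linarith
qed

definition triples :: "nat \<Rightarrow> (int list \<times> int list \<times> int list) set" where
  "triples N = (SIGMA t1 : ups N. SIGMA t2 : ups (exit_index t1). ups (exit_index t2))"

abbreviation glue :: "int list \<times> int list \<times> int list \<Rightarrow> int list" where
  "glue \<equiv> \<lambda>(t1, t2, t3). t1 @ t2 @ t3"

text \<open>A walk of winding 1 ends in direction 1, so its continuation is traced in a frame turned
  by one \<open>rot\<close>. Lists of turns can therefore be joined unchanged.\<close>

lemma verts_endpos_glue:
  assumes "sum_list t1 = 1"
  shows "verts 0 0 (t1 @ t) = verts 0 0 t1 @ map (\<lambda>z. endpos 0 0 t1 + rot z) (verts 0 0 t)"
    and "endpos 0 0 (t1 @ t) = endpos 0 0 t1 + rot (endpos 0 0 t)"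
proof -
  have "rot 0 = 0" by (simp add: rot_def prod_eq_iff)
  then show "verts 0 0 (t1 @ t) = verts 0 0 t1 @ map (\<lambda>z. endpos 0 0 t1 + rot z) (verts 0 0 t)"
    "endpos 0 0 (t1 @ t) = endpos 0 0 t1 + rot (endpos 0 0 t)"
    using verts_rot[of "endpos 0 0 t1" 0 0 t] endpos_rot[of "endpos 0 0 t1" 0 0 t] assms
    by (simp_all add: verts_append endpos_append)
qed

text \<open>The lines at height \<open>6 * N - 3\<close> in directions 1 and 2 meet on the left
  side, at the top vertex of the first triangle, and cut the half-plane into three sectors of angle
  pi / 3. Each piece stays in its own sector, which makes the glued walk self-avoiding.\<close>

lemma glue_facts:
  assumes N: "N \<ge> 1" and t: "(t1, t2, t3) \<in> triples N"
  defines "p1 \<equiv> endpos 0 0 t1" and "p2 \<equiv> endpos 0 0 t2"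
  defines "V1 \<equiv> verts 0 0 t1" and "V2 \<equiv> map (\<lambda>z. p1 + rot z) (verts 0 0 t2)"
    and "V3 \<equiv> map (\<lambda>z. p1 + rot (p2 + rot z)) (verts 0 0 t3)"
  shows "verts 0 0 (glue (t1, t2, t3)) = V1 @ V2 @ V3"
    and "c \<in> set V1 \<Longrightarrow> height 0 c > 0 \<and> height 1 c < 6 * int N - 3"
    and "c \<in> set V2 \<Longrightarrow> height 0 c > 0 \<and> height 1 c > 6 * int N - 3 \<and> height 2 c < 6 * int N - 3"
    and "c \<in> set V3 \<Longrightarrow> height 0 c > 0 \<and> height 1 c > 6 * int N - 3 \<and> height 2 c > 6 * int N - 3"
    and "glue (t1, t2, t3) \<in> half_plane_arcs"
    and "\<exists>j. N \<le> j \<and> j \<le> 9 * N - 8 \<and> height 2 (endpos 0 0 (glue (t1, t2, t3))) = 6 * int j"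
proof -
  define m1 m2 m3 where "m1 = exit_index t1" and "m2 = exit_index t2" and "m3 = exit_index t3"
  have u: "t1 \<in> ups N" "t2 \<in> ups m1" "t3 \<in> ups m2" using t by (auto simp: triples_def m1_def m2_def)
  note i1 = ups_index[OF N u(1), folded m1_def]
  note i2 = ups_index[OF i1(3) u(2), folded m2_def]
  note i3 = ups_index[OF i2(3) u(3), folded m3_def]
  have sums: "sum_list t1 = 1" "sum_list t2 = 1" "sum_list t3 = 1" using u by (auto simp: ups_def)
  have saws: "t1 \<in> saws (tri N)" "t2 \<in> saws (tri m1)" "t3 \<in> saws (tri m2)"
    using u by (auto simp: ups_def exits_def)
  have ne: "t1 \<noteq> []" using sums by auto
  have mm: "m1 \<le> 2 * N - 1" "m2 \<le> 2 * m1 - 1" "m3 \<le> 2 * m2 - 1" "1 \<le> m3"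
    using i1 i2 i3 by auto
  show eq: "verts 0 0 (glue (t1, t2, t3)) = V1 @ V2 @ V3"
    using verts_endpos_glue(1)[OF sums(1), of "t2 @ t3"] verts_endpos_glue(1)[OF sums(2), of t3]
    by (simp add: V1_def V2_def V3_def p1_def p2_def o_def)
  have hr: "height 0 (rot z) = height 0 z - height 1 z" "height 1 (rot z) = height 0 z"
    "height 2 (rot z) = height 1 z" for z
    by (simp_all add: height_simps rot_def)
  have h21: "height 2 z = height 1 z - height 0 z" for z by (simp add: height_simps)
  have P1: "height 0 p1 = 6 * int m1 - 3" "height 1 p1 = 6 * int N - 3" "height 2 p1 = 6 * int N - 6 * int m1"
    using i1 by (simp_all add: p1_def h21)
  have P2: "height 0 p2 = 6 * int m2 - 3" "height 1 p2 = 6 * int m1 - 3"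
    using i2 by (simp_all add: p2_def)
  show c1: "height 0 c > 0 \<and> height 1 c < 6 * int N - 3" if "c \<in> set V1" for c
    using that saws(1) by (auto simp: V1_def saws_def tri_iff)
  show c2: "height 0 c > 0 \<and> height 1 c > 6 * int N - 3 \<and> height 2 c < 6 * int N - 3" if c: "c \<in> set V2" for c
  proof -
    obtain z where z: "z \<in> tri m1" "c = p1 + rot z" using c saws(2) by (auto simp: V2_def saws_def)
    then show ?thesis using P1 by (auto simp: tri_iff height_add hr)
  qed
  show c3: "height 0 c > 0 \<and> height 1 c > 6 * int N - 3 \<and> height 2 c > 6 * int N - 3" if c: "c \<in> set V3" for c
  proof -
    obtain z where z: "z \<in> tri m2" "c = p1 + rot (p2 + rot z)" using c saws(3) by (auto simp: V3_def saws_def)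
    have "height 0 c = 6 * int m2 - 3 - height 1 z" "height 2 c = 6 * int N - 3 + height 0 z"
      using P1 P2 by (simp_all add: z(2) height_add hr)
    then have "height 0 c > 0" "height 2 c > 6 * int N - 3" using z(1) by (auto simp: tri_iff)
    then show ?thesis using h21[of c] by simp
  qed
  have ep: "endpos 0 0 (glue (t1, t2, t3)) = p1 + rot (p2 + rot (endpos 0 0 t3))"
    using verts_endpos_glue(2)[OF sums(1), of "t2 @ t3"] verts_endpos_glue(2)[OF sums(2), of t3]
    by (simp add: p1_def p2_def)
  have h0: "height 0 (endpos 0 0 (glue (t1, t2, t3))) = 0"
    unfolding ep using P1 P2 i3 by (simp add: height_add hr)
  have h2: "height 2 (endpos 0 0 (glue (t1, t2, t3))) = 6 * int (N + m3 - 1)"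
    unfolding ep using P1 P2 i3 by (simp add: height_add hr)
  \<comment> \<open>In units of 6 the common vertex has height \<open>N - 1 / 2\<close>, and the
    walk ends at the \<open>m3\<close>-th midpoint above it. Doubling three times gives
    \<open>m3 \<le> 8 * N - 7\<close>.\<close>
  show "\<exists>j. N \<le> j \<and> j \<le> 9 * N - 8 \<and> height 2 (endpos 0 0 (glue (t1, t2, t3))) = 6 * int j"
    by (rule exI[of _ "N + m3 - 1"]) (use h2 mm N in auto)
  have dis: "distinct (V1 @ V2 @ V3)"
  proof -
    have "distinct V1" "distinct V2" "distinct V3"
      using saws by (auto simp: V1_def V2_def V3_def saws_def distinct_map inj_on_def rot_inj)
    moreover have "set V1 \<inter> (set V2 \<union> set V3) = {}" using c1 c2 c3 by fastforce
    moreover have "set V2 \<inter> set V3 = {}" using c2 c3 by fastforce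
    ultimately show ?thesis by auto
  qed
  have "set (glue (t1, t2, t3)) \<subseteq> {1, - 1}" using saws by (auto simp: saws_def)
  moreover have "set (V1 @ V2 @ V3) \<subseteq> {c. height 0 c > 0}" using c1 c2 c3 by auto
  ultimately show "glue (t1, t2, t3) \<in> half_plane_arcs"
    unfolding half_plane_arcs_def saws_def using dis h0 ne eq by simp
qed

text \<open>The pieces of a glued walk are recovered from its two crossings of the sides of the middle
  triangle.\<close>

lemma inj_on_glue:
  assumes N: "N \<ge> 1"
  shows "inj_on glue (triples N)"
proof (rule inj_onI)
  fix x y assume xy: "x \<in> triples N" "y \<in> triples N" "glue x = glue y"
  obtain t1 t2 t3 s1 s2 s3 where x: "x = (t1, t2, t3)" and y: "y = (s1, s2, s3)" by (cases x; cases y)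
  define P Q where "P c = (height 1 c < 6 * int N - 3)"
    and "Q c = (height 1 c < 6 * int N - 3 \<or> height 2 c < 6 * int N - 3)" for c
  have key: "length r1 = length (takeWhile P (verts 0 0 (glue (r1, r2, r3)))) \<and>
      length (r1 @ r2) = length (takeWhile Q (verts 0 0 (glue (r1, r2, r3))))"
    if r: "(r1, r2, r3) \<in> triples N" for r1 r2 r3
  proof -
    note f = glue_facts[OF N r]
    have "takeWhile P (A @ B) = A" if "\<And>c. c \<in> set A \<Longrightarrow> P c" "\<And>c. c \<in> set B \<Longrightarrow> \<not> P c"
      for A B :: "(int \<times> int) list" and P
      using that by (cases B) (simp_all add: takeWhile_tail)
    note tw = this
    define V1 V2 V3 where "V1 = verts 0 0 r1" and "V2 = map (\<lambda>z. endpos 0 0 r1 + rot z) (verts 0 0 r2)"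
      and "V3 = map (\<lambda>z. endpos 0 0 r1 + rot (endpos 0 0 r2 + rot z)) (verts 0 0 r3)"
    note f = f[folded V1_def V2_def V3_def]
    have "takeWhile P (V1 @ (V2 @ V3)) = V1"
    proof (rule tw)
      fix c assume "c \<in> set (V2 @ V3)"
      then have "height 1 c > 6 * int N - 3" using f(3)[of c] f(4)[of c] by auto
      then show "\<not> P c" by (simp add: P_def)
    qed (use f(2) in \<open>simp add: P_def\<close>)
    moreover have "takeWhile Q ((V1 @ V2) @ V3) = V1 @ V2"
    proof (rule tw)
      fix c assume "c \<in> set (V1 @ V2)"
      then show "Q c" using f(2)[of c] f(3)[of c] by (auto simp: Q_def)
    next
      fix c assume "c \<in> set V3"
      then show "\<not> Q c" using f(4)[of c] by (auto simp: Q_def)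
    qed
    ultimately show ?thesis unfolding f(1) by (simp add: V1_def V2_def)
  qed
  have l: "length t1 = length s1" "length (t1 @ t2) = length (s1 @ s2)"
    using key[of t1 t2 t3] key[of s1 s2 s3] xy unfolding x y by simp_all
  then show "x = y" using xy(3) unfolding x y by simp
qed

definition glued :: "nat \<Rightarrow> int list set" where
  "glued N = glue ` triples N"

lemma finite_triples: "finite (triples N)"
  unfolding triples_def by (intro finite_SigmaI finite_ups)

text \<open>The three sizes are at most \<open>4 * N - 3\<close>, so the strips of
  \<open>ups_weight\<close> have width at most \<open>8 * N\<close>, and monotonicity of
  \<open>deficit\<close> gives one lower bound for the three factors. Each exit determines the size
  of the next triangle, hence the sums are nested and are estimated from the inside.\<close>

lemma glued_weight:
  assumes N: "N \<ge> 1"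
  shows "(crit * deficit (8 * N)) ^ 3 \<le> (\<Sum>t\<in>glued N. wt t)"
proof -
  define \<delta> where "\<delta> = crit * deficit (8 * N)"
  have \<delta>: "\<delta> \<ge> 0" using crit_pos deficit_nonneg[of "8 * N"] N by (simp add: \<delta>_def)
  have up: "\<delta> \<le> (\<Sum>t\<in>ups m. wt t)" if "1 \<le> m" "2 * m - 1 \<le> 8 * N" for m
  proof -
    have "deficit (8 * N) \<le> deficit (2 * m - 1)" using that by (intro deficit_antimono) auto
    then show ?thesis
      using ups_weight[OF that(1)] crit_pos unfolding \<delta>_def by (meson mult_left_mono less_imp_le order_trans)
  qed
  have "(\<Sum>t\<in>glued N. wt t) = (\<Sum>x\<in>triples N. wt (glue x))"
    unfolding glued_def by (simp add: sum.reindex[OF inj_on_glue[OF N]] o_def)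
  also have "\<dots> = (\<Sum>t1\<in>ups N. \<Sum>y\<in>(SIGMA t2 : ups (exit_index t1). ups (exit_index t2)). wt (glue (t1, y)))"
    unfolding triples_def by (subst sum.Sigma) (auto simp: finite_ups case_prod_beta)
  also have "\<dots> = (\<Sum>t1\<in>ups N. \<Sum>t2\<in>ups (exit_index t1). \<Sum>t3\<in>ups (exit_index t2). wt t1 * (wt t2 * wt t3))"
    by (intro sum.cong refl, subst sum.Sigma) (auto simp: finite_ups case_prod_beta wt_append)
  also have "\<dots> = (\<Sum>t1\<in>ups N. wt t1 * (\<Sum>t2\<in>ups (exit_index t1). wt t2 * (\<Sum>t3\<in>ups (exit_index t2). wt t3)))"
    by (simp add: sum_distrib_left)
  also have "\<dots> \<ge> (\<Sum>t1\<in>ups N. wt t1 * (\<Sum>t2\<in>ups (exit_index t1). wt t2 * \<delta>))"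
  proof (intro sum_mono mult_left_mono)
    fix t1 t2 assume t: "t1 \<in> ups N" "t2 \<in> ups (exit_index t1)"
    note i1 = ups_index[OF N t(1)]
    note i2 = ups_index[OF i1(3) t(2)]
    show "\<delta> \<le> sum wt (ups (exit_index t2))" using i1 i2 by (intro up) auto
  qed (use wt_pos in \<open>auto intro: less_imp_le\<close>)
  also have "(\<Sum>t1\<in>ups N. wt t1 * (\<Sum>t2\<in>ups (exit_index t1). wt t2 * \<delta>)) =
      (\<Sum>t1\<in>ups N. wt t1 * ((\<Sum>t2\<in>ups (exit_index t1). wt t2) * \<delta>))"
    by (simp add: sum_distrib_right)
  also have "\<dots> \<ge> (\<Sum>t1\<in>ups N. wt t1 * (\<delta> * \<delta>))"
  proof (intro sum_mono mult_left_mono mult_right_mono)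
    fix t1 assume t: "t1 \<in> ups N"
    show "\<delta> \<le> sum wt (ups (exit_index t1))" using ups_index[OF N t] by (intro up) auto
  qed (use wt_pos \<delta> in \<open>auto intro: less_imp_le\<close>)
  also have "(\<Sum>t1\<in>ups N. wt t1 * (\<delta> * \<delta>)) = (\<Sum>t1\<in>ups N. wt t1) * (\<delta> * \<delta>)"
    by (simp add: sum_distrib_right)
  also have "\<dots> \<ge> \<delta> * (\<delta> * \<delta>)"
    using \<delta> N by (intro mult_right_mono up) auto
  finally show ?thesis by (simp add: \<delta>_def power3_eq_cube mult.assoc)
qed

lemma sum_deficit_cubed:
  "(\<Sum>k<K. (crit * deficit (8 * 9 ^ k)) ^ 3) \<le> 1 / ca"
proof -
  have N: "(9::nat) ^ k \<ge> 1" for k by simp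
  have range: "\<exists>j. 9 ^ k \<le> j \<and> j < 9 ^ Suc k \<and> height 2 (endpos 0 0 t) = 6 * int j" if "t \<in> glued (9 ^ k)" for t k
  proof -
    from that[unfolded glued_def] obtain x where x: "t = glue x" "x \<in> triples (9 ^ k)" by (rule imageE)
    obtain t1 t2 t3 where "x = (t1, t2, t3)" by (cases x)
    with x have t: "(t1, t2, t3) \<in> triples (9 ^ k)" "t = glue (t1, t2, t3)" by simp_all
    obtain j where "9 ^ k \<le> j" "j \<le> 9 * 9 ^ k - 8" "height 2 (endpos 0 0 t) = 6 * int j"
      using glue_facts(6)[OF N t(1)] t(2) by auto
    moreover have "9 * 9 ^ k - 8 < (9::nat) ^ Suc k" by simp
    ultimately show ?thesis by (meson le_less_trans)
  qed
  have disj: "glued (9 ^ k) \<inter> glued (9 ^ l) = {}" if "k < l" for k l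
  proof (rule ccontr)
    assume "glued (9 ^ k) \<inter> glued (9 ^ l) \<noteq> {}"
    then obtain t where t: "t \<in> glued (9 ^ k)" "t \<in> glued (9 ^ l)" by auto
    obtain i j where "9 ^ k \<le> i" "i < 9 ^ Suc k" "height 2 (endpos 0 0 t) = 6 * int i"
      "9 ^ l \<le> j" "j < 9 ^ Suc l" "height 2 (endpos 0 0 t) = 6 * int j"
      using range[OF t(1)] range[OF t(2)] by auto
    moreover have "(9::nat) ^ Suc k \<le> 9 ^ l" using that by (intro power_increasing) auto
    ultimately show False by linarith
  qed
  have fin: "finite (glued N)" for N by (simp add: glued_def finite_triples)
  have "(\<Sum>k<K. (crit * deficit (8 * 9 ^ k)) ^ 3) \<le> (\<Sum>k<K. \<Sum>t\<in>glued (9 ^ k). wt t)"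
    by (intro sum_mono glued_weight N)
  also have "\<dots> = (\<Sum>t\<in>(\<Union>k\<in>{..<K}. glued (9 ^ k)). wt t)"
  proof (rule sum.UNION_disjoint[symmetric])
    show "\<forall>i\<in>{..<K}. \<forall>j\<in>{..<K}. i \<noteq> j \<longrightarrow> glued (9 ^ i) \<inter> glued (9 ^ j) = {}"
      using disj by (metis Int_commute nat_neq_iff)
  qed (use fin in auto)
  also have "\<dots> \<le> 1 / ca"
  proof (rule half_plane_arcs_weight)
    show "(\<Union>k\<in>{..<K}. glued (9 ^ k)) \<subseteq> half_plane_arcs"
      using glue_facts(5)[OF N] by (auto simp: glued_def)
  qed (use fin in auto)
  finally show ?thesis .
qed

lemma summable_deficit_cubed: "summable (\<lambda>k. deficit (8 * 9 ^ k) ^ 3)"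
proof (rule bounded_imp_summable)
  show "0 \<le> deficit (8 * 9 ^ k) ^ 3" for k using deficit_nonneg[of "8 * 9 ^ k"] by simp
  show "(\<Sum>k\<le>K. deficit (8 * 9 ^ k) ^ 3) \<le> 1 / ca / crit ^ 3" for K
  proof -
    have "crit ^ 3 * (\<Sum>k\<le>K. deficit (8 * 9 ^ k) ^ 3) \<le> 1 / ca"
      using sum_deficit_cubed[of "Suc K"]
      by (simp add: power_mult_distrib sum_distrib_left lessThan_Suc_atMost)
    then show ?thesis using crit_pos by (subst pos_le_divide_eq) (simp_all add: mult.commute)
  qed
qed

section \<open>Decay of the deficit\<close>

lemma deficit_tendsto_0: "deficit \<longlonglongrightarrow> 0"
proof -
  have "(\<lambda>k. deficit (8 * 9 ^ k) ^ 3) \<longlonglongrightarrow> 0"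
    by (rule summable_LIMSEQ_zero[OF summable_deficit_cubed])
  then have "(\<lambda>k. root 3 (deficit (8 * 9 ^ k) ^ 3)) \<longlonglongrightarrow> root 3 0"
    by (rule tendsto_real_root)
  moreover have "root 3 (deficit (8 * 9 ^ k) ^ 3) = deficit (8 * 9 ^ k)" for k
    by (rule real_root_power_cancel) (use deficit_nonneg[of "8 * 9 ^ k"] in auto)
  ultimately have lim: "(\<lambda>k. deficit (8 * 9 ^ k)) \<longlonglongrightarrow> 0" by simp
  show ?thesis
  proof (rule LIMSEQ_I)
    fix r :: real assume "r > 0"
    then obtain k where k: "norm (deficit (8 * 9 ^ k) - 0) < r" using LIMSEQ_D[OF lim] by blast
    have "norm (deficit T - 0) < r" if "T \<ge> 8 * 9 ^ k" for T
    proof -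
      have "(1::nat) \<le> 8 * 9 ^ k" by simp
      then have "deficit T \<le> deficit (8 * 9 ^ k)" "deficit T \<ge> 0"
        using deficit_antimono[of "8 * 9 ^ k" T] deficit_nonneg[of T] that by linarith+
      then show ?thesis using k by simp
    qed
    then show "\<exists>no. \<forall>n\<ge>no. norm (deficit n - 0) < r" by blast
  qed
qed

text \<open>Condensation along powers of 9: a block from \<open>8 * 9 ^ k\<close> up to
  \<open>8 * 9 ^ Suc k\<close> has \<open>8 * (8 * 9 ^ k)\<close> members, so the sum of
  \<open>1 / T\<close> over it is at most 8.\<close>

lemma summable_deficit_over:
  "summable (\<lambda>T. 1 / real T * deficit T ^ 3)"
proof -
  define g where "g T = 1 / real T * deficit T ^ 3" for T
  \<comment> \<open>The case \<open>T = 0\<close> is outside the scope of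
    \<open>deficit_nonneg\<close>, but there \<open>1 / 0\<close> is 0.\<close>
  have g0: "g T \<ge> 0" for T using deficit_nonneg[of T] by (cases T) (simp_all add: g_def)
  define a where "a k = deficit (8 * 9 ^ k) ^ 3" for k
  have a0: "a k \<ge> 0" for k using deficit_nonneg[of "8 * 9 ^ k"] by (simp add: a_def)
  have block: "(\<Sum>T = 8 * 9 ^ k..<8 * 9 ^ Suc k. g T) \<le> 8 * a k" for k
  proof -
    have p: "(1::nat) \<le> 8 * 9 ^ k" by simp
    have "g T \<le> 1 / real (8 * 9 ^ k) * a k" if "T \<in> {8 * 9 ^ k..<8 * 9 ^ Suc k}" for T
    proof -
      have T: "8 * 9 ^ k \<le> T" using that by simp
      then have "deficit T \<le> deficit (8 * 9 ^ k)" "deficit T \<ge> 0"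
        using deficit_antimono[of "8 * 9 ^ k" T] deficit_nonneg[of T] p by linarith+
      then have "deficit T ^ 3 \<le> a k" unfolding a_def by (intro power_mono)
      moreover have "1 / real T \<le> 1 / real (8 * 9 ^ k)"
      proof (rule frac_le)
        show "0 < real (8 * 9 ^ k)" by simp
        show "real (8 * 9 ^ k) \<le> real T" using T by (rule of_nat_mono)
      qed simp_all
      ultimately show ?thesis unfolding g_def
        using \<open>deficit T \<ge> 0\<close> by (intro mult_mono) auto
    qed
    then have "(\<Sum>T = 8 * 9 ^ k..<8 * 9 ^ Suc k. g T) \<le> (\<Sum>T = 8 * 9 ^ k..<8 * 9 ^ Suc k::nat. 1 / real (8 * 9 ^ k) * a k)"
      by (rule sum_mono)
    also have "\<dots> = real (8 * 9 ^ Suc k - 8 * 9 ^ k) * (1 / real (8 * 9 ^ k) * a k)" by simp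
    also have "8 * 9 ^ Suc k - 8 * 9 ^ k = 8 * (8 * 9 ^ k :: nat)" by simp
    also have "real (8 * (8 * 9 ^ k)) * (1 / real (8 * 9 ^ k) * a k) = 8 * a k" by simp
    finally show ?thesis .
  qed
  have total: "(\<Sum>T<8 * 9 ^ K. g T) \<le> (\<Sum>T<8. g T) + 8 * (\<Sum>k<K. a k)" for K
  proof (induction K)
    case (Suc K)
    have "(\<Sum>T<8 * 9 ^ Suc K. g T) = (\<Sum>T<8 * 9 ^ K. g T) + (\<Sum>T = 8 * 9 ^ K..<8 * 9 ^ Suc K. g T)"
      by (simp only: lessThan_atLeast0) (rule sum.atLeastLessThan_concat[symmetric], auto)
    then show ?case using Suc block[of K] by simp
  qed simp
  have bound: "(\<Sum>T\<le>n. g T) \<le> (\<Sum>T<8. g T) + 8 * suminf a" for n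
  proof -
    have "n < 8 * 9 ^ n"
      by (induction n) auto
    then have "(\<Sum>T\<le>n. g T) \<le> (\<Sum>T<8 * 9 ^ n. g T)"
      using g0 by (intro sum_mono2) auto
    also have "\<dots> \<le> (\<Sum>T<8. g T) + 8 * (\<Sum>k<n. a k)" by (rule total)
    also have "(\<Sum>k<n. a k) \<le> suminf a"
      using summable_deficit_cubed a0 by (intro sum_le_suminf) (auto simp: a_def[abs_def])
    finally show ?thesis by simp
  qed
  have "summable g" by (rule bounded_imp_summable[OF g0 bound])
  then show ?thesis by (simp add: g_def[abs_def])
qed

text \<open>Otherwise the summable cubes would eventually dominate
  \<open>1 / ln (8 * 9 ^ k)\<close>, hence a multiple of the harmonic series.\<close>

lemma infinite_small_deficit:
  "infinite {T. T \<ge> 1 \<and> deficit T < 1 / ln (real T) powr (1 / 3)}"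
proof
  assume "finite {T. T \<ge> 1 \<and> deficit T < 1 / ln (real T) powr (1 / 3)}" (is "finite ?S")
  then obtain M where M: "\<And>T. T \<in> ?S \<Longrightarrow> T < M" using finite_nat_set_iff_bounded by auto
  have big: "1 / (ln 72 * real (Suc k)) \<le> deficit (8 * 9 ^ k) ^ 3" if "k \<ge> M" for k
  proof -
    define T :: nat where "T = 8 * 9 ^ k"
    have "k < 8 * 9 ^ k" by (induction k) auto
    then have "T \<notin> ?S" using M[of T] that unfolding T_def by linarith
    moreover have T: "T \<ge> 8" by (simp add: T_def)
    ultimately have ge: "1 / ln (real T) powr (1 / 3) \<le> deficit T" by auto
    have ln0: "ln (real T) > 0" using T by simp
    then have "(1 / ln (real T) powr (1 / 3)) ^ 3 = 1 / ln (real T)"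
      by (simp add: power_divide powr_power)
    then have "1 / ln (real T) \<le> deficit T ^ 3"
      using power_mono[OF ge, of 3] by simp
    moreover have "ln (real T) \<le> ln 72 * real (Suc k)"
    proof -
      \<comment> \<open>A single power with exponent \<open>Suc k\<close> makes the logarithm a
        multiple of \<open>Suc k\<close>.\<close>
      have "T \<le> 72 ^ Suc k"
        unfolding T_def power_Suc by (intro mult_mono power_mono) auto
      then have "real T \<le> real (72 ^ Suc k)" by (rule of_nat_mono)
      then have "ln (real T) \<le> ln (72 ^ Suc k)" using T by (subst ln_le_cancel_iff) auto
      also have "\<dots> = ln 72 * real (Suc k)" by (subst ln_realpow) auto
      finally show ?thesis .
    qed
    ultimately show ?thesis
      using ln0 unfolding T_def by (meson divide_left_mono frac_le order_trans zero_le_one less_imp_le order_refl)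
  qed
  have "summable (\<lambda>k. 1 / (ln 72 * real (Suc k)))"
  proof (rule summable_comparison_test)
    show "\<exists>N. \<forall>k\<ge>N. norm (1 / (ln 72 * real (Suc k))) \<le> deficit (8 * 9 ^ k) ^ 3"
      using big by (intro exI[of _ M]) (auto simp del: of_nat_Suc)
  qed (rule summable_deficit_cubed)
  then have "summable (\<lambda>k. ln 72 * (1 / (ln 72 * real (Suc k))))" by (rule summable_mult)
  moreover have "ln 72 * (1 / (ln 72 * real (Suc k))) = inverse (real (Suc k))" for k
  proof -
    have "ln (72 :: real) \<noteq> 0" by simp
    then show ?thesis by (simp add: divide_simps del: of_nat_Suc)
  qed
  ultimately have "summable (\<lambda>k. inverse (real (Suc k)))" by simp
  then show False using not_summable_harmonic[where 'a = real] summable_Suc_iff by blast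
qed

section \<open>Bridges\<close>

text \<open>Side midpoints and triangle centres have integer coordinates in the lattice scaled by
  \<open>1 / (2 * sqrt 3)\<close>.\<close>

definition place :: "int \<times> int \<Rightarrow> complex" where
  "place z = emb z / of_real (2 * sqrt 3)"

lemma place_inj: "place z = place z' \<longleftrightarrow> z = z'"
  by (simp add: place_def emb_inj)

lemma midpoint_place: "midpoint (place x) (place y) = place z" if "x + y = z + z"
proof -
  have "emb x + emb y = 2 * emb z" using that by (metis emb_add mult_2)
  then show ?thesis by (simp add: place_def midpoint_def scaleR_conv_of_real flip: add_divide_distrib)
qed

lemma vertex_place: "vertex k j = place (4 * int k - 3 - 2 * j, 4 * j - 2 * int k)"
proof (rule complex_eqI)
  have s: "sqrt 3 * sqrt 3 = (3 :: real)" by simp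
  have "Re (place (4 * int k - 3 - 2 * j, 4 * j - 2 * int k)) = (3 * (real k - 1)) / (2 * sqrt 3)"
    by (simp add: place_def emb_complex algebra_simps add_divide_distrib diff_divide_distrib del: of_real_mult)
  also have "\<dots> = (real k - 1) * (sqrt 3 / 2)"
    using s by (simp add: field_simps)
  finally show "Re (vertex k j) = Re (place (4 * int k - 3 - 2 * j, 4 * j - 2 * int k))"
    by (simp add: vertex_def sin_60)
  show "Im (vertex k j) = Im (place (4 * int k - 3 - 2 * j, 4 * j - 2 * int k))"
    by (simp add: vertex_def place_def emb_complex cos_60 field_simps del: of_real_mult)
qed

text \<open>The triangle dual to the hexagonal vertex \<open>c\<close>. The two classes of vertices
  modulo 3 are the two orientations of the triangles, and the offsets are twice the unit directions
  of even or of odd index.\<close>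

definition corners :: "int \<times> int \<Rightarrow> (int \<times> int) set" where
  "corners c = (if (fst c - snd c) mod 3 = 1 then {c + (2, 0), c + (-2, 2), c + (0, -2)}
     else {c + (0, 2), c + (-2, 0), c + (2, -2)})"

definition triangle_at :: "int \<times> int \<Rightarrow> complex set" where
  "triangle_at c = place ` corners c"

text \<open>The centroid of the corners is \<open>c\<close>.\<close>

lemma corners_inj: "corners c = corners c' \<Longrightarrow> c = c'"
proof -
  have "(\<Sum>z\<in>corners c. fst z) = 3 * fst c \<and> (\<Sum>z\<in>corners c. snd z) = 3 * snd c" for c
    by (cases c) (simp add: corners_def)
  moreover assume "corners c = corners c'"
  ultimately show "c = c'" by (metis prod_eqI mult_cancel_left zero_neq_numeral)
qed

lemma triangle_at_inj: "triangle_at c = triangle_at c' \<Longrightarrow> c = c'"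
proof -
  assume "triangle_at c = triangle_at c'"
  moreover have "inj place" by (simp add: inj_def place_inj)
  ultimately show "c = c'" unfolding triangle_at_def by (metis corners_inj inj_image_eq_iff)
qed

lemma triangle_WN_at:
  "triangle_WN k j = triangle_at (4 * int k - 3 - 2 * j, 4 * j - 2 * int k + 2)"
proof -
  have "(4 * int k - 3 - 2 * j - (4 * j - 2 * int k + 2)) = 1 + 3 * (2 * int k - 2 * j - 2)" by simp
  then have "(4 * int k - 3 - 2 * j - (4 * j - 2 * int k + 2)) mod 3 = 1" by (simp only: mod_mult_self2) simp
  then show ?thesis
    by (simp add: triangle_WN_def triangle_at_def corners_def vertex_place) (auto simp: algebra_simps)
qed

lemma triangle_SE_at:
  "triangle_SE k j = triangle_at (4 * int k - 1 - 2 * j, 4 * j - 2 * int k)"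
proof -
  have "(4 * int k - 1 - 2 * j - (4 * j - 2 * int k)) = 2 + 3 * (2 * int k - 2 * j - 1)" by simp
  then have "(4 * int k - 1 - 2 * j - (4 * j - 2 * int k)) mod 3 = 2" by (simp only: mod_mult_self2) simp
  then show ?thesis
    by (simp add: triangle_SE_def triangle_at_def corners_def vertex_place) (auto simp: algebra_simps)
qed

lemma column_triangle:
  assumes "t \<in> column_triangles k"
  obtains c d where "t = triangle_at c" "mid_ok (c - unit_dir d) d" "6 * int k - 6 < height 0 c" "height 0 c < 6 * int k"
proof -
  consider j where "t = triangle_WN k j" | j where "t = triangle_SE k j"
    using assms by (auto simp: column_triangles_def)
  then show thesis
  proof cases
    case (1 j)
    have "4 * int k - 4 - 2 * j - (4 * j - 2 * int k + 2) = 3 * (2 * int k - 2 * j - 2)" by simp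
    then have "(4 * int k - 4 - 2 * j - (4 * j - 2 * int k + 2)) mod 3 = 0" by (simp only: mod_mult_self1_is_0)
    then show thesis
      by (intro that[of "(4 * int k - 3 - 2 * j, 4 * j - 2 * int k + 2)" 0])
        (simp_all add: 1 triangle_WN_at mid_ok_def height_simps)
  next
    case (2 j)
    have "4 * int k - 1 - 2 * j - (4 * j - 2 * int k - 1) = 3 * (2 * int k - 2 * j)" by simp
    then have "(4 * int k - 1 - 2 * j - (4 * j - 2 * int k - 1)) mod 3 = 0" by (simp only: mod_mult_self1_is_0)
    moreover have "unit_dir 1 = (0, 1)" by (simp add: unit_dir_def)
    ultimately show thesis
      by (intro that[of "(4 * int k - 1 - 2 * j, 4 * j - 2 * int k)" 1])
        (simp_all add: 2 triangle_SE_at mid_ok_def height_simps)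
  qed
qed

lemma strip_triangle:
  assumes "triangle_at c \<in> strip T"
  shows "c \<in> strip_verts T"
proof -
  obtain k where k: "1 \<le> k" "k \<le> T" "triangle_at c \<in> column_triangles k"
    using assms by (auto simp: strip_def)
  then obtain c' where "triangle_at c = triangle_at c'" "6 * int k - 6 < height 0 c'" "height 0 c' < 6 * int k"
    by (metis column_triangle)
  then show ?thesis using k triangle_at_inj[of c c'] by (auto simp: strip_verts_def)
qed

lemma corners_mid_ok:
  assumes "mid_ok m d"
  defines "c \<equiv> m + unit_dir d"
  shows "corners c = (\<lambda>e. c + unit_dir e + unit_dir e) ` {d, d + 2, d - 2}"
proof -
  define k where "k = d mod 6"
  have dk: "(d + 2) mod 6 = (k + 2) mod 6" "(d - 2) mod 6 = (k - 2) mod 6" "d mod 6 = k mod 6"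
    by (simp_all add: k_def mod_add_left_eq mod_diff_left_eq)
  then have u: "unit_dir (d + 2) = unit_dir (k + 2)" "unit_dir (d - 2) = unit_dir (k - 2)" "unit_dir d = unit_dir k"
    by (blast intro: unit_dir_cong)+
  have par: "even d = even k"
    using mod2_of_mod6[of d] mod2_of_mod6[of k] dk by (simp only: even_iff_mod_2_eq_zero)
  have k: "k = 0 \<or> k = 1 \<or> k = 2 \<or> k = 3 \<or> k = 4 \<or> k = 5"
    unfolding k_def by (cases d rule: mod6_cases) auto
  have "corners c = (if even k then {c + (2, 0), c + (-2, 2), c + (0, -2)} else {c + (0, 2), c + (-2, 0), c + (2, -2)})"
    using mid_ok_vertex(3)[OF assms(1)] by (simp add: corners_def c_def par)
  also have "\<dots> = (\<lambda>e. c + unit_dir e + unit_dir e) ` {d, d + 2, d - 2}"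
    using k unfolding image_insert image_empty u
    by (cases c) (elim disjE; auto simp: unit_dir_def)
  finally show ?thesis .
qed

text \<open>Each side is crossed in its middle by one of the three hexagonal edges at the centre:
  the edge of arrival and those that follow a left or a right turn.\<close>

lemma side_midpoints_triangle_at:
  assumes "mid_ok m d"
  shows "side_midpoints (triangle_at (m + unit_dir d)) =
    place ` {m, m + unit_dir d + unit_dir (d + 1), m + unit_dir d + unit_dir (d - 1)}"
proof -
  define c where "c = m + unit_dir d"
  define A where "A = place (c + unit_dir d + unit_dir d)"
  define B where "B = place (c + unit_dir (d + 2) + unit_dir (d + 2))"
  define C where "C = place (c + unit_dir (d - 2) + unit_dir (d - 2))"
  have T: "triangle_at c = {A, B, C}"
    using corners_mid_ok[OF assms] by (simp add: triangle_at_def c_def A_def B_def C_def)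
  have us: "unit_dir d + unit_dir (d + 2) = unit_dir (d + 1)" "unit_dir d + unit_dir (d - 2) = unit_dir (d - 1)"
    "unit_dir (d + 2) + unit_dir (d - 2) = - unit_dir d"
  proof -
    have *: "unit_dir e + unit_dir (e + 2) = unit_dir (e + 1)" for e
    proof -
      have "unit_dir (e + 1) = rot (unit_dir e)" "unit_dir (e + 2) = rot (rot (unit_dir e))"
        using rot_unit_dir[of e] rot_unit_dir[of "e + 1"] by (simp_all add: add.assoc)
      then show ?thesis by (simp add: rot_def prod_eq_iff)
    qed
    show "unit_dir d + unit_dir (d + 2) = unit_dir (d + 1)" by (rule *)
    show "unit_dir d + unit_dir (d - 2) = unit_dir (d - 1)" using *[of "d - 2"] by (simp add: add.commute)
    have "unit_dir (d + 2) + unit_dir (d + 4) = unit_dir (d + 3)" using *[of "d + 2"] by (simp add: add.commute)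
    moreover have "unit_dir (d + 4) = unit_dir (d - 2)"
    proof (rule unit_dir_cong)
      have "d + 4 = d - 2 + 6" by simp
      then show "(d + 4) mod 6 = (d - 2) mod 6" by (simp only: mod_add_self2)
    qed
    ultimately show "unit_dir (d + 2) + unit_dir (d - 2) = - unit_dir d" by (simp add: unit_dir_add3)
  qed
  have AB: "midpoint A B = place (c + unit_dir (d + 1))" and AC: "midpoint A C = place (c + unit_dir (d - 1))"
    and BC: "midpoint B C = place m"
    unfolding A_def B_def C_def
    by (rule midpoint_place, use us in \<open>simp add: c_def algebra_simps prod_eq_iff\<close>)+
  have ne: "A \<noteq> B" "A \<noteq> C" "B \<noteq> C"
  proof -
    have x: "place (c + unit_dir e + unit_dir e) \<noteq> place (c + unit_dir f + unit_dir f)" if "e mod 6 \<noteq> f mod 6" for e f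
      using that unit_dir_inj[of e f] by (simp add: place_inj prod_eq_iff)
    have "d mod 6 \<noteq> (d + 2) mod 6" "d mod 6 \<noteq> (d - 2) mod 6" "(d + 2) mod 6 \<noteq> (d - 2) mod 6"
      by (simp_all add: mod_eq_dvd_iff)
    then show "A \<noteq> B" "A \<noteq> C" "B \<noteq> C" unfolding A_def B_def C_def using x by blast+
  qed
  have "side_midpoints {A, B, C} = {midpoint A B, midpoint A C, midpoint B C}"
    using ne unfolding side_midpoints_def
    by (auto simp: midpoint_sym) 
  then show ?thesis using T AB AC BC by (simp add: c_def insert_commute)
qed

lemma mid_ok_unique: "mid_ok m d \<Longrightarrow> mid_ok m e \<Longrightarrow> d mod 3 = e mod 3"
proof -
  assume a: "mid_ok m d" "mid_ok m e"
  have "d mod 3 = 0 \<or> d mod 3 = 1 \<or> d mod 3 = 2" "e mod 3 = 0 \<or> e mod 3 = 1 \<or> e mod 3 = 2"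
    using pos_mod_bound[of 3 d] pos_mod_sign[of 3 d] pos_mod_bound[of 3 e] pos_mod_sign[of 3 e] by linarith+
  then show ?thesis using a unfolding mid_ok_def by auto
qed

text \<open>A midpoint determines the direction of its edge modulo 3, so the centre of the triangle
  is one of the two end points of that edge.\<close>

lemma triangle_with_side_midpoint:
  assumes m: "mid_ok m d" and t: "t \<in> half_plane" "place m \<in> side_midpoints t"
  shows "t = triangle_at (m + unit_dir d) \<or> t = triangle_at (m - unit_dir d)"
proof -
  obtain k where "t \<in> column_triangles k" using t(1) by (auto simp: half_plane_def)
  then obtain c d' where c: "t = triangle_at c" "mid_ok (c - unit_dir d') d'" by (rule column_triangle)
  have sm: "place m \<in> place ` {c - unit_dir d', c + unit_dir (d' + 1), c + unit_dir (d' - 1)}"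
    using side_midpoints_triangle_at[OF c(2)] t(2) c(1) by simp
  have "m \<in> {c - unit_dir d', c + unit_dir (d' + 1), c + unit_dir (d' - 1)}"
    using sm by (auto simp: place_inj)
  then obtain g where g: "m = c + unit_dir g" "mid_ok m g"
  proof (elim insertE emptyE)
    assume "m = c - unit_dir d'"
    then show thesis using that[of "d' + 3"] c(2) by (simp add: unit_dir_add3 mid_ok_add3)
  next
    assume "m = c + unit_dir (d' + 1)"
    then show thesis using that[of "d' + 1"] mid_ok_step[OF c(2), of 1] by simp
  next
    assume "m = c + unit_dir (d' - 1)"
    then show thesis using that[of "d' - 1"] mid_ok_step[OF c(2), of "- 1"] by simp
  qed
  have "g mod 3 = d mod 3" using mid_ok_unique g(2) m by blast
  then have "3 dvd g - d" by (simp add: mod_eq_dvd_iff)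
  then obtain i where i: "g = d + 3 * i" by (metis dvdE add.commute diff_add_cancel)
  have "unit_dir g = unit_dir d \<or> unit_dir g = - unit_dir d"
  proof (cases "even i")
    case True
    then obtain l where "i = 2 * l" by (rule evenE)
    then have "g = d + l * 6" using i by simp
    then show ?thesis using unit_dir_cong[of g d] by (simp only: mod_mult_self1) simp
  next
    case False
    then obtain l where "i = 2 * l + 1" by (rule oddE)
    then have "g = (d + 3) + l * 6" using i by simp
    then show ?thesis using unit_dir_cong[of g "d + 3"] by (simp only: mod_mult_self1 unit_dir_add3) simp
  qed
  then show ?thesis using g(1) c(1) by auto
qed

section \<open>Lists of turns of bridges\<close>

primrec mids :: "int \<times> int \<Rightarrow> int \<Rightarrow> int list \<Rightarrow> (int \<times> int) list" where
  "mids m d [] = [m]"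
| "mids m d (s # t) = m # mids (m + unit_dir d + unit_dir (d + s)) (d + s) t"

lemma last_mids: "last (mids m d t) = endpos m d t"
proof (induction t arbitrary: m d)
  case (Cons s t)
  have "mids m' d' t \<noteq> []" for m' d' by (cases t) auto
  then show ?case using Cons by simp
qed simp

text \<open>Within a triangle, distinctness of the midpoints leaves two ways on, the turns 1 and -1.
  Distinctness of the triangles forces the walk across the side it has reached, which determines the
  next triangle.\<close>

lemma trace_walk:
  assumes "mid_ok m d" "length ps = length ts + 1" "set ts \<subseteq> half_plane"
    "\<forall>i < length ts. ps ! i \<in> side_midpoints (ts ! i) \<and> ps ! (i + 1) \<in> side_midpoints (ts ! i)"
    "distinct ps" "distinct ts" "hd ps = place m" "ts \<noteq> [] \<Longrightarrow> hd ts = triangle_at (m + unit_dir d)"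
  shows "\<exists>t. set t \<subseteq> {1, - 1} \<and> ps = map place (mids m d t) \<and> ts = map triangle_at (verts m d t)"
  using assms
proof (induction ts arbitrary: m d ps)
  case Nil
  then have "ps = [place m]" by (cases ps) auto
  then show ?case by (intro exI[of _ "[]"]) simp
next
  case (Cons T ts)
  obtain p1 ps' where ps: "ps = place m # p1 # ps'"
    using Cons.prems(2,7) by (cases ps; cases "tl ps") auto
  have T: "T = triangle_at (m + unit_dir d)" using Cons.prems(8) by simp
  have "p1 \<in> side_midpoints T" "p1 \<noteq> place m"
    using Cons.prems(4)[rule_format, of 0] Cons.prems(5) by (auto simp: ps)
  then have "p1 = place (m + unit_dir d + unit_dir (d + 1)) \<or> p1 = place (m + unit_dir d + unit_dir (d - 1))"
    using side_midpoints_triangle_at[OF Cons.prems(1)] T by auto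
  then obtain s where s: "s = 1 \<or> s = - 1" "p1 = place (m + unit_dir d + unit_dir (d + s))"
    by (metis add_uminus_conv_diff)
  define m' where "m' = m + unit_dir d + unit_dir (d + s)"
  have ok: "mid_ok m' (d + s)" unfolding m'_def by (rule mid_ok_step[OF Cons.prems(1) s(1)])
  have "\<exists>t. set t \<subseteq> {1, - 1} \<and> p1 # ps' = map place (mids m' (d + s) t) \<and> ts = map triangle_at (verts m' (d + s) t)"
  proof (rule Cons.IH[OF ok])
    show "\<forall>i<length ts. (p1 # ps') ! i \<in> side_midpoints (ts ! i) \<and> (p1 # ps') ! (i + 1) \<in> side_midpoints (ts ! i)"
    proof (intro allI impI)
      fix i assume "i < length ts"
      then show "(p1 # ps') ! i \<in> side_midpoints (ts ! i) \<and> (p1 # ps') ! (i + 1) \<in> side_midpoints (ts ! i)"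
        using Cons.prems(4)[rule_format, of "Suc i"] by (simp add: ps)
    qed
    show "hd ts = triangle_at (m' + unit_dir (d + s))" if ne: "ts \<noteq> []"
    proof -
      have "hd ts \<in> half_plane" "hd ts \<noteq> T" using ne Cons.prems(3,6) by (cases ts; auto)+
      moreover have "place m' \<in> side_midpoints (hd ts)"
        using ne Cons.prems(4)[rule_format, of 1] s(2) by (cases ts) (auto simp: ps m'_def)
      ultimately show ?thesis
        using triangle_with_side_midpoint[OF ok, of "hd ts"] T by (auto simp: m'_def)
    qed
    show "length (p1 # ps') = length ts + 1" "set ts \<subseteq> half_plane" "distinct ts"
      using Cons.prems(2,3,6) by (simp_all add: ps)
    show "distinct (p1 # ps')" "hd (p1 # ps') = place m'"
      using Cons.prems(5) s(2) by (simp_all add: ps m'_def)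
  qed
  then obtain t where tt: "set t \<subseteq> {1, - 1} \<and> p1 # ps' = map place (mids m' (d + s) t) \<and>
    ts = map triangle_at (verts m' (d + s) t)" ..
  note t = tt[THEN conjunct1] tt[THEN conjunct2, THEN conjunct1] tt[THEN conjunct2, THEN conjunct2]
  show ?case
  proof (intro exI[of _ "s # t"] conjI)
    show "set (s # t) \<subseteq> {1, - 1}" using t(1) s(1) by auto
    show "ps = map place (mids m d (s # t))" using ps t(2) by (simp only: mids.simps list.map m'_def)
    show "T # ts = map triangle_at (verts m d (s # t))" using T t(3) by (simp only: verts.simps list.map m'_def)
  qed
qed

lemma mid_E_place: "mid_E k j = place (4 * int k - 2 * j, 4 * j - 2 * int k)"
  unfolding mid_E_def vertex_place by (rule midpoint_place) simp

lemma bridges_subset: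
  assumes "T \<ge> 1"
  shows "bridges T \<subseteq> (\<lambda>t. (map place (mids 0 0 t), map triangle_at (verts 0 0 t))) ` crossings T"
proof
  fix \<gamma> assume "\<gamma> \<in> bridges T"
  then obtain ps ts where g: "\<gamma> = (ps, ts)" and saw: "self_avoiding_walk (ps, ts)" and st: "set ts \<subseteq> strip T"
    and hd: "hd ps = 0" and "last ps \<in> range (mid_E T)"
    by (auto simp: bridges_def)
  then obtain j where j: "last ps = place (4 * int T - 2 * j, 4 * j - 2 * int T)" by (auto simp: mid_E_place)
  note w = saw[unfolded self_avoiding_walk_def prod.case]
  have p0: "place 0 = 0" by (simp add: place_def)
  have "ts \<noteq> []"
  proof
    assume "ts = []"
    then have "ps = [place 0]" using w hd p0 by (cases ps) auto
    then have "(0, 0) = (4 * int T - 2 * j, 4 * j - 2 * int T)"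
      using j by (simp add: place_inj zero_prod_def)
    then show False using assms by auto
  qed
  then obtain T0 ts' where ts: "ts = T0 # ts'" by (cases ts) auto
  have "place 0 \<in> side_midpoints T0" "T0 \<in> half_plane"
    using w ts hd p0 by (cases ps; auto)+
  then have "T0 = triangle_at (0 + unit_dir 0) \<or> T0 = triangle_at (0 - unit_dir 0)"
    by (intro triangle_with_side_midpoint) auto
  \<comment> \<open>The other triangle at the origin lies to the left of the strip, so the walk
    starts in direction 0.\<close>
  moreover have "T0 \<noteq> triangle_at (0 - unit_dir 0)"
  proof
    assume "T0 = triangle_at (0 - unit_dir 0)"
    then have "0 - unit_dir 0 \<in> strip_verts T" using st ts strip_triangle by auto
    then show False by (simp add: strip_verts_def height_simps)
  qed
  ultimately have "hd ts = triangle_at (0 + unit_dir 0)" using ts by simp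
  then have "\<exists>t. set t \<subseteq> {1, - 1} \<and> ps = map place (mids 0 0 t) \<and> ts = map triangle_at (verts 0 0 t)"
    using w hd p0 by (intro trace_walk) auto
  then obtain t where t: "set t \<subseteq> {1, - 1}" "ps = map place (mids 0 0 t)" "ts = map triangle_at (verts 0 0 t)"
    by blast
  have "distinct (verts 0 0 t)" using w t(3) by (simp add: distinct_map)
  moreover have "set (verts 0 0 t) \<subseteq> strip_verts T" using st t(3) strip_triangle by auto
  moreover have "mids 0 0 t \<noteq> []" by (cases t) auto
  then have "place (endpos 0 0 t) = last ps" using t(2) by (simp add: last_map last_mids)
  then have "height 0 (endpos 0 0 t) = 6 * int T" using j by (simp add: place_inj height_simps)
  ultimately have "t \<in> crossings T" using t(1) by (simp add: crossings_def saws_def)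
  then show "\<gamma> \<in> (\<lambda>t. (map place (mids 0 0 t), map triangle_at (verts 0 0 t))) ` crossings T"
    using g t by blast
qed

lemma bridge_sum_le_deficit:
  assumes T: "T \<ge> 1"
  shows "bridge_sum T \<le> ennreal (deficit T)"
proof -
  define \<Phi> where "\<Phi> t = (map place (mids 0 0 t), map triangle_at (verts 0 0 t))" for t
  have w: "weight (\<Phi> t) = wt t" for t
  proof -
    have p: "2 + sqrt 2 > 0" by (simp add: add_pos_nonneg)
    have "crit = (2 + sqrt 2) powr (- (1 / 2))"
      unfolding crit_def powr_minus using powr_half_sqrt[of "2 + sqrt 2"] p by (simp add: inverse_eq_divide)
    moreover have "((2 + sqrt 2) powr (- (1 / 2))) ^ n = (2 + sqrt 2) powr (- real n / 2)" for n
      using p by (subst powr_power) auto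
    ultimately have "crit ^ n = (2 + sqrt 2) powr (- real n / 2)" for n by (simp only:)
    then show ?thesis by (simp add: weight_def walk_length_def \<Phi>_def wt_def)
  qed
  have "bridge_sum T = (SUP F\<in>{F. finite F \<and> F \<subseteq> bridges T}. \<Sum>\<gamma>\<in>F. ennreal (weight \<gamma>))"
    unfolding bridge_sum_def by (rule nonneg_infsum_complete) simp
  also have "\<dots> \<le> ennreal (deficit T)"
  proof (rule SUP_least)
    fix F assume "F \<in> {F. finite F \<and> F \<subseteq> bridges T}"
    then have F: "finite F" "F \<subseteq> \<Phi> ` crossings T"
      using bridges_subset[OF T] by (auto simp: \<Phi>_def)
    \<comment> \<open>One preimage is chosen for each member of \<open>F\<close>, which makes
      \<open>\<Phi>\<close> injective on \<open>G\<close>.\<close>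
    then obtain G where G: "G \<subseteq> crossings T" "inj_on \<Phi> G" "F = \<Phi> ` G"
      by (meson subset_image_inj)
    have fG: "finite G" using F(1) G(2,3) by (simp add: finite_image_iff)
    have "(\<Sum>\<gamma>\<in>F. ennreal (weight \<gamma>)) = (\<Sum>t\<in>G. ennreal (wt t))"
      unfolding G(3) by (simp add: sum.reindex[OF G(2)] w)
    also have "\<dots> = ennreal (\<Sum>t\<in>G. wt t)"
      using wt_pos by (intro sum_ennreal) (auto intro: less_imp_le)
    also have "\<dots> \<le> ennreal (deficit T)"
      by (intro ennreal_leI crossings_le_deficit T fG G(1))
    finally show "(\<Sum>\<gamma>\<in>F. ennreal (weight \<gamma>)) \<le> ennreal (deficit T)" .
  qed
  finally show ?thesis .
qed

theorem proposition1p1: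
  shows "(\<Sum>\<^sub>\<infinity>T\<in>{1::nat..}. 1 / of_nat T * bridge_sum T ^ 3) < \<infinity>
       \<and> bridge_sum \<longlonglongrightarrow> 0
       \<and> infinite {T::nat. T \<ge> 1 \<and> bridge_sum T < ennreal (1 / ln (real T) powr (1 / 3))}"
proof (intro conjI)
  define g where "g T = 1 / real T * deficit T ^ 3" for T
  have g: "g T \<ge> 0" for T using deficit_nonneg[of T] by (cases T) (simp_all add: g_def)
  have le: "1 / of_nat T * bridge_sum T ^ 3 \<le> ennreal (g T)" if "T \<ge> 1" for T
  proof -
    have "bridge_sum T ^ 3 \<le> ennreal (deficit T) ^ 3"
      by (intro power_mono bridge_sum_le_deficit that) simp
    also have "\<dots> = ennreal (deficit T ^ 3)" by (rule ennreal_power[OF deficit_nonneg[OF that]])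
    finally have b: "bridge_sum T ^ 3 \<le> ennreal (deficit T ^ 3)" .
    have "(1 :: ennreal) / of_nat T = ennreal (1 / real T)"
      using that divide_ennreal[of 1 "real T"] by (simp add: ennreal_of_nat_eq_real_of_nat)
    then have "1 / of_nat T * bridge_sum T ^ 3 \<le> ennreal (1 / real T) * ennreal (deficit T ^ 3)"
      using b by (simp add: mult_left_mono)
    also have "\<dots> = ennreal (g T)"
      using deficit_nonneg[OF that] by (simp add: g_def flip: ennreal_mult)
    finally show ?thesis .
  qed
  \<comment> \<open>In \<open>ennreal\<close> the sum is the supremum of its finite partial sums,
    and \<open>suminf g\<close> bounds all of these.\<close>
  have "(\<Sum>\<^sub>\<infinity>T\<in>{1::nat..}. 1 / of_nat T * bridge_sum T ^ 3) =
      (SUP F\<in>{F. finite F \<and> F \<subseteq> {1::nat..}}. \<Sum>T\<in>F. 1 / of_nat T * bridge_sum T ^ 3)"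
    by (rule nonneg_infsum_complete) simp
  also have "\<dots> \<le> ennreal (suminf g)"
  proof (rule SUP_least)
    fix F :: "nat set" assume F: "F \<in> {F. finite F \<and> F \<subseteq> {1..}}"
    then have "(\<Sum>T\<in>F. 1 / of_nat T * bridge_sum T ^ 3) \<le> (\<Sum>T\<in>F. ennreal (g T))"
      by (intro sum_mono le) auto
    also have "\<dots> = ennreal (\<Sum>T\<in>F. g T)" by (rule sum_ennreal) (rule g)
    also have "\<dots> \<le> ennreal (suminf g)"
      using F g summable_deficit_over by (intro ennreal_leI sum_le_suminf) (auto simp: g_def[abs_def])
    finally show "(\<Sum>T\<in>F. 1 / of_nat T * bridge_sum T ^ 3) \<le> ennreal (suminf g)" .
  qed
  also have "\<dots> < \<infinity>" by simp
  finally show "(\<Sum>\<^sub>\<infinity>T\<in>{1::nat..}. 1 / of_nat T * bridge_sum T ^ 3) < \<infinity>" .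
  have "(\<lambda>T. ennreal (deficit T)) \<longlonglongrightarrow> ennreal 0"
    by (intro tendsto_ennrealI deficit_tendsto_0)
  then have lim: "(\<lambda>T. ennreal (deficit T)) \<longlonglongrightarrow> 0" by simp
  have ev: "eventually (\<lambda>T. bridge_sum T \<le> ennreal (deficit T)) sequentially"
    using eventually_ge_at_top[of "1 :: nat"] by eventually_elim (rule bridge_sum_le_deficit)
  show "bridge_sum \<longlonglongrightarrow> 0"
    by (rule tendsto_sandwich[OF _ ev tendsto_const lim]) simp
  show "infinite {T::nat. T \<ge> 1 \<and> bridge_sum T < ennreal (1 / ln (real T) powr (1 / 3))}"
  proof (rule infinite_super[OF _ infinite_small_deficit], clarify)
    fix T :: nat assume T: "1 \<le> T" "deficit T < 1 / ln (real T) powr (1 / 3)"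
    have "ennreal (deficit T) < ennreal (1 / ln (real T) powr (1 / 3))"
      using T(2) deficit_nonneg[OF T(1)] by (subst ennreal_less_iff)
    with bridge_sum_le_deficit[OF T(1)] show "bridge_sum T < ennreal (1 / ln (real T) powr (1 / 3))"
      by (rule le_less_trans)
  qed
qed

end
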